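(* Let $\mathcal{X},\mathcal{Y},\mathcal{Z}$ be finite sets, $p_{XY}$ a probability mass function on $\mathcal{X}\times\mathcal{Y}$ and $p_{Z|XY}$ a conditional distribution on $\mathcal{Z}$, such that $p_X,p_Y,p_Z$ have full support, and suppose $(p_{XY},p_{Z|XY})$ is computable with asymptotic security. Then the optimal rate (infimum of achievable rates) for asymptotically secure computation with privacy against both Alice and Bob is $$R^{\mathrm{AS}_1}=H(X_{\mathrm{EQ}}|Y).$$
   Context: $n$-fold problem. $(X_i,Y_i)$, $i=1,\dots,n$, are i.i.d. with law $p_{XY}$, Alice has $X^n$, Bob has $Y^n$, and $p_{Z^n|X^nY^n}(z^n|x^n,y^n)=\prod_{i=1}^n p_{Z|XY}(z_i|x_i,y_i)$. Entropies are in bits. Protocols. A protocol $\Pi_n$: each user has private randomness (the two users' private randomness and the inputs are mutually independent). They communicate over a noiseless private link over multiple rounds; in each round one user sends a message (a finite binary string), which is a function of that user's input, private randomness and all messages exchanged so far. The messages of each round $t$ belong to a prefix-free code determined by the messages exchanged before. The transcript $M$ is the concatenation of all messages and $|M|$ its length in bits. At the end Bob outputs $\hat Z^n\in\mathcal{Z}^n$ as a function of his input, his private randomness and the transcript. The rate of $\Pi_n$ is $\frac1n\mathbb{E}[|M|]$. Asymptotic security. A rate $R$ is achievable if there is a sequence of protocols $\Pi_n$, of rate at most $R$, such that for every $\epsilon>0$ there is a large enough $n$ for which $$\mathbb{E}_{X^nY^n}\|p_{\hat Z^n|X^nY^n}-p_{Z^n|X^nY^n}\|_1\le\epsilon,\quad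 I(M;Y^n,\hat Z^n|X^n)\le n\epsilon,\quad I(M;X^n|Y^n,\hat Z^n)\le n\epsilon.$$ $R^{\mathrm{AS}_1}$ is the infimum of achievable rates. $(p_{XY},p_{Z|XY})$ is computable with asymptotic security if for every $\epsilon>0$ there are a large enough $n$ and a protocol $\Pi_n$ (of any rate) satisfying these three conditions. Definition of $X_{\mathrm{EQ}}$. For distinct $x,x'\in\mathcal{X}$ write $x\sim x'$ if there exist $y\in\mathcal{Y}$, $z\in\mathcal{Z}$ with $p_{XY}(x,y)$, $p_{XY}(x',y)$, $p_{Z|XY}(z|x,y)$, $p_{Z|XY}(z|x',y)$ all positive. Write $x\equiv x'$ if $x=x'$ or there is a sequence $x=x_1,\dots,x_l=x'$ with $x_i\sim x_{i+1}$ for all $i$. Let $\mathcal{X}_1,\dots,\mathcal{X}_k$ be the equivalence classes of $\equiv$, with representatives $x_1,\dots,x_k$. $X_{\mathrm{EQ}}$ is the random variable equal to $x_i$ when $X\in\mathcal{X}_i$, so $p_{X_{\mathrm{EQ}},Y}(x_i,y)=\sum_{x\in\mathcal{X}_i}p_{XY}(x,y)$. *)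

theory Defs
  imports "HOL-Probability.Probability" "HOL-Library.Sublist"
begin

datatype user = Alice | Bob

text \<open>
  A block of inputs or outputs is a list of length \<open>n\<close>. Messages are bit strings, and a history is
  the list of the messages exchanged so far, oldest first. All observable quantities are discrete,
  so a Borel probability measure on the reals is general enough to model the private randomness of
  a user. The number of rounds is fixed; a protocol may stop earlier, or let a user skip a round,
  by means of the code that consists of the empty string only.
\<close>

record ('x, 'y, 'z) protocol =
  rand_A :: "real measure"
  rand_B :: "real measure"
  rounds :: nat
  speaker :: "bool list list \<Rightarrow> user"
  msg_code :: "bool list list \<Rightarrow> bool list set"
  msg_A :: "'x list \<Rightarrow> real \<Rightarrow> bool list list \<Rightarrow> bool list"
  msg_B :: "'y list \<Rightarrow> real \<Rightarrow> bool list list \<Rightarrow> bool list"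
  out_B :: "'y list \<Rightarrow> real \<Rightarrow> bool list \<Rightarrow> 'z list"

definition prefix_free :: "bool list set \<Rightarrow> bool" where
  "prefix_free C \<longleftrightarrow> pairwise parallel C"

definition valid_protocol :: "nat \<Rightarrow> ('x, 'y, 'z) protocol \<Rightarrow> bool" where
  "valid_protocol n \<pi> \<longleftrightarrow>
     prob_space (rand_A \<pi>) \<and> sets (rand_A \<pi>) = sets borel \<and>
     prob_space (rand_B \<pi>) \<and> sets (rand_B \<pi>) = sets borel \<and>
     (\<forall>xs h. (\<lambda>r. msg_A \<pi> xs r h) \<in> measurable borel (count_space UNIV)) \<and>
     (\<forall>ys h. (\<lambda>r. msg_B \<pi> ys r h) \<in> measurable borel (count_space UNIV)) \<and>
     (\<forall>ys m. (\<lambda>r. out_B \<pi> ys r m) \<in> measurable borel (count_space UNIV)) \<and>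
     (\<forall>h. prefix_free (msg_code \<pi> h)) \<and>
     (\<forall>xs r h. speaker \<pi> h = Alice \<longrightarrow> msg_A \<pi> xs r h \<in> msg_code \<pi> h) \<and>
     (\<forall>ys r h. speaker \<pi> h = Bob \<longrightarrow> msg_B \<pi> ys r h \<in> msg_code \<pi> h) \<and>
     (\<forall>ys r m. length (out_B \<pi> ys r m) = n)"

fun history ::
    "('x, 'y, 'z) protocol \<Rightarrow> 'x list \<Rightarrow> 'y list \<Rightarrow> real \<Rightarrow> real \<Rightarrow> nat \<Rightarrow> bool list list" where
  "history \<pi> xs ys a b 0 = []"
| "history \<pi> xs ys a b (Suc t) =
     (let h = history \<pi> xs ys a b t
      in h @ [case speaker \<pi> h of Alice \<Rightarrow> msg_A \<pi> xs a h | Bob \<Rightarrow> msg_B \<pi> ys b h])"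

definition transcript ::
    "('x, 'y, 'z) protocol \<Rightarrow> 'x list \<Rightarrow> 'y list \<Rightarrow> real \<Rightarrow> real \<Rightarrow> bool list" where
  "transcript \<pi> xs ys a b = concat (history \<pi> xs ys a b (rounds \<pi>))"

text \<open>
  A sample point \<open>(w, a, b)\<close> consists of the list \<open>w\<close> of the \<open>n\<close> input pairs and of the private
  randomness \<open>a\<close> of Alice and \<open>b\<close> of Bob.
\<close>

type_synonym ('x, 'y) sample = "('x \<times> 'y) list \<times> real \<times> real"

definition exec_space ::
    "('x \<times> 'y) pmf \<Rightarrow> nat \<Rightarrow> ('x, 'y, 'z) protocol \<Rightarrow> ('x, 'y) sample measure" where
  "exec_space P n \<pi> =
     measure_pmf (replicate_pmf n P) \<Otimes>\<^sub>M (rand_A \<pi> \<Otimes>\<^sub>M rand_B \<pi>)"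

definition input_A :: "('x, 'y) sample \<Rightarrow> 'x list" where
  "input_A = (\<lambda>(w, a, b). map fst w)"

definition input_B :: "('x, 'y) sample \<Rightarrow> 'y list" where
  "input_B = (\<lambda>(w, a, b). map snd w)"

definition transcript_rv :: "('x, 'y, 'z) protocol \<Rightarrow> ('x, 'y) sample \<Rightarrow> bool list" where
  "transcript_rv \<pi> = (\<lambda>(w, a, b). transcript \<pi> (map fst w) (map snd w) a b)"

definition output_rv :: "('x, 'y, 'z) protocol \<Rightarrow> ('x, 'y) sample \<Rightarrow> 'z list" where
  "output_rv \<pi> =
     (\<lambda>(w, a, b). out_B \<pi> (map snd w) b (transcript \<pi> (map fst w) (map snd w) a b))"

text \<open>The rate is extended-valued since the expected length may be infinite.\<close>

definition protocol_rate :: "('x \<times> 'y) pmf \<Rightarrow> nat \<Rightarrow> ('x, 'y, 'z) protocol \<Rightarrow> ennreal" where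
  "protocol_rate P n \<pi> =
     (\<integral>\<^sup>+ \<omega>. of_nat (length (transcript_rv \<pi> \<omega>)) \<partial>exec_space P n \<pi>) / of_nat n"

definition ideal_prob ::
    "('x \<Rightarrow> 'y \<Rightarrow> 'z pmf) \<Rightarrow> nat \<Rightarrow> 'x list \<Rightarrow> 'y list \<Rightarrow> 'z list \<Rightarrow> real" where
  "ideal_prob W n xs ys zs = (\<Prod>i<n. pmf (W (xs ! i) (ys ! i)) (zs ! i))"

definition output_prob ::
    "('x \<times> 'y) pmf \<Rightarrow> nat \<Rightarrow> ('x, 'y, 'z) protocol \<Rightarrow> 'x list \<Rightarrow> 'y list \<Rightarrow> 'z list \<Rightarrow> real" where
  "output_prob P n \<pi> xs ys zs =
     \<P>(\<omega> in exec_space P n \<pi>. output_rv \<pi> \<omega> = zs \<bar> input_A \<omega> = xs \<and> input_B \<omega> = ys)"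

definition correctness_error ::
    "('x \<times> 'y) pmf \<Rightarrow> ('x \<Rightarrow> 'y \<Rightarrow> 'z pmf) \<Rightarrow> nat \<Rightarrow> ('x, 'y, 'z) protocol \<Rightarrow> real" where
  "correctness_error P W n \<pi> =
     measure_pmf.expectation (replicate_pmf n P)
       (\<lambda>w. \<Sum>zs | length zs = n.
          \<bar>output_prob P n \<pi> (map fst w) (map snd w) zs - ideal_prob W n (map fst w) (map snd w) zs\<bar>)"

text \<open>
  The discrete sigma-algebras are adequate here because all random variables in question take values
  in countable types, so that the product sigma-algebras are discrete as well.
\<close>

abbreviation cond_mutual_info_bits ::
    "'s measure \<Rightarrow> ('s \<Rightarrow> 'a) \<Rightarrow> ('s \<Rightarrow> 'b) \<Rightarrow> ('s \<Rightarrow> 'c) \<Rightarrow> real" where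
  "cond_mutual_info_bits S U V T \<equiv>
     prob_space.conditional_mutual_information S 2
       (count_space UNIV) (count_space UNIV) (count_space UNIV) U V T"

definition leakage_A :: "('x \<times> 'y) pmf \<Rightarrow> nat \<Rightarrow> ('x, 'y, 'z) protocol \<Rightarrow> real" where
  "leakage_A P n \<pi> =
     cond_mutual_info_bits (exec_space P n \<pi>)
       (transcript_rv \<pi>) (\<lambda>\<omega>. (input_B \<omega>, output_rv \<pi> \<omega>)) input_A"

definition leakage_B :: "('x \<times> 'y) pmf \<Rightarrow> nat \<Rightarrow> ('x, 'y, 'z) protocol \<Rightarrow> real" where
  "leakage_B P n \<pi> =
     cond_mutual_info_bits (exec_space P n \<pi>)
       (transcript_rv \<pi>) input_A (\<lambda>\<omega>. (input_B \<omega>, output_rv \<pi> \<omega>))"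

definition eps_secure ::
    "('x \<times> 'y) pmf \<Rightarrow> ('x \<Rightarrow> 'y \<Rightarrow> 'z pmf) \<Rightarrow> nat \<Rightarrow> real \<Rightarrow> ('x, 'y, 'z) protocol \<Rightarrow> bool" where
  "eps_secure P W n \<epsilon> \<pi> \<longleftrightarrow>
     correctness_error P W n \<pi> \<le> \<epsilon> \<and>
     leakage_A P n \<pi> \<le> real n * \<epsilon> \<and>
     leakage_B P n \<pi> \<le> real n * \<epsilon>"

text \<open>
  ``There is a large enough \<open>n\<close>'' is rendered as the existence of a suitable \<open>n\<close> beyond any given
  bound; this also excludes the degenerate block length \<open>0\<close>.
\<close>

definition computable_AS :: "('x \<times> 'y) pmf \<Rightarrow> ('x \<Rightarrow> 'y \<Rightarrow> 'z pmf) \<Rightarrow> bool" where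
  "computable_AS P W \<longleftrightarrow>
     (\<forall>\<epsilon>>0. \<forall>N. \<exists>n>N. \<exists>\<pi>. valid_protocol n \<pi> \<and> eps_secure P W n \<epsilon> \<pi>)"

definition achievable_AS :: "('x \<times> 'y) pmf \<Rightarrow> ('x \<Rightarrow> 'y \<Rightarrow> 'z pmf) \<Rightarrow> ennreal \<Rightarrow> bool" where
  "achievable_AS P W R \<longleftrightarrow>
     (\<exists>\<pi>. (\<forall>n>0. valid_protocol n (\<pi> n) \<and> protocol_rate P n (\<pi> n) \<le> R) \<and>
          (\<forall>\<epsilon>>0. \<forall>N. \<exists>n>N. eps_secure P W n \<epsilon> (\<pi> n)))"

definition optimal_rate_AS :: "('x \<times> 'y) pmf \<Rightarrow> ('x \<Rightarrow> 'y \<Rightarrow> 'z pmf) \<Rightarrow> ennreal" where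
  "optimal_rate_AS P W = Inf {R. achievable_AS P W R}"

definition x_sim :: "('x \<times> 'y) pmf \<Rightarrow> ('x \<Rightarrow> 'y \<Rightarrow> 'z pmf) \<Rightarrow> 'x \<Rightarrow> 'x \<Rightarrow> bool" where
  "x_sim P W x x' \<longleftrightarrow>
     x \<noteq> x' \<and> (\<exists>y z. pmf P (x, y) > 0 \<and> pmf P (x', y) > 0 \<and>
                     pmf (W x y) z > 0 \<and> pmf (W x' y) z > 0)"

definition x_equiv :: "('x \<times> 'y) pmf \<Rightarrow> ('x \<Rightarrow> 'y \<Rightarrow> 'z pmf) \<Rightarrow> 'x \<Rightarrow> 'x \<Rightarrow> bool" where
  "x_equiv P W = (x_sim P W)\<^sup>*\<^sup>*"

lemma x_equiv_equivp: "equivp (x_equiv P W)"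
proof (rule equivpI)
  show "reflp (x_equiv P W)" by (simp add: x_equiv_def reflp_def)
  have "symp (x_sim P W)" by (auto simp: symp_def x_sim_def)
  then show "symp (x_equiv P W)" unfolding x_equiv_def by (rule symp_rtranclp)
  show "transp (x_equiv P W)" unfolding x_equiv_def by (rule transp_rtranclp)
qed

text \<open>
  The choice depends only on the predicate \<open>x_equiv P W x\<close>, that is, on the class of \<open>x\<close>.
\<close>

definition x_EQ :: "('x \<times> 'y) pmf \<Rightarrow> ('x \<Rightarrow> 'y \<Rightarrow> 'z pmf) \<Rightarrow> 'x \<Rightarrow> 'x" where
  "x_EQ P W x = (SOME x'. x_equiv P W x x')"

lemma x_EQ_representative:
  shows "x_equiv P W x (x_EQ P W x)"
    and "x_EQ P W x = x_EQ P W x' \<longleftrightarrow> x_equiv P W x x'"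
proof -
  have rep: "x_equiv P W u (x_EQ P W u)" for u
    unfolding x_EQ_def by (rule someI[of _ u]) (simp add: x_equiv_def)
  then show "x_equiv P W x (x_EQ P W x)" .
  show "x_EQ P W x = x_EQ P W x' \<longleftrightarrow> x_equiv P W x x'"
  proof
    assume "x_EQ P W x = x_EQ P W x'"
    then show "x_equiv P W x x'"
      using rep[of x] rep[of x'] x_equiv_equivp[of P W] by (metis equivp_symp equivp_transp)
  next
    assume "x_equiv P W x x'"
    then have "x_equiv P W x = x_equiv P W x'"
      using x_equiv_equivp[of P W] by (simp add: equivp_def)
    then show "x_EQ P W x = x_EQ P W x'" by (simp add: x_EQ_def)
  qed
qed

definition entropy_XEQ_given_Y :: "('x \<times> 'y) pmf \<Rightarrow> ('x \<Rightarrow> 'y \<Rightarrow> 'z pmf) \<Rightarrow> real" where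
  "entropy_XEQ_given_Y P W =
     prob_space.conditional_entropy (measure_pmf P) 2 (count_space UNIV) (count_space UNIV)
       (\<lambda>(x, y). x_EQ P W x) (\<lambda>(x, y). y)"

end

(*
  The class U of x under x_equiv is a function of (y, z) on the support.

  Lower bound: correctness therefore makes H(U^n | Y^n, Zhat^n) small. Given X^n and Y^n the transcript
  and the output have a law of the form alpha(x, m) beta(y, m, z), so Zhat^n adds nothing about U^n to
  (Y^n, M), and n H(U | Y) = H(U^n | Y^n) exceeds I(U^n; M | Y^n) <= E|M| by at most o(n).

  Structure: by the chain rules for the two leakages, taken in opposite orders, the side information
  V_i = (M, X_{>i}, Y_{<i}, Z_{<i}) satisfies I(V_i; Y_i Z_i | X_i) ~ 0 and I(V_i; X_i | Y_i Z_i) ~ 0 for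
  some i, and X_i -> (V_i, Y_i) -> Z_i is a Markov chain. So the law of V_i given x is the same, in the
  limit, for x ~ x', and hence W(. | x, y) depends on x only through its class.

  Achievability: Alice sends a Slepian-Wolf hash of U^n and Bob samples Z^n from the decoded block. The
  transcript is a function of U^n, so nothing leaks to Alice, and Bob learns only H(M | Y^n, Zhat^n)
  <= H(U^n | Y^n, Zhat^n) = o(n).
*)
theory Submission
  imports Defs
begin

text \<open>The transcript has infinite range and possibly infinite entropy, so it appears only as a
  condition: entropies are taken of finite-range variables, and the expected length is compared with
  a mutual information directly through Kraft's inequality. The actual output is only close to the
  ideal one. Since the two block laws are close in l1 norm, each block entropy is off by at most
  \<open>n\<close> times a quantity that tends to 0 with the error, which survives division by
  \<open>n\<close>.

  The side information \<open>V\<close> lives on alphabets that grow with the block length, so no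
  limit law of it is sought. Only numbers converge: the means of one test function of
  \<open>V\<close>, the conditional probability of \<open>z\<close> given \<open>(V, y)\<close>. The
  Markov chain makes its mean given \<open>(x, y)\<close> equal to the conditional probability of
  \<open>z\<close>, and the two leakage bounds carry the mean from \<open>x\<close> to a related
  \<open>x'\<close>. The resulting structure of \<open>W\<close> is what allows Bob to sample
  correctly in the protocol, although he learns only the class of each letter.\<close>

section \<open>Conditional entropy of discrete random variables\<close>

text \<open>A function of the sample point rather than of a value: entropies become expectations of
  ratios over one space, and everything depends on \<open>f\<close> only through its level
  sets.\<close>

definition prob_val :: "'a pmf \<Rightarrow> ('a \<Rightarrow> 'b) \<Rightarrow> 'a \<Rightarrow> real" where
  "prob_val p f w = pmf (map_pmf f p) (f w)"

lemma prob_val_eq: "prob_val p f w = measure_pmf.prob p {w'. f w' = f w}"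
  by (simp add: prob_val_def pmf_map vimage_def)

lemma prob_val_pos: "w \<in> set_pmf p \<Longrightarrow> prob_val p f w > 0"
  by (simp add: prob_val_def pmf_positive)

lemma prob_val_nonneg [simp]: "prob_val p f w \<ge> 0"
  by (simp add: prob_val_def)

lemma prob_val_mono:
  assumes "\<And>w'. w' \<in> set_pmf p \<Longrightarrow> f w' = f w \<Longrightarrow> g w' = g w"
  shows "prob_val p f w \<le> prob_val p g w"
  unfolding prob_val_eq
  by (rule measure_pmf.finite_measure_mono_AE) (use assms in \<open>auto simp: AE_measure_pmf_iff\<close>)

lemma prob_val_cong:
  assumes "\<And>w'. w' \<in> set_pmf p \<Longrightarrow> f w' = f w \<longleftrightarrow> g w' = g w"
  shows "prob_val p f w = prob_val p g w"
  by (intro antisym prob_val_mono) (use assms in auto)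

text \<open>Dividing by the probability of the value cancels the weight of that value and leaves
  counting measure on the support. Means of likelihood ratios are computed this way
  throughout.\<close>

lemma nn_integral_prob_val_ratio:
  assumes k: "\<And>c. k c \<ge> 0"
  shows "(\<integral>\<^sup>+w. ennreal (k (f w) / prob_val p f w) \<partial>measure_pmf p)
    = (\<integral>\<^sup>+c. ennreal (k c) \<partial>count_space (f ` set_pmf p))"
proof -
  let ?q = "map_pmf f p"
  have "(\<integral>\<^sup>+w. ennreal (k (f w) / prob_val p f w) \<partial>measure_pmf p)
    = (\<integral>\<^sup>+c. ennreal (k c / pmf ?q c) \<partial>measure_pmf ?q)"
    by (simp add: prob_val_def)
  also have "\<dots> = (\<integral>\<^sup>+c. ennreal (pmf ?q c) * ennreal (k c / pmf ?q c) \<partial>count_space UNIV)"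
    by (subst nn_integral_measure_pmf) simp
  also have "\<dots> = (\<integral>\<^sup>+c. ennreal (k c) * indicator (set_pmf ?q) c \<partial>count_space UNIV)"
    by (intro nn_integral_cong)
      (auto simp: indicator_def set_pmf_iff ennreal_mult[symmetric] k simp del: set_map_pmf)
  also have "\<dots> = (\<integral>\<^sup>+c. ennreal (k c) \<partial>count_space (f ` set_pmf p))"
    by (simp add: nn_integral_count_space_indicator)
  finally show ?thesis .
qed

lemma nn_integral_prob_val_ratio_le:
  assumes "\<And>c. k c \<ge> 0"
  shows "(\<integral>\<^sup>+w. ennreal (k (f w) / prob_val p f w) \<partial>measure_pmf p)
    \<le> (\<integral>\<^sup>+c. ennreal (k c) \<partial>count_space UNIV)"
  unfolding nn_integral_prob_val_ratio[where k=k, OF assms]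
  by (subst nn_integral_count_space_indicator)
    (auto intro!: nn_integral_mono simp: indicator_def)

lemma nn_integral_pmf_fst:
  "(\<integral>\<^sup>+a. ennreal (pmf (map_pmf (\<lambda>w. (f w, g w)) p) (a, b)) \<partial>count_space UNIV) = ennreal (pmf (map_pmf g p) b)"
proof -
  let ?q = "map_pmf (\<lambda>w. (f w, g w)) p"
  have "(\<integral>\<^sup>+a. ennreal (pmf ?q (a, b)) \<partial>count_space UNIV)
    = (\<integral>\<^sup>+c. ennreal (pmf ?q c) \<partial>count_space (range (\<lambda>a. (a, b))))"
    by (rule nn_integral_bij_count_space) (auto simp: bij_betw_def inj_on_def)
  also have "\<dots> = emeasure (measure_pmf ?q) (range (\<lambda>a. (a, b)))"
    by (rule nn_integral_pmf)
  also have "\<dots> = emeasure (measure_pmf p) (g -` {b})"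
    by (simp add: emeasure_map_pmf) (rule arg_cong[where f="emeasure (measure_pmf p)"], auto)
  finally show ?thesis
    by (simp add: pmf_map measure_pmf.emeasure_eq_measure)
qed

lemma expectation_pmf_cong:
  fixes f g :: "'a \<Rightarrow> real"
  assumes "\<And>w. w \<in> set_pmf p \<Longrightarrow> f w = g w"
  shows "measure_pmf.expectation p f = measure_pmf.expectation p g"
  by (rule integral_cong_AE) (use assms in \<open>auto simp: AE_measure_pmf_iff\<close>)

text \<open>Conditional entropy in bits. A non-integrable function has integral 0 by default, so the
  formula is trustworthy for \<open>f\<close> of finite range; \<open>g\<close> may take infinitely
  many values, as the transcript does.\<close>

definition cond_ent :: "'a pmf \<Rightarrow> ('a \<Rightarrow> 'b) \<Rightarrow> ('a \<Rightarrow> 'c) \<Rightarrow> real" where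
  "cond_ent p f g = measure_pmf.expectation p
     (\<lambda>w. log 2 (prob_val p g w / prob_val p (\<lambda>w. (f w, g w)) w))"

lemma prob_val_pair_le: "prob_val p (\<lambda>w. (f w, g w)) w \<le> prob_val p g w"
  by (rule prob_val_mono) auto

lemma cond_ent_cong:
  assumes "\<And>w w'. w \<in> set_pmf p \<Longrightarrow> w' \<in> set_pmf p \<Longrightarrow> g w = g w' \<longleftrightarrow> g' w = g' w'"
    and "\<And>w w'. w \<in> set_pmf p \<Longrightarrow> w' \<in> set_pmf p \<Longrightarrow>
      f w = f w' \<and> g w = g w' \<longleftrightarrow> f' w = f' w' \<and> g' w = g' w'"
  shows "cond_ent p f g = cond_ent p f' g'"
  unfolding cond_ent_def
proof (rule expectation_pmf_cong)
  fix w assume "w \<in> set_pmf p"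
  then have "prob_val p g w = prob_val p g' w"
    and "prob_val p (\<lambda>w. (f w, g w)) w = prob_val p (\<lambda>w. (f' w, g' w)) w"
    using assms by (auto intro!: prob_val_cong)
  then show "log 2 (prob_val p g w / prob_val p (\<lambda>w. (f w, g w)) w) =
    log 2 (prob_val p g' w / prob_val p (\<lambda>w. (f' w, g' w)) w)" by simp
qed

text \<open>The mean of the ratio under the logarithm is at most the number of values of
  \<open>f\<close>, and the logarithm lies between 0 and that ratio divided by
  \<open>ln 2\<close>.\<close>

lemma integrable_cond_ent:
  assumes fin: "finite (f ` set_pmf p)"
  shows "integrable (measure_pmf p) (\<lambda>w. log 2 (prob_val p g w / prob_val p (\<lambda>w. (f w, g w)) w))"
proof -
  let ?F = "f ` set_pmf p" and ?fg = "\<lambda>w. (f w, g w)"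
  let ?r = "\<lambda>w. prob_val p g w / prob_val p ?fg w"
  let ?k = "\<lambda>c. indicator ?F (fst c) * pmf (map_pmf g p) (snd c)"
  have "(\<integral>\<^sup>+w. ennreal (?r w) \<partial>measure_pmf p)
    = (\<integral>\<^sup>+w. ennreal (?k (?fg w) / prob_val p ?fg w) \<partial>measure_pmf p)"
    by (rule nn_integral_cong_AE) (auto simp: AE_measure_pmf_iff prob_val_def)
  also have "\<dots> \<le> (\<integral>\<^sup>+c. ennreal (?k c) \<partial>count_space UNIV)"
    by (rule nn_integral_prob_val_ratio_le) auto
  also have "\<dots> = (\<integral>\<^sup>+a. (\<integral>\<^sup>+b. ennreal (?k (a, b)) \<partial>count_space UNIV) \<partial>count_space UNIV)"
    by (rule nn_integral_fst_count_space[symmetric])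
  also have "\<dots> = (\<integral>\<^sup>+a. indicator ?F a \<partial>count_space UNIV)"
  proof (rule nn_integral_cong)
    fix a
    show "(\<integral>\<^sup>+b. ennreal (?k (a, b)) \<partial>count_space UNIV) = indicator ?F a"
      by (cases "a \<in> ?F") (simp_all add: nn_integral_pmf_eq_1)
  qed
  also have "\<dots> = of_nat (card ?F)"
    using fin by (subst nn_integral_indicator) auto
  finally have le: "(\<integral>\<^sup>+w. ennreal (?r w) \<partial>measure_pmf p) \<le> of_nat (card ?F)" .
  have "integrable (measure_pmf p) ?r"
    by (rule integrableI_nonneg) (use le in \<open>auto simp: le_less_trans of_nat_less_top\<close>)
  then have "integrable (measure_pmf p) (\<lambda>w. ?r w / ln 2)"
    by (rule integrable_divide_zero)
  then show ?thesis
  proof (rule Bochner_Integration.integrable_bound)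
    show "AE w in measure_pmf p. norm (log 2 (?r w)) \<le> norm (?r w / ln 2)"
      unfolding AE_measure_pmf_iff
    proof
      fix w assume "w \<in> set_pmf p"
      then have "prob_val p ?fg w > 0" by (rule prob_val_pos)
      with prob_val_pair_le[of p f g w] have "1 \<le> ?r w" by (simp add: field_simps)
      moreover from this have "ln (?r w) \<le> ?r w" using ln_le_minus_one[of "?r w"] by linarith
      ultimately show "norm (log 2 (?r w)) \<le> norm (?r w / ln 2)"
        using divide_right_mono[of "ln (?r w)" "?r w" "ln 2"] by (simp add: log_def)
    qed
  qed simp
qed

lemma cond_ent_nonneg: "cond_ent p f g \<ge> 0"
  unfolding cond_ent_def
proof (rule integral_nonneg_AE, unfold AE_measure_pmf_iff, rule)
  fix w assume "w \<in> set_pmf p"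
  then have "prob_val p (\<lambda>w. (f w, g w)) w > 0" by (rule prob_val_pos)
  with prob_val_pair_le[of p f g w]
  have "1 \<le> prob_val p g w / prob_val p (\<lambda>w. (f w, g w)) w" by (simp add: field_simps)
  then show "0 \<le> log 2 (prob_val p g w / prob_val p (\<lambda>w. (f w, g w)) w)"
    by (subst zero_le_log_cancel_iff) auto
qed

lemma cond_ent_chain:
  assumes "finite (f1 ` set_pmf p)" "finite (f2 ` set_pmf p)"
  shows "cond_ent p (\<lambda>w. (f1 w, f2 w)) g = cond_ent p f1 g + cond_ent p f2 (\<lambda>w. (f1 w, g w))"
proof -
  have "cond_ent p f1 g + cond_ent p f2 (\<lambda>w. (f1 w, g w)) = measure_pmf.expectation p
    (\<lambda>w. log 2 (prob_val p g w / prob_val p (\<lambda>w. (f1 w, g w)) w)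
      + log 2 (prob_val p (\<lambda>w. (f1 w, g w)) w / prob_val p (\<lambda>w. (f2 w, f1 w, g w)) w))"
    unfolding cond_ent_def
    by (rule Bochner_Integration.integral_add[symmetric]; rule integrable_cond_ent; fact)
  also have "\<dots> = cond_ent p (\<lambda>w. (f1 w, f2 w)) g"
    unfolding cond_ent_def
  proof (rule expectation_pmf_cong)
    fix w assume *: "w \<in> set_pmf p"
    have "prob_val p (\<lambda>w. ((f1 w, f2 w), g w)) w = prob_val p (\<lambda>w. (f2 w, f1 w, g w)) w"
      by (rule prob_val_cong) auto
    then show "log 2 (prob_val p g w / prob_val p (\<lambda>w. (f1 w, g w)) w)
      + log 2 (prob_val p (\<lambda>w. (f1 w, g w)) w / prob_val p (\<lambda>w. (f2 w, f1 w, g w)) w)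
      = log 2 (prob_val p g w / prob_val p (\<lambda>w. ((f1 w, f2 w), g w)) w)"
      by (simp add: prob_val_pos[OF *, THEN less_imp_neq, symmetric] log_def ln_div
          add_divide_distrib[symmetric])
  qed
  finally show ?thesis ..
qed

text \<open>A Pinsker inequality: for a likelihood ratio \<open>r\<close> the left side is a squared
  total variation defect and the right side twice a divergence in nats. It follows from the
  pointwise bound \<open>ineq\<close>, whose linear term \<open>s - 1\<close> has nonpositive mean.
  Its weaker consequence \<open>E ln r \<le> 0\<close> serves as the Gibbs inequality.\<close>

lemma expectation_defect_square_le:
  assumes pos: "\<And>w. w \<in> set_pmf p \<Longrightarrow> r w > 0"
    and le: "(\<integral>\<^sup>+w. ennreal (r w) \<partial>measure_pmf p) \<le> 1"
    and int: "integrable (measure_pmf p) (\<lambda>w. ln (r w))"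
  shows "(measure_pmf.expectation p (\<lambda>w. max 0 (1 - r w)))\<^sup>2
    \<le> - 2 * measure_pmf.expectation p (\<lambda>w. ln (r w))"
proof -
  have ae: "AE w in measure_pmf p. 0 \<le> r w"
    using pos by (auto simp: AE_measure_pmf_iff less_imp_le)
  have ir: "integrable (measure_pmf p) r"
    by (rule integrableI_nonneg) (use le ae in \<open>auto simp: le_less_trans\<close>)
  have "ennreal (measure_pmf.expectation p r) \<le> 1"
    using le by (subst nn_integral_eq_integral[OF ir ae, symmetric])
  then have Er: "measure_pmf.expectation p r \<le> 1" by simp
  let ?t = "\<lambda>w. max 0 (1 - r w)"
  have it: "integrable (measure_pmf p) ?t"
    by (rule measure_pmf.integrable_const_bound[of _ 1]) (use ae in auto)
  have it2: "integrable (measure_pmf p) (\<lambda>w. (?t w)\<^sup>2)"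
    by (rule measure_pmf.integrable_const_bound[of _ 1])
      (use ae in \<open>auto simp: abs_square_le_1 elim!: eventually_mono\<close>)
  have ineq: "(max 0 (1 - s))\<^sup>2 / 2 \<le> - ln s + (s - 1)" if "s > 0" for s :: real
  proof (cases "s \<ge> 1")
    case True
    then show ?thesis using ln_le_minus_one[OF that] by simp
  next
    case False
    \<comment> \<open>\<open>?h\<close> vanishes at 1 and has derivative
      \<open>- (x - 1)^2 / x\<close>.\<close>
    let ?h = "\<lambda>s::real. - ln s + (s - 1) - (1 - s)\<^sup>2 / 2"
    have "?h s \<ge> ?h 1"
    proof (rule DERIV_nonpos_imp_nonincreasing[of s 1 ?h])
      show "s \<le> 1" using False by simp
      fix x assume x: "s \<le> x" "x \<le> 1"
      have "(?h has_real_derivative (- (1/x) + 1 + (1 - x))) (at x)"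
        using x that by (auto intro!: derivative_eq_intros simp: field_simps power2_eq_square)
      moreover have "- (1/x) + 1 + (1 - x) \<le> 0"
        using x that sum_squares_ge_zero[of "x - 1" 0] by (simp add: field_simps power2_eq_square)
      ultimately show "\<exists>y. (?h has_real_derivative y) (at x) \<and> y \<le> 0" by blast
    qed
    then show ?thesis using False by simp
  qed
  have "(measure_pmf.expectation p ?t)\<^sup>2 \<le> measure_pmf.expectation p (\<lambda>w. (?t w)\<^sup>2)"
  proof -
    have "0 \<le> measure_pmf.variance p ?t" by (intro integral_nonneg_AE) auto
    also have "\<dots> = measure_pmf.expectation p (\<lambda>w. (?t w)\<^sup>2) - (measure_pmf.expectation p ?t)\<^sup>2"
      by (rule measure_pmf.variance_eq[OF it it2])
    finally show ?thesis by simp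
  qed
  also have "\<dots> \<le> measure_pmf.expectation p (\<lambda>w. 2 * (- ln (r w) + (r w - 1)))"
  proof (rule integral_mono_AE)
    show "AE w in measure_pmf p. (?t w)\<^sup>2 \<le> 2 * (- ln (r w) + (r w - 1))"
      unfolding AE_measure_pmf_iff using ineq[OF pos] by fastforce
  qed (use it2 int ir in auto)
  also have "\<dots> = 2 * (- measure_pmf.expectation p (\<lambda>w. ln (r w)) + (measure_pmf.expectation p r - 1))"
    using int ir by simp
  also have "\<dots> \<le> - 2 * measure_pmf.expectation p (\<lambda>w. ln (r w))" using Er by simp
  finally show ?thesis .
qed

text \<open>\<open>r\<close> is the ratio between the law that makes \<open>f\<close> and
  \<open>h\<close> independent given \<open>g\<close> and the true law, so \<open>- E ln r\<close>
  is \<open>ln 2\<close> times the conditional mutual information in bits. Its mean is at most 1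
  because the independent law has total mass at most 1.\<close>

lemma cond_ent_indep_ratio:
  fixes f :: "'a \<Rightarrow> 'b" and g :: "'a \<Rightarrow> 'c" and h :: "'a \<Rightarrow> 'd" and p :: "'a pmf"
  assumes fin: "finite (f ` set_pmf p)"
  defines "r \<equiv> \<lambda>w. prob_val p (\<lambda>w. (f w, g w)) w * prob_val p (\<lambda>w. (h w, g w)) w
    / (prob_val p g w * prob_val p (\<lambda>w. (f w, h w, g w)) w)"
  shows "(measure_pmf.expectation p (\<lambda>w. max 0 (1 - r w)))\<^sup>2
    \<le> 2 * ln 2 * (cond_ent p f g - cond_ent p f (\<lambda>w. (h w, g w)))"
proof -
  have pos: "r w > 0" if "w \<in> set_pmf p" for w
    unfolding r_def by (simp add: prob_val_pos[OF that])
  have ln_r: "ln (r w) = - ln 2 * (log 2 (prob_val p g w / prob_val p (\<lambda>w. (f w, g w)) w)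
    - log 2 (prob_val p (\<lambda>w. (h w, g w)) w / prob_val p (\<lambda>w. (f w, h w, g w)) w))"
    if "w \<in> set_pmf p" for w
    unfolding r_def log_def
    by (simp add: prob_val_pos[OF that, THEN less_imp_neq, symmetric] ln_div ln_mult
        diff_divide_distrib[symmetric])
  note i1 = integrable_cond_ent[OF fin, of g]
  note i2 = integrable_cond_ent[OF fin, of "\<lambda>w. (h w, g w)"]
  let ?L = "\<lambda>w. - ln 2 * (log 2 (prob_val p g w / prob_val p (\<lambda>w. (f w, g w)) w)
    - log 2 (prob_val p (\<lambda>w. (h w, g w)) w / prob_val p (\<lambda>w. (f w, h w, g w)) w))"
  have iL: "integrable (measure_pmf p) ?L"
    by (intro Bochner_Integration.integrable_mult_right Bochner_Integration.integrable_diff i1 i2)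
  have ae: "AE w in measure_pmf p. ?L w = ln (r w)"
    unfolding AE_measure_pmf_iff using ln_r by simp
  have il: "integrable (measure_pmf p) (\<lambda>w. ln (r w))"
    by (rule integrable_cong_AE_imp[OF iL]) (use ae in auto)
  have "measure_pmf.expectation p (\<lambda>w. ln (r w)) = measure_pmf.expectation p ?L"
    by (rule integral_cong_AE) (use ae in \<open>auto elim!: eventually_mono\<close>)
  also have "\<dots> = - ln 2 * (cond_ent p f g - cond_ent p f (\<lambda>w. (h w, g w)))"
    unfolding cond_ent_def using i1 i2 by simp
  finally have El: "measure_pmf.expectation p (\<lambda>w. ln (r w))
    = - ln 2 * (cond_ent p f g - cond_ent p f (\<lambda>w. (h w, g w)))" .
  let ?P3 = "map_pmf (\<lambda>w. (f w, h w, g w)) p"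
  let ?Pf = "\<lambda>a c. pmf (map_pmf (\<lambda>w. (f w, g w)) p) (a, c)"
  let ?Ph = "\<lambda>b c. pmf (map_pmf (\<lambda>w. (h w, g w)) p) (b, c)"
  let ?Pg = "\<lambda>c. pmf (map_pmf g p) c"
  let ?k = "\<lambda>(a, b, c). ?Pf a c * ?Ph b c / ?Pg c"
  have "(\<integral>\<^sup>+w. ennreal (r w) \<partial>measure_pmf p)
    = (\<integral>\<^sup>+w. ennreal (?k (f w, h w, g w) / prob_val p (\<lambda>w. (f w, h w, g w)) w) \<partial>measure_pmf p)"
    by (simp add: r_def prob_val_def)
  also have "\<dots> \<le> (\<integral>\<^sup>+c. ennreal (?k c) \<partial>count_space UNIV)"
    by (rule nn_integral_prob_val_ratio_le) auto
  also have "\<dots> = (\<integral>\<^sup>+a. \<integral>\<^sup>+bc. ennreal (?k (a, bc)) \<partial>count_space UNIV \<partial>count_space UNIV)"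
    by (rule nn_integral_fst_count_space[symmetric])
  \<comment> \<open>Summing over the value of \<open>f\<close> first leaves the joint law of
    \<open>h\<close> and \<open>g\<close>.\<close>
  also have "\<dots> = (\<integral>\<^sup>+bc. \<integral>\<^sup>+a. ennreal (?k (a, bc)) \<partial>count_space UNIV \<partial>count_space UNIV)"
    by (subst nn_integral_fst_count_space, subst nn_integral_snd_count_space[symmetric]) simp
  also have "\<dots> \<le> (\<integral>\<^sup>+bc. ennreal (?Ph (fst bc) (snd bc)) \<partial>count_space UNIV)"
  proof (rule nn_integral_mono)
    fix bc :: "'d \<times> 'c"
    obtain b c where bc: "bc = (b, c)" by fastforce
    have "(\<integral>\<^sup>+a. ennreal (?k (a, bc)) \<partial>count_space UNIV)
      = (\<integral>\<^sup>+a. ennreal (?Pf a c) * ennreal (?Ph b c / ?Pg c) \<partial>count_space UNIV)"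
      by (simp add: bc ennreal_mult[symmetric])
    also have "\<dots> = (\<integral>\<^sup>+a. ennreal (?Pf a c) \<partial>count_space UNIV) * ennreal (?Ph b c / ?Pg c)"
      by (rule nn_integral_multc) simp
    also have "\<dots> = ennreal (?Pg c) * ennreal (?Ph b c / ?Pg c)"
      by (simp add: nn_integral_pmf_fst)
    also have "\<dots> \<le> ennreal (?Ph b c)"
      by (cases "?Pg c = 0") (auto simp: ennreal_mult[symmetric])
    finally show "(\<integral>\<^sup>+a. ennreal (?k (a, bc)) \<partial>count_space UNIV) \<le> ennreal (?Ph (fst bc) (snd bc))"
      by (simp add: bc)
  qed
  also have "\<dots> = 1" by (simp add: nn_integral_pmf_eq_1)
  finally have le: "(\<integral>\<^sup>+w. ennreal (r w) \<partial>measure_pmf p) \<le> 1" .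
  show ?thesis
    using expectation_defect_square_le[OF pos le il] unfolding El by (simp add: algebra_simps)
qed

section \<open>Monotonicity and chain rules of conditional entropy\<close>

lemma cond_ent_condition_le:
  assumes "finite (f ` set_pmf p)"
  shows "cond_ent p f (\<lambda>w. (h w, g w)) \<le> cond_ent p f g"
proof -
  have "0 \<le> 2 * ln 2 * (cond_ent p f g - cond_ent p f (\<lambda>w. (h w, g w)))"
    by (rule order_trans[OF zero_le_power2 cond_ent_indep_ratio[OF assms]])
  then show ?thesis by (simp add: zero_le_mult_iff)
qed

lemma cond_ent_mono_cond:
  assumes fin: "finite (f ` set_pmf p)"
    and "\<And>w w'. w \<in> set_pmf p \<Longrightarrow> w' \<in> set_pmf p \<Longrightarrow> h w = h w' \<Longrightarrow> g w = g w'"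
  shows "cond_ent p f h \<le> cond_ent p f g"
proof -
  have "cond_ent p f h = cond_ent p f (\<lambda>w. (h w, g w))"
    by (rule cond_ent_cong) (use assms(2) in blast)+
  with cond_ent_condition_le[OF fin, of h g] show ?thesis by simp
qed

lemma cond_ent_mono_val:
  assumes fin: "finite (f ` set_pmf p)" "finite (f' ` set_pmf p)"
    and *: "\<And>w w'. w \<in> set_pmf p \<Longrightarrow> w' \<in> set_pmf p \<Longrightarrow> f' w = f' w' \<Longrightarrow> f w = f w'"
  shows "cond_ent p f g \<le> cond_ent p f' g"
proof -
  have "cond_ent p f' g = cond_ent p (\<lambda>w. (f w, f' w)) g"
    by (rule cond_ent_cong) (use * in blast)+
  also have "\<dots> = cond_ent p f g + cond_ent p f' (\<lambda>w. (f w, g w))"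
    by (rule cond_ent_chain[OF fin])
  finally show ?thesis using cond_ent_nonneg[of p f' "\<lambda>w. (f w, g w)"] by simp
qed

text \<open>A constant condition turns \<open>cond_ent\<close> into plain entropy. This form reduces
  continuity of conditional entropy to continuity of finite entropy sums.\<close>

lemma cond_ent_eq_diff:
  assumes "finite (f ` set_pmf p)" "finite (g ` set_pmf p)"
  shows "cond_ent p f g = cond_ent p (\<lambda>w. (f w, g w)) (\<lambda>_. ()) - cond_ent p g (\<lambda>_. ())"
proof -
  have "cond_ent p (\<lambda>w. (f w, g w)) (\<lambda>_. ()) = cond_ent p (\<lambda>w. (g w, f w)) (\<lambda>_. ())"
    by (rule cond_ent_cong) auto
  also have "\<dots> = cond_ent p g (\<lambda>_. ()) + cond_ent p f (\<lambda>w. (g w, ()))"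
    by (rule cond_ent_chain) (use assms in auto)
  also have "cond_ent p f (\<lambda>w. (g w, ())) = cond_ent p f g"
    by (rule cond_ent_cong) auto
  finally show ?thesis by simp
qed

text \<open>
  \<open>S k\<close> stands for the first \<open>k\<close> variables in an arbitrary order, so that the lemma covers both
  the forward and the backward chain rule.
\<close>

lemma cond_ent_chain_sum:
  fixes F :: "nat \<Rightarrow> 'a \<Rightarrow> 'b" and S :: "nat \<Rightarrow> 'a \<Rightarrow> 'c"
  assumes finF: "\<And>k. k < n \<Longrightarrow> finite (F k ` set_pmf p)"
    and finS: "\<And>k. k \<le> n \<Longrightarrow> finite (S k ` set_pmf p)"
    and S0: "\<And>w w'. w \<in> set_pmf p \<Longrightarrow> w' \<in> set_pmf p \<Longrightarrow> S 0 w = S 0 w'"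
    and step: "\<And>k w w'. k < n \<Longrightarrow> w \<in> set_pmf p \<Longrightarrow> w' \<in> set_pmf p \<Longrightarrow>
      S (Suc k) w = S (Suc k) w' \<longleftrightarrow> S k w = S k w' \<and> F k w = F k w'"
  shows "cond_ent p (S n) g = (\<Sum>k<n. cond_ent p (F k) (\<lambda>w. (S k w, g w)))"
proof -
  have "m \<le> n \<Longrightarrow> cond_ent p (S m) g = (\<Sum>k<m. cond_ent p (F k) (\<lambda>w. (S k w, g w)))" for m
  proof (induction m)
    case 0
    have "cond_ent p (S 0) g = cond_ent p (\<lambda>_. ()) g"
      by (rule cond_ent_cong) (use S0 in blast)+
    also have "\<dots> = 0"
    proof -
      have "prob_val p (\<lambda>w. ((), g w)) w = prob_val p g w" for w
        by (rule prob_val_cong) auto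
      then have "log 2 (prob_val p g w / prob_val p (\<lambda>w. ((), g w)) w) = 0" for w
        by (cases "prob_val p g w = 0") (auto simp: log_def)
      then show ?thesis by (simp add: cond_ent_def)
    qed
    finally show ?case by simp
  next
    case (Suc m)
    have "cond_ent p (S (Suc m)) g = cond_ent p (\<lambda>w. (S m w, F m w)) g"
      by (rule cond_ent_cong) (use step[of m] Suc.prems in \<open>simp_all add: Suc_le_eq\<close>)
    also have "\<dots> = cond_ent p (S m) g + cond_ent p (F m) (\<lambda>w. (S m w, g w))"
      by (rule cond_ent_chain) (use Suc.prems finF[of m] finS[of m] in simp_all)
    finally show ?case using Suc by simp
  qed
  then show ?thesis by simp
qed

lemma cond_ent_map:
  "cond_ent (map_pmf \<phi> p) f g = cond_ent p (\<lambda>w. f (\<phi> w)) (\<lambda>w. g (\<phi> w))"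
  by (simp add: cond_ent_def prob_val_def map_pmf_comp)

text \<open>
  Plays the role of Pinsker's inequality: a small \<open>I(f; h | g)\<close> makes every test function of \<open>h\<close> nearly
  independent of \<open>f\<close> given \<open>g\<close>.
\<close>

lemma test_function_deviation_le:
  fixes f :: "'a \<Rightarrow> 'b" and g :: "'a \<Rightarrow> 'c" and h :: "'a \<Rightarrow> 'd" and p :: "'a pmf"
  assumes fin: "finite (f ` set_pmf p)"
    and phi: "\<And>v. 0 \<le> \<phi> v" "\<And>v. \<phi> v \<le> (1::real)"
  defines "D \<equiv> sqrt (2 * ln 2 * (cond_ent p f g - cond_ent p f (\<lambda>w. (h w, g w))))"
  shows "measure_pmf.expectation p (\<lambda>w. \<phi> (h w) * indicator {w. f w = a \<and> g w = c} w) \<le>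
    measure_pmf.prob p {w. f w = a \<and> g w = c} *
      (measure_pmf.expectation p (\<lambda>w. \<phi> (h w) * indicator {w. g w = c} w)
        / measure_pmf.prob p {w. g w = c}) + D"
proof -
  define r where "r = (\<lambda>w. prob_val p (\<lambda>w. (f w, g w)) w * prob_val p (\<lambda>w. (h w, g w)) w
    / (prob_val p g w * prob_val p (\<lambda>w. (f w, h w, g w)) w))"
  let ?I = "indicator {w. f w = a \<and> g w = c} :: 'a \<Rightarrow> real"
  let ?Ph = "\<lambda>b. pmf (map_pmf (\<lambda>w. (h w, g w)) p) (b, c)"
  let ?Pac = "measure_pmf.prob p {w. f w = a \<and> g w = c}" and ?Pc = "measure_pmf.prob p {w. g w = c}"
  let ?Ec = "measure_pmf.expectation p (\<lambda>w. \<phi> (h w) * indicator {w. g w = c} w)"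
  let ?k = "\<lambda>(a', b, c'). (if a' = a \<and> c' = c then \<phi> b * ?Ph b else 0) * (?Pac / ?Pc)"
  have Ec_nn: "?Ec \<ge> 0" by (intro integral_nonneg_AE) (auto simp: phi)
  have iE: "integrable (measure_pmf p) (\<lambda>w. \<phi> (h w) * indicator {w. g w = c} w)"
    by (rule measure_pmf.integrable_const_bound[of _ 1]) (auto simp: phi indicator_def)
  \<comment> \<open>Weighting by \<open>r\<close> replaces the true law by the one with
    \<open>f\<close> and \<open>h\<close> independent given \<open>g\<close>; there the mean factors
    into the main term of the claim.\<close>
  have "(\<integral>\<^sup>+w. ennreal (\<phi> (h w) * ?I w * r w) \<partial>measure_pmf p)
    = (\<integral>\<^sup>+w. ennreal (?k (f w, h w, g w) / prob_val p (\<lambda>w. (f w, h w, g w)) w) \<partial>measure_pmf p)"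
  proof (rule nn_integral_cong)
    fix w
    have "f w = a \<Longrightarrow> g w = c \<Longrightarrow> prob_val p (\<lambda>w. (f w, g w)) w = ?Pac"
      "g w = c \<Longrightarrow> prob_val p g w = ?Pc"
      by (simp_all add: prob_val_eq)
    moreover have "prob_val p (\<lambda>w. (h w, g w)) w = ?Ph (h w)" if "g w = c"
      using that by (simp add: prob_val_def)
    ultimately show "ennreal (\<phi> (h w) * ?I w * r w)
      = ennreal (?k (f w, h w, g w) / prob_val p (\<lambda>w. (f w, h w, g w)) w)"
      by (cases "f w = a \<and> g w = c") (auto simp: r_def mult_ac)
  qed
  also have "\<dots> \<le> (\<integral>\<^sup>+c. ennreal (?k c) \<partial>count_space UNIV)"
    by (rule nn_integral_prob_val_ratio_le) (auto simp: phi)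
  also have "\<dots> = (\<integral>\<^sup>+c. ennreal (?k c) \<partial>count_space (range (\<lambda>b. (a, b, c))))"
    by (subst (2) nn_integral_count_space_indicator)
      (auto intro!: nn_integral_cong simp: indicator_def image_def)
  also have "\<dots> = (\<integral>\<^sup>+b. ennreal (?k (a, b, c)) \<partial>count_space UNIV)"
    by (rule nn_integral_bij_count_space[symmetric]) (auto simp: bij_betw_def inj_on_def)
  also have "\<dots> = (\<integral>\<^sup>+b. ennreal (\<phi> b * ?Ph b) * ennreal (?Pac / ?Pc) \<partial>count_space UNIV)"
    by (simp add: ennreal_mult[symmetric] phi)
  also have "\<dots> = (\<integral>\<^sup>+b. ennreal (\<phi> b * ?Ph b) \<partial>count_space UNIV) * ennreal (?Pac / ?Pc)"
    by (rule nn_integral_multc) simp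
  also have "(\<integral>\<^sup>+b. ennreal (\<phi> b * ?Ph b) \<partial>count_space UNIV)
    = (\<integral>\<^sup>+bc. ennreal (\<phi> (fst bc) * indicator {c} (snd bc)) \<partial>measure_pmf (map_pmf (\<lambda>w. (h w, g w)) p))"
  proof -
    let ?q = "map_pmf (\<lambda>w. (h w, g w)) p"
    have "(\<integral>\<^sup>+bc. ennreal (\<phi> (fst bc) * indicator {c} (snd bc)) \<partial>measure_pmf ?q)
      = (\<integral>\<^sup>+bc. ennreal (pmf ?q bc * (\<phi> (fst bc) * indicator {c} (snd bc))) \<partial>count_space UNIV)"
      by (subst nn_integral_measure_pmf) (simp add: ennreal_mult phi)
    also have "\<dots> = (\<integral>\<^sup>+bc. ennreal (pmf ?q bc * (\<phi> (fst bc) * indicator {c} (snd bc)))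
        \<partial>count_space (range (\<lambda>b. (b, c))))"
      by (subst (2) nn_integral_count_space_indicator)
        (auto intro!: nn_integral_cong simp: indicator_def image_def)
    also have "\<dots> = (\<integral>\<^sup>+b. ennreal (pmf ?q (b, c) * (\<phi> (fst (b, c)) * indicator {c} (snd (b, c)))) \<partial>count_space UNIV)"
      by (rule nn_integral_bij_count_space[symmetric]) (auto simp: bij_betw_def inj_on_def)
    finally show ?thesis by (simp add: mult.commute)
  qed
  also have "\<dots> = (\<integral>\<^sup>+w. ennreal (\<phi> (h w) * indicator {w. g w = c} w) \<partial>measure_pmf p)"
    by (auto intro!: nn_integral_cong simp: indicator_def)
  also have "\<dots> = ennreal ?Ec"
    by (rule nn_integral_eq_integral[OF iE]) (auto simp: phi)
  also have "ennreal ?Ec * ennreal (?Pac / ?Pc) = ennreal (?Pac * (?Ec / ?Pc))"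
    by (simp add: ennreal_mult[symmetric] Ec_nn field_simps)
  finally have le: "(\<integral>\<^sup>+w. ennreal (\<phi> (h w) * ?I w * r w) \<partial>measure_pmf p) \<le> ennreal (?Pac * (?Ec / ?Pc))" .
  have r_nn: "r w \<ge> 0" for w by (simp add: r_def)
  have ir: "integrable (measure_pmf p) (\<lambda>w. \<phi> (h w) * ?I w * r w)"
    by (rule integrableI_nonneg) (use le in \<open>auto simp: phi r_nn le_less_trans\<close>)
  have Er: "measure_pmf.expectation p (\<lambda>w. \<phi> (h w) * ?I w * r w) \<le> ?Pac * (?Ec / ?Pc)"
  proof -
    have "ennreal (measure_pmf.expectation p (\<lambda>w. \<phi> (h w) * ?I w * r w)) \<le> ennreal (?Pac * (?Ec / ?Pc))"
      using le by (subst nn_integral_eq_integral[OF ir, symmetric]) (auto simp: phi r_nn)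
    then show ?thesis using Ec_nn by (subst (asm) ennreal_le_iff) auto
  qed
  have it: "integrable (measure_pmf p) (\<lambda>w. max 0 (1 - r w))"
    by (rule measure_pmf.integrable_const_bound[of _ 1]) (auto simp: r_nn)
  have "measure_pmf.expectation p (\<lambda>w. max 0 (1 - r w)) \<le> D"
    unfolding D_def r_def by (rule real_le_rsqrt) (rule cond_ent_indep_ratio[OF fin])
  \<comment> \<open>Dropping the weight \<open>r\<close> costs at most the positive part of
    \<open>1 - r\<close>, because the test function is bounded by 1.\<close>
  moreover have "measure_pmf.expectation p (\<lambda>w. \<phi> (h w) * ?I w)
    \<le> measure_pmf.expectation p (\<lambda>w. \<phi> (h w) * ?I w * r w + max 0 (1 - r w))"
  proof (rule integral_mono)
    show "integrable (measure_pmf p) (\<lambda>w. \<phi> (h w) * ?I w)"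
      by (rule measure_pmf.integrable_const_bound[of _ 1]) (auto simp: phi indicator_def)
    fix w
    have "x * (1 - s) \<le> max 0 (1 - s)" if "0 \<le> x" "x \<le> 1" for x s :: real
    proof (cases "s \<le> 1")
      case True then show ?thesis using that mult_right_mono[of x 1 "1 - s"] by simp
    next
      case False then show ?thesis using that mult_nonneg_nonpos[of x "1 - s"] by simp
    qed
    from this[of "\<phi> (h w) * ?I w" "r w"] phi[of "h w"]
    show "\<phi> (h w) * ?I w \<le> \<phi> (h w) * ?I w * r w + max 0 (1 - r w)"
      by (auto simp: indicator_def right_diff_distrib)
  qed (intro Bochner_Integration.integrable_add ir it)
  ultimately show ?thesis
    using Er unfolding Bochner_Integration.integral_add[OF ir it] by linarith
qed

section \<open>Blocks of independent letters and continuity of entropy\<close>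

lemma measure_pair_pmf_Times:
  "measure_pmf.prob (pair_pmf M N) (A \<times> B) = measure_pmf.prob M A * measure_pmf.prob N B"
proof -
  \<comment> \<open>Cutting both factors down to the supports makes them countable.\<close>
  have "measure_pmf.prob (pair_pmf M N) (A \<times> B)
    = measure_pmf.prob (pair_pmf M N) ((A \<inter> set_pmf M) \<times> (B \<inter> set_pmf N))"
    by (subst measure_Int_set_pmf[symmetric]) (auto intro!: arg_cong[where f="measure _"])
  also have "\<dots> = measure_pmf.prob M (A \<inter> set_pmf M) * measure_pmf.prob N (B \<inter> set_pmf N)"
    by (rule measure_pmf_prob_product) auto
  finally show ?thesis by (simp add: measure_Int_set_pmf)
qed

lemma replicate_pmf_Suc_pair:
  "replicate_pmf (Suc n) p = map_pmf (\<lambda>(x, xs). x # xs) (pair_pmf p (replicate_pmf n p))"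
  by (simp add: pair_pmf_def map_bind_pmf)

lemma prob_replicate_pmf:
  "measure_pmf.prob (replicate_pmf n p) {l. \<forall>i<n. l ! i \<in> A i} = (\<Prod>i<n. measure_pmf.prob p (A i))"
proof (induction n arbitrary: A)
  case 0
  then show ?case by simp
next
  case (Suc n)
  have "(\<lambda>(x, xs). x # xs) -` {l. \<forall>i<Suc n. l ! i \<in> A i} = A 0 \<times> {l. \<forall>i<n. l ! i \<in> A (Suc i)}"
    by (auto simp: less_Suc_eq_0_disj)
  then show ?case
    unfolding replicate_pmf_Suc_pair measure_map_pmf
    by (simp add: measure_pair_pmf_Times Suc prod.lessThan_Suc_shift del: prod.lessThan_Suc)
qed

lemma length_replicate_pmf: "l \<in> set_pmf (replicate_pmf n p) \<Longrightarrow> length l = n"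
  by (auto simp: set_replicate_pmf)

lemma pmf_replicate_pmf:
  assumes "length l = n"
  shows "pmf (replicate_pmf n p) l = (\<Prod>i<n. pmf p (l ! i))"
proof -
  have "pmf (replicate_pmf n p) l = measure_pmf.prob (replicate_pmf n p) {l'. \<forall>i<n. l' ! i \<in> {l ! i}}"
    unfolding measure_pmf_single[symmetric]
    by (rule measure_pmf.finite_measure_eq_AE)
      (auto simp: AE_measure_pmf_iff assms intro!: nth_equalityI dest: length_replicate_pmf)
  also have "\<dots> = (\<Prod>i<n. pmf p (l ! i))"
    unfolding prob_replicate_pmf by (simp add: measure_pmf_single)
  finally show ?thesis .
qed

lemma map_nth_replicate_pmf:
  assumes "i < n"
  shows "map_pmf (\<lambda>l. l ! i) (replicate_pmf n p) = p"
proof (rule pmf_eqI)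
  fix x
  have "pmf (map_pmf (\<lambda>l. l ! i) (replicate_pmf n p)) x
    = measure_pmf.prob (replicate_pmf n p) {l. \<forall>j<n. l ! j \<in> (if j = i then {x} else UNIV)}"
    unfolding pmf_map using assms by (intro arg_cong[where f="measure _"]) (auto split: if_splits)
  also have "\<dots> = (\<Prod>j<n. if j = i then pmf p x else 1)"
    unfolding prob_replicate_pmf by (intro prod.cong) (auto simp: measure_pmf_single)
  also have "\<dots> = pmf p x" using assms by simp
  finally show "pmf (map_pmf (\<lambda>l. l ! i) (replicate_pmf n p)) x = pmf p x" .
qed

lemma map_map_replicate_pmf:
  "map_pmf (map f) (replicate_pmf n p) = replicate_pmf n (map_pmf f p)"
proof (induction n)
  case (Suc n)
  show ?case by (simp add: map_bind_pmf bind_map_pmf Suc[symmetric])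
qed simp

lemma finite_set_replicate_pmf: "finite (set_pmf p) \<Longrightarrow> finite (set_pmf (replicate_pmf n p))"
  using finite_lists_length_eq[of "set_pmf p" n] by (simp add: set_replicate_pmf in_lists_conv_set subset_eq)

lemma nth_replicate_pmf_in: "l \<in> set_pmf (replicate_pmf n p) \<Longrightarrow> i < n \<Longrightarrow> l ! i \<in> set_pmf p"
  by (auto simp: set_replicate_pmf in_lists_conv_set)

lemma prob_val_replicate_pmf:
  assumes "length l = n"
  shows "prob_val (replicate_pmf n p) (map f) l = (\<Prod>i<n. prob_val p f (l ! i))"
  unfolding prob_val_def map_map_replicate_pmf using assms by (simp add: pmf_replicate_pmf)

text \<open>The ratio under the logarithm is a product over the coordinates, and each coordinate has
  the marginal law \<open>p\<close>.\<close>

lemma cond_ent_replicate_pmf: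
  assumes fin: "finite (set_pmf p)"
  shows "cond_ent (replicate_pmf n p) (map f) (map g) = n * cond_ent p f g"
proof -
  let ?q = "replicate_pmf n p"
  let ?r = "\<lambda>w. prob_val p g w / prob_val p (\<lambda>w. (f w, g w)) w"
  have finq: "finite (set_pmf ?q)" using fin by (rule finite_set_replicate_pmf)
  have "cond_ent ?q (map f) (map g) = measure_pmf.expectation ?q (\<lambda>l. \<Sum>i<n. log 2 (?r (l ! i)))"
    unfolding cond_ent_def
  proof (rule expectation_pmf_cong)
  fix l assume l: "l \<in> set_pmf ?q"
  then have len: "length l = n" by (rule length_replicate_pmf)
  have "prob_val ?q (\<lambda>w. (map f w, map g w)) l = prob_val ?q (map (\<lambda>x. (f x, g x))) l"
  proof (rule prob_val_cong)
    fix l' assume "l' \<in> set_pmf ?q"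
    then have "length l' = length l" by (simp add: len length_replicate_pmf)
    then show "(map f l', map g l') = (map f l, map g l)
      \<longleftrightarrow> map (\<lambda>x. (f x, g x)) l' = map (\<lambda>x. (f x, g x)) l"
      by (auto simp: list_eq_iff_nth_eq)
  qed
  then have "prob_val ?q (map g) l / prob_val ?q (\<lambda>w. (map f w, map g w)) l = (\<Prod>i<n. ?r (l ! i))"
    by (simp add: prob_val_replicate_pmf len prod_dividef)
  moreover have "log 2 (\<Prod>i<n. ?r (l ! i)) = (\<Sum>i<n. log 2 (?r (l ! i)))"
  proof -
    have "ln (\<Prod>i<n. ?r (l ! i)) = (\<Sum>i<n. ln (?r (l ! i)))"
      by (intro ln_prod)
        (simp_all add: prob_val_pos[OF nth_replicate_pmf_in[OF l], THEN less_imp_neq, symmetric])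
    then show ?thesis
      unfolding log_def by (simp add: sum_divide_distrib)
  qed
  ultimately show "log 2 (prob_val ?q (map g) l / prob_val ?q (\<lambda>w. (map f w, map g w)) l)
    = (\<Sum>i<n. log 2 (?r (l ! i)))" by simp
  qed
  also have "\<dots> = (\<Sum>i<n. measure_pmf.expectation ?q (\<lambda>l. log 2 (?r (l ! i))))"
    by (rule Bochner_Integration.integral_sum) (rule integrable_measure_pmf_finite[OF finq])
  also have "\<dots> = (\<Sum>i<n. cond_ent p f g)"
  proof (rule sum.cong)
    fix i assume "i \<in> {..<n}"
    then have "map_pmf (\<lambda>l. l ! i) ?q = p" by (simp add: map_nth_replicate_pmf)
    then have "measure_pmf.expectation ?q (\<lambda>l. log 2 (?r (l ! i)))
      = measure_pmf.expectation p (\<lambda>x. log 2 (?r x))"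
      using integral_map_pmf[of "\<lambda>l. l ! i" ?q "\<lambda>x. log 2 (?r x)"] by simp
    then show "measure_pmf.expectation ?q (\<lambda>l. log 2 (?r (l ! i))) = cond_ent p f g"
      by (simp add: cond_ent_def)
  qed simp
  finally show ?thesis by simp
qed

text \<open>\<open>d\<close> and \<open>e\<close> are the positive and negative parts of
  \<open>p - q\<close>. Subadditivity of \<open>?\<eta>\<close> bounds the cost of adding
  \<open>d\<close>; its slope of at least -1 on the unit interval bounds the cost of removing
  \<open>e\<close> by the mass of \<open>e\<close>. The usual term \<open>- T ln T\<close> is
  replaced by \<open>2 * sqrt T\<close>, which is monotone in \<open>T\<close>. Units are
  nats.\<close>

lemma sum_entropy_diff_le:
  fixes p q :: "'a pmf"
  assumes fin: "finite A" and p: "set_pmf p \<subseteq> A" and q: "set_pmf q \<subseteq> A"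
    and T: "(\<Sum>a\<in>A. \<bar>pmf p a - pmf q a\<bar>) \<le> T"
  shows "(\<Sum>a\<in>A. - pmf p a * ln (pmf p a))
    \<le> (\<Sum>a\<in>A. - pmf q a * ln (pmf q a)) + (T * (1 + ln (card A)) + 2 * sqrt T)"
proof -
  let ?\<eta> = "\<lambda>t::real. - t * ln t"
  define d where "d = (\<lambda>a. max 0 (pmf p a - pmf q a))"
  define e where "e = (\<lambda>a. max 0 (pmf q a - pmf p a))"
  define s where "s = sum d A"
  have K: "real (card A) \<ge> 1"
    using fin set_pmf_not_empty[of p] p by (cases "card A") auto
  have d0: "d a \<ge> 0" for a by (simp add: d_def)
  have s0: "s \<ge> 0" by (simp add: s_def d0 sum_nonneg)
  have sT: "s \<le> T"
    unfolding s_def by (rule order_trans[OF _ T]) (auto intro!: sum_mono simp: d_def)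
  have eT: "sum e A \<le> T"
    by (rule order_trans[OF _ T]) (auto intro!: sum_mono simp: e_def)
  have sub: "?\<eta> (x + y) \<le> ?\<eta> x + ?\<eta> y" if "x \<ge> 0" "y \<ge> 0" for x y
  proof (cases "x = 0 \<or> y = 0")
    case False
    with that have "x > 0" "y > 0" by auto
    then have "x * ln x \<le> x * ln (x + y)" "y * ln y \<le> y * ln (x + y)"
      by (auto intro!: mult_left_mono)
    then show ?thesis by (simp add: algebra_simps)
  qed auto
  \<comment> \<open>The derivative of \<open>?\<eta>\<close> is at least -1 on
    \<open>(0, 1]\<close>.\<close>
  have low: "?\<eta> m - z \<le> ?\<eta> (m + z)" if "m \<ge> 0" "z \<ge> 0" "m + z \<le> 1" for m z
  proof (cases "m = 0 \<or> z = 0")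
    case True
    then show ?thesis
    proof
      assume "m = 0"
      moreover have "ln z \<le> 1" if "z > 0"
        using ln_le_minus_one[OF that] \<open>m + z \<le> 1\<close> \<open>m = 0\<close> by linarith
      ultimately show ?thesis using that by (cases "z = 0") auto
    qed (use that in simp)
  next
    case False
    with that have mz: "m > 0" "z > 0" by auto
    have "ln ((m + z) / m) \<le> (m + z) / m - 1" using mz by (intro ln_le_minus_one) auto
    then have "ln (m + z) - ln m \<le> z / m" using mz by (subst (asm) ln_div) (auto simp: add_divide_distrib)
    then have "m * (ln (m + z) - ln m) \<le> z" using mz by (simp add: field_simps)
    moreover have "z * ln (m + z) \<le> 0" using mz that by (intro mult_nonneg_nonpos) auto
    ultimately show ?thesis by (simp add: algebra_simps)
  qed
  have pt: "?\<eta> (pmf p a) \<le> ?\<eta> (pmf q a) + ?\<eta> (d a) + e a" for a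
  proof (cases "pmf p a \<ge> pmf q a")
    case True
    then show ?thesis using sub[of "pmf q a" "d a"] by (simp add: d_def e_def)
  next
    case False
    then show ?thesis using low[of "pmf p a" "e a"] by (simp add: d_def e_def pmf_le_1)
  qed
  \<comment> \<open>Mass \<open>s\<close> on \<open>card A\<close> points contributes most when
    spread uniformly; the uniform weight \<open>s / ?K\<close> enters through
    \<open>ln u \<le> u - 1\<close>.\<close>
  have eta_d: "(\<Sum>a\<in>A. ?\<eta> (d a)) \<le> s * ln (card A) + ?\<eta> s"
  proof (cases "s = 0")
    case True
    then have "d a = 0" if "a \<in> A" for a
      using that fin d0 by (simp add: s_def sum_nonneg_eq_0_iff)
    with True show ?thesis by simp
  next
    case False
    with s0 have s: "s > 0" by simp
    let ?K = "real (card A)"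
    have "?\<eta> (d a) \<le> d a * (ln ?K - ln s) + (s / ?K - d a)" for a
    proof (cases "d a = 0")
      case False
      with d0[of a] have da: "d a > 0" by simp
      have "ln (s / ?K / d a) \<le> s / ?K / d a - 1" using s K da by (intro ln_le_minus_one) auto
      then have "d a * ln (s / ?K / d a) \<le> d a * (s / ?K / d a - 1)"
        using da by (intro mult_left_mono) auto
      also have "d a * (s / ?K / d a - 1) = s / ?K - d a" using da by (simp add: field_simps)
      also have "ln (s / ?K / d a) = ln s - ln ?K - ln (d a)"
        using s K da by (simp add: ln_div ln_mult)
      finally show ?thesis by (simp add: algebra_simps)
    qed (use s K in simp)
    then have "(\<Sum>a\<in>A. ?\<eta> (d a)) \<le> (\<Sum>a\<in>A. d a * (ln ?K - ln s) + (s / ?K - d a))"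
      by (intro sum_mono)
    also have "\<dots> = s * (ln ?K - ln s) + (\<Sum>a\<in>A. s / ?K) - s"
      by (simp add: s_def sum.distrib sum_subtractf sum_distrib_right[symmetric])
    also have "(\<Sum>a\<in>A. s / ?K) = s" using K by simp
    finally show ?thesis by (simp add: algebra_simps)
  qed
  have eta_s: "?\<eta> s \<le> 2 * sqrt s"
  proof (cases "s = 0")
    case False
    with s0 have s: "s > 0" by simp
    have "ln (1 / sqrt s) \<le> 1 / sqrt s - 1" using s by (intro ln_le_minus_one) auto
    then have "- ln s / 2 \<le> 1 / sqrt s" using s by (simp add: ln_div ln_sqrt)
    then have "s * (- ln s / 2) \<le> s * (1 / sqrt s)" using s by (intro mult_left_mono) auto
    also have "s * (1 / sqrt s) = sqrt s" using s by (simp add: real_div_sqrt)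
    finally show ?thesis by simp
  qed simp
  have "(\<Sum>a\<in>A. ?\<eta> (pmf p a)) \<le> (\<Sum>a\<in>A. ?\<eta> (pmf q a) + ?\<eta> (d a) + e a)"
    by (intro sum_mono pt)
  also have "\<dots> = (\<Sum>a\<in>A. ?\<eta> (pmf q a)) + (\<Sum>a\<in>A. ?\<eta> (d a)) + sum e A"
    by (simp add: sum.distrib sum_subtractf sum_negf)
  also have "\<dots> \<le> (\<Sum>a\<in>A. ?\<eta> (pmf q a)) + (s * ln (card A) + 2 * sqrt s) + T"
    using eta_d eta_s eT by simp
  also have "\<dots> \<le> (\<Sum>a\<in>A. ?\<eta> (pmf q a)) + (T * ln (card A) + 2 * sqrt T) + T"
    using sT K by (auto intro!: add_mono mult_right_mono)
  finally show ?thesis by (simp add: algebra_simps)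
qed

text \<open>Merging atoms can only decrease the l1 distance, by the triangle inequality on each
  fibre.\<close>

lemma sum_abs_pmf_map_le:
  assumes fin: "finite A" and p: "set_pmf p \<subseteq> A" and q: "set_pmf q \<subseteq> A"
  shows "(\<Sum>b\<in>f ` A. \<bar>pmf (map_pmf f p) b - pmf (map_pmf f q) b\<bar>) \<le> (\<Sum>a\<in>A. \<bar>pmf p a - pmf q a\<bar>)"
proof -
  have eq: "pmf (map_pmf f r) b = (\<Sum>a | a \<in> A \<and> f a = b. pmf r a)" if "set_pmf r \<subseteq> A" for r b
  proof -
    have "pmf (map_pmf f r) b = measure_pmf.prob r {a. a \<in> A \<and> f a = b}"
      unfolding pmf_map using that
      by (intro measure_pmf.finite_measure_eq_AE) (auto simp: AE_measure_pmf_iff)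
    also have "\<dots> = (\<Sum>a | a \<in> A \<and> f a = b. pmf r a)"
      by (rule measure_measure_pmf_finite) (use fin in auto)
    finally show ?thesis .
  qed
  have "(\<Sum>b\<in>f ` A. \<bar>pmf (map_pmf f p) b - pmf (map_pmf f q) b\<bar>)
    \<le> (\<Sum>b\<in>f ` A. \<Sum>a | a \<in> A \<and> f a = b. \<bar>pmf p a - pmf q a\<bar>)"
    by (intro sum_mono) (auto simp: eq[OF p] eq[OF q] sum_subtractf[symmetric])
  also have "\<dots> = (\<Sum>a\<in>A. \<bar>pmf p a - pmf q a\<bar>)"
    by (rule sum.group[OF fin]) (use fin in auto)
  finally show ?thesis .
qed

text \<open>Modulus of continuity of conditional entropy in bits, for alphabet size \<open>K\<close>
  and l1 distance \<open>T\<close>. The factor 2 arises because a conditional entropy is a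
  difference of two entropies; \<open>ln 2\<close> converts from nats.\<close>

definition ent_dev :: "real \<Rightarrow> real \<Rightarrow> real" where
  "ent_dev K T = 2 * (T * (1 + ln K) + 2 * sqrt T) / ln 2"

lemma cond_ent_unit_eq_sum:
  assumes fin: "finite B" and sub: "f ` set_pmf p \<subseteq> B"
  shows "cond_ent p f (\<lambda>_. ()) = (\<Sum>b\<in>B. - pmf (map_pmf f p) b * ln (pmf (map_pmf f p) b)) / ln 2"
proof -
  have 1: "prob_val p (\<lambda>_. ()) w = 1" for w by (simp add: prob_val_eq)
  have 2: "prob_val p (\<lambda>w. (f w, ())) w = pmf (map_pmf f p) (f w)" for w
    unfolding prob_val_def[symmetric] by (rule prob_val_cong) auto
  have "cond_ent p f (\<lambda>_. ()) = measure_pmf.expectation (map_pmf f p) (\<lambda>b. log 2 (1 / pmf (map_pmf f p) b))"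
    by (simp add: cond_ent_def 1 2)
  also have "\<dots> = (\<Sum>b\<in>B. pmf (map_pmf f p) b *\<^sub>R log 2 (1 / pmf (map_pmf f p) b))"
    by (rule integral_measure_pmf[OF fin]) (use sub in auto)
  also have "\<dots> = (\<Sum>b\<in>B. - pmf (map_pmf f p) b * ln (pmf (map_pmf f p) b) / ln 2)"
  proof (rule sum.cong)
    fix b
    show "pmf (map_pmf f p) b *\<^sub>R log 2 (1 / pmf (map_pmf f p) b)
      = - pmf (map_pmf f p) b * ln (pmf (map_pmf f p) b) / ln 2"
      by (cases "pmf (map_pmf f p) b = 0") (auto simp: log_def ln_div)
  qed simp
  finally show ?thesis by (simp add: sum_divide_distrib)
qed

text \<open>Only one entropy is compared here, hence half of \<open>ent_dev\<close>. The image
  alphabet is no larger than \<open>A\<close>, and the l1 distance does not grow under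
  \<open>f\<close>.\<close>

lemma cond_ent_unit_dev:
  assumes fin: "finite A" and p: "set_pmf p \<subseteq> A" and q: "set_pmf q \<subseteq> A"
    and T: "(\<Sum>a\<in>A. \<bar>pmf p a - pmf q a\<bar>) \<le> T"
  shows "cond_ent p f (\<lambda>_. ()) \<le> cond_ent q f (\<lambda>_. ()) + ent_dev (card A) T / 2"
proof -
  let ?B = "f ` A"
  have T0: "T \<ge> 0" by (rule order_trans[OF _ T]) (auto intro: sum_nonneg)
  have B: "card ?B \<ge> 1" "card ?B \<le> card A"
    using fin set_pmf_not_empty[of p] p by (auto simp: card_image_le Suc_le_eq card_gt_0_iff)
  have "(\<Sum>b\<in>?B. - pmf (map_pmf f p) b * ln (pmf (map_pmf f p) b))
    \<le> (\<Sum>b\<in>?B. - pmf (map_pmf f q) b * ln (pmf (map_pmf f q) b)) + (T * (1 + ln (card ?B)) + 2 * sqrt T)"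
    by (rule sum_entropy_diff_le)
      (use fin p q order_trans[OF sum_abs_pmf_map_le[OF fin p q] T] in auto)
  also have "\<dots> \<le> (\<Sum>b\<in>?B. - pmf (map_pmf f q) b * ln (pmf (map_pmf f q) b)) + (T * (1 + ln (card A)) + 2 * sqrt T)"
    using B T0 by (intro add_left_mono add_right_mono mult_left_mono) auto
  finally have "(\<Sum>b\<in>?B. - pmf (map_pmf f p) b * ln (pmf (map_pmf f p) b)) / ln 2
    \<le> ((\<Sum>b\<in>?B. - pmf (map_pmf f q) b * ln (pmf (map_pmf f q) b)) + (T * (1 + ln (card A)) + 2 * sqrt T)) / ln 2"
    by (rule divide_right_mono) simp
  moreover have "cond_ent p f (\<lambda>_. ()) = (\<Sum>b\<in>?B. - pmf (map_pmf f p) b * ln (pmf (map_pmf f p) b)) / ln 2"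
    and "cond_ent q f (\<lambda>_. ()) = (\<Sum>b\<in>?B. - pmf (map_pmf f q) b * ln (pmf (map_pmf f q) b)) / ln 2"
    by (rule cond_ent_unit_eq_sum; use fin p q in auto)+
  ultimately show ?thesis by (simp add: ent_dev_def add_divide_distrib)
qed

lemma cond_ent_dev:
  assumes fin: "finite A" and p: "set_pmf p \<subseteq> A" and q: "set_pmf q \<subseteq> A"
    and T: "(\<Sum>a\<in>A. \<bar>pmf p a - pmf q a\<bar>) \<le> T"
  shows "cond_ent p f g \<le> cond_ent q f g + ent_dev (card A) T"
proof -
  have fp: "finite (set_pmf p)" and fq: "finite (set_pmf q)"
    using fin p q finite_subset by auto
  have "cond_ent p (\<lambda>w. (f w, g w)) (\<lambda>_. ())
    \<le> cond_ent q (\<lambda>w. (f w, g w)) (\<lambda>_. ()) + ent_dev (card A) T / 2"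
    by (rule cond_ent_unit_dev[OF fin p q T])
  moreover have "cond_ent q g (\<lambda>_. ()) \<le> cond_ent p g (\<lambda>_. ()) + ent_dev (card A) T / 2"
    by (rule cond_ent_unit_dev[OF fin q p]) (use T in \<open>simp add: abs_minus_commute\<close>)
  moreover have "cond_ent p f g = cond_ent p (\<lambda>w. (f w, g w)) (\<lambda>_. ()) - cond_ent p g (\<lambda>_. ())"
    by (rule cond_ent_eq_diff) (use fp in auto)
  moreover have "cond_ent q f g = cond_ent q (\<lambda>w. (f w, g w)) (\<lambda>_. ()) - cond_ent q g (\<lambda>_. ())"
    by (rule cond_ent_eq_diff) (use fq in auto)
  ultimately show ?thesis by argo
qed

text \<open>The alphabet size enters through its logarithm, so passing to blocks of length
  \<open>n\<close> costs a factor of at most \<open>n\<close> and the deviation per letter does not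
  grow.\<close>

lemma ent_dev_power_le:
  assumes "T \<ge> 0" "K \<ge> 1" "n > 0"
  shows "ent_dev (K ^ n) T \<le> n * ent_dev K T"
proof -
  have n: "1 \<le> real n" using assms by simp
  have "T * (1 + ln (K ^ n)) + 2 * sqrt T \<le> real n * (T * (1 + ln K) + 2 * sqrt T)"
  proof -
    have "T * 1 \<le> T * n" "2 * sqrt T * 1 \<le> 2 * sqrt T * n"
      using assms n by (intro mult_left_mono; simp)+
    moreover have "ln (K ^ n) = n * ln K" using assms by (simp add: ln_realpow)
    ultimately show ?thesis by (simp add: algebra_simps)
  qed
  then have "2 * (T * (1 + ln (K ^ n)) + 2 * sqrt T) / ln 2
    \<le> 2 * (real n * (T * (1 + ln K) + 2 * sqrt T)) / ln 2"
    by (intro divide_right_mono mult_left_mono) auto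
  moreover have "2 * (real n * x) / ln 2 = real n * (2 * x / ln 2)" for x :: real by simp
  ultimately show ?thesis unfolding ent_dev_def by (simp only:)
qed

lemma ent_dev_tendsto: "(\<delta> \<longlongrightarrow> 0) F \<Longrightarrow> ((\<lambda>k. ent_dev K (\<delta> k)) \<longlongrightarrow> 0) F"
  unfolding ent_dev_def by (auto intro!: tendsto_eq_intros)

section \<open>Conditional mutual information as an entropy difference\<close>

context
  fixes S :: "'s measure" and J :: "'s \<Rightarrow> 'a" and p :: "'a pmf"
  assumes S: "prob_space S" and J: "J \<in> measurable S (count_space UNIV)"
    and distr_J: "distr S (count_space UNIV) J = measure_pmf p"
begin

text \<open>The execution space is uncountable, but all relevant variables factor through one
  discrete variable \<open>J\<close>. This lemma and the next ones turn informations defined on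
  \<open>S\<close> into expectations under the law \<open>p\<close> of \<open>J\<close>.\<close>

lemma distributed_comp_pmf:
  "distributed S (count_space UNIV) (\<lambda>w. X (J w)) (\<lambda>x. ennreal (pmf (map_pmf X p) x))"
proof -
  have "distr S (count_space UNIV) (\<lambda>w. X (J w)) = distr (distr S (count_space UNIV) J) (count_space UNIV) X"
    by (subst distr_distr) (use J in \<open>auto simp: comp_def\<close>)
  also have "\<dots> = measure_pmf (map_pmf X p)"
    by (simp add: distr_J map_pmf_rep_eq)
  finally have "distr S (count_space UNIV) (\<lambda>w. X (J w)) = measure_pmf (map_pmf X p)" .
  then show ?thesis
    using measurable_comp[OF J, of X "count_space UNIV"]
    by (simp add: distributed_def measure_pmf_eq_density comp_def)
qed

lemma mutual_information_comp_pmf: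
  fixes X :: "'a \<Rightarrow> 'b::countable" and Y :: "'a \<Rightarrow> 'c::countable"
  shows "prob_space.mutual_information S 2 (count_space UNIV) (count_space UNIV) (\<lambda>w. X (J w)) (\<lambda>w. Y (J w))
    = measure_pmf.expectation p (\<lambda>w. log 2 (prob_val p (\<lambda>w. (X w, Y w)) w / (prob_val p X w * prob_val p Y w)))"
proof -
  interpret information_space S 2 using S by (simp add: information_space_def information_space_axioms_def)
  have pc: "count_space (UNIV :: 'b set) \<Otimes>\<^sub>M count_space (UNIV :: 'c set) = count_space UNIV"
    by (subst pair_measure_countable) auto
  let ?q = "map_pmf (\<lambda>w. (X w, Y w)) p"
  let ?h = "\<lambda>x. log 2 (pmf ?q x / (pmf (map_pmf X p) (fst x) * pmf (map_pmf Y p) (snd x)))"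
  have "mutual_information 2 (count_space UNIV) (count_space UNIV) (\<lambda>w. X (J w)) (\<lambda>w. Y (J w))
    = (\<integral>x. pmf ?q x * ?h x \<partial>count_space UNIV)"
    using distributed_comp_pmf[of "\<lambda>w. (X w, Y w)"]
    by (subst mutual_information_distr[OF _ _ distributed_comp_pmf _ distributed_comp_pmf, where Pxy = "\<lambda>x. pmf ?q x"])
      (auto simp: pc sigma_finite_measure_count_space_countable)
  also have "\<dots> = measure_pmf.expectation ?q ?h"
    unfolding measure_pmf_eq_density by (subst integral_real_density) auto
  finally show ?thesis by (simp add: prob_val_def)
qed

text \<open>Expanded in entropies of the finite-range variable \<open>Y\<close>, because
  \<open>U\<close> is going to be the transcript.\<close>

lemma mutual_information_eq_cond_ent:
  fixes U :: "'a \<Rightarrow> 'b::countable" and Y :: "'a \<Rightarrow> 'c::countable"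
  assumes fin: "finite (Y ` set_pmf p)"
  shows "prob_space.mutual_information S 2 (count_space UNIV) (count_space UNIV) (\<lambda>w. U (J w)) (\<lambda>w. Y (J w))
    = cond_ent p Y (\<lambda>_. ()) - cond_ent p Y U"
  proof -
    have "cond_ent p Y (\<lambda>_. ()) - cond_ent p Y U = measure_pmf.expectation p (\<lambda>w.
        log 2 (prob_val p (\<lambda>_. ()) w / prob_val p (\<lambda>w. (Y w, ())) w)
        - log 2 (prob_val p U w / prob_val p (\<lambda>w. (Y w, U w)) w))"
      unfolding cond_ent_def
      by (rule Bochner_Integration.integral_diff[symmetric]) (rule integrable_cond_ent[OF fin])+
    also have "\<dots> = measure_pmf.expectation p
      (\<lambda>w. log 2 (prob_val p (\<lambda>w. (U w, Y w)) w / (prob_val p U w * prob_val p Y w)))"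
    proof (rule expectation_pmf_cong)
      fix w assume w: "w \<in> set_pmf p"
      have 1: "prob_val p (\<lambda>_. ()) w = 1" by (simp add: prob_val_eq)
      have 2: "prob_val p (\<lambda>w. (Y w, ())) w = prob_val p Y w"
        "prob_val p (\<lambda>w. (Y w, U w)) w = prob_val p (\<lambda>w. (U w, Y w)) w"
        by (rule prob_val_cong; auto)+
      show "log 2 (prob_val p (\<lambda>_. ()) w / prob_val p (\<lambda>w. (Y w, ())) w)
        - log 2 (prob_val p U w / prob_val p (\<lambda>w. (Y w, U w)) w)
        = log 2 (prob_val p (\<lambda>w. (U w, Y w)) w / (prob_val p U w * prob_val p Y w))"
        unfolding 1 2 log_def div_by_1
        by (simp add: prob_val_pos[OF w, THEN less_imp_neq, symmetric] ln_div ln_mult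
            diff_divide_distrib add_divide_distrib)
    qed
    also note mutual_information_comp_pmf[symmetric]
    finally show ?thesis by simp
  qed

text \<open>The underlying definition is \<open>I(U; (V, T)) - I(U; T)\<close>. Expanding both terms
  on the finite-range side and applying the chain rule leaves entropies of \<open>V\<close>.\<close>

lemma cond_mutual_info_bits_comp_pmf:
  fixes U :: "'a \<Rightarrow> 'b::countable" and V :: "'a \<Rightarrow> 'c::countable" and T :: "'a \<Rightarrow> 'd::countable"
  assumes fV: "finite (V ` set_pmf p)" and fT: "finite (T ` set_pmf p)"
  shows "cond_mutual_info_bits S (\<lambda>w. U (J w)) (\<lambda>w. V (J w)) (\<lambda>w. T (J w))
    = cond_ent p V T - cond_ent p V (\<lambda>w. (U w, T w))"
proof -
  interpret information_space S 2 using S by (simp add: information_space_def information_space_axioms_def)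
  have pc: "count_space (UNIV :: 'c set) \<Otimes>\<^sub>M count_space (UNIV :: 'd set) = count_space UNIV"
    by (subst pair_measure_countable) auto
  have fVT: "finite ((\<lambda>w. (V w, T w)) ` set_pmf p)"
    by (rule finite_subset[of _ "V ` set_pmf p \<times> T ` set_pmf p"]) (use fV fT in auto)
  have "cond_ent p (\<lambda>w. (V w, T w)) (\<lambda>_. ()) = cond_ent p (\<lambda>w. (T w, V w)) (\<lambda>_. ())"
    "cond_ent p (\<lambda>w. (V w, T w)) U = cond_ent p (\<lambda>w. (T w, V w)) U"
    by (rule cond_ent_cong; auto)+
  moreover have "cond_ent p V (\<lambda>w. (T w, ())) = cond_ent p V T"
    "cond_ent p V (\<lambda>w. (T w, U w)) = cond_ent p V (\<lambda>w. (U w, T w))"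
    by (rule cond_ent_cong; auto)+
  ultimately show ?thesis
    unfolding conditional_mutual_information_def pc
    using mutual_information_eq_cond_ent[OF fVT, of U] mutual_information_eq_cond_ent[OF fT, of U]
    by (simp add: cond_ent_chain fV fT)
qed

end

lemma entropy_XEQ_given_Y_eq:
  fixes P :: "('x::finite \<times> 'y::finite) pmf" and W :: "'x \<Rightarrow> 'y \<Rightarrow> 'z pmf"
  shows "entropy_XEQ_given_Y P W = cond_ent P (\<lambda>(x, y). x_EQ P W x) snd"
proof -
  interpret information_space "measure_pmf P" 2
    by (simp add: information_space_def information_space_axioms_def prob_space_measure_pmf)
  let ?X = "\<lambda>(x, y). x_EQ P W x"
  let ?q = "map_pmf (\<lambda>w. (?X w, snd w)) P"
  have pc: "count_space (UNIV :: 'x set) \<Otimes>\<^sub>M count_space (UNIV :: 'y set) = count_space UNIV"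
    by (subst pair_measure_countable) auto
  have id: "prob_space P" "(\<lambda>x. x) \<in> measurable P (count_space UNIV)"
    "distr P (count_space UNIV) (\<lambda>x. x) = P"
    by (auto simp: prob_space_measure_pmf distr_id2)
  let ?h = "\<lambda>x. log 2 (pmf ?q x / pmf (map_pmf snd P) (snd x))"
  have snd: "(\<lambda>(x, y). y) = snd" by auto
  have "entropy_XEQ_given_Y P W = - (\<integral>(x, y). pmf ?q (x, y) * log 2 (pmf ?q (x, y) / pmf (map_pmf snd P) y) \<partial>(count_space UNIV \<Otimes>\<^sub>M count_space UNIV))"
    unfolding entropy_XEQ_given_Y_def snd
    by (rule conditional_entropy_generic_eq[OF _ _ distributed_comp_pmf[OF id]])
      (use distributed_comp_pmf[OF id, of "\<lambda>w. (?X w, snd w)"]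
        in \<open>auto simp: pc sigma_finite_measure_count_space_countable\<close>)
  also have "\<dots> = - (\<integral>x. pmf ?q x * ?h x \<partial>count_space UNIV)"
    by (simp add: pc case_prod_unfold)
  also have "(\<integral>x. pmf ?q x * ?h x \<partial>count_space UNIV) = measure_pmf.expectation ?q ?h"
    unfolding measure_pmf_eq_density by (subst integral_real_density) auto
  also have "\<dots> = - cond_ent P ?X snd"
    unfolding cond_ent_def
  proof (simp, subst integral_minus[symmetric], rule integral_cong_AE)
    show "AE w in measure_pmf P.
      log 2 (pmf ?q (?X w, snd w) / pmf (map_pmf snd P) (snd w))
      = - log 2 (prob_val P snd w / prob_val P (\<lambda>w. (?X w, snd w)) w)"
      unfolding AE_measure_pmf_iff
    proof
      fix w assume w: "w \<in> set_pmf P"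
      show "log 2 (pmf ?q (?X w, snd w) / pmf (map_pmf snd P) (snd w))
        = - log 2 (prob_val P snd w / prob_val P (\<lambda>w. (?X w, snd w)) w)"
      proof -
        have "pmf ?q (?X w, snd w) = prob_val P (\<lambda>w. (?X w, snd w)) w"
          "pmf (map_pmf snd P) (snd w) = prob_val P snd w" by (simp_all add: prob_val_def)
        then show ?thesis
          by (simp add: prob_val_pos[OF w, THEN less_imp_neq, symmetric] log_def ln_div diff_divide_distrib)
      qed
    qed
  qed auto
  finally show ?thesis by simp
qed

section \<open>The Kraft inequality and expected length\<close>

text \<open>Probabilistic proof: \<open>L\<close> fair coin flips begin with a codeword
  \<open>m\<close> with probability \<open>2^(-|m|)\<close>, and for pairwise incomparable codewords
  these events are disjoint.\<close>

lemma kraft_finite: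
  fixes C :: "bool list set"
  assumes fin: "finite C" and par: "pairwise parallel C"
  shows "(\<Sum>m\<in>C. (1/2 :: real) ^ length m) \<le> 1"
proof -
  define L where "L = Max (insert 0 (length ` C))"
  have L: "length m \<le> L" if "m \<in> C" for m
    unfolding L_def using that fin by (intro Max_ge) auto
  let ?coin = "pmf_of_set (UNIV :: bool set)"
  let ?E = "\<lambda>m. {l. \<forall>i<L. l ! i \<in> (if i < length m then {m ! i} else UNIV)}"
  have E: "measure_pmf.prob (replicate_pmf L ?coin) {l. length l = L \<and> prefix m l} = (1/2) ^ length m"
    if "m \<in> C" for m
  proof -
    have "measure_pmf.prob (replicate_pmf L ?coin) {l. length l = L \<and> prefix m l}
      = measure_pmf.prob (replicate_pmf L ?coin) (?E m)"
    proof (rule measure_pmf.finite_measure_eq_AE)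
      show "AE l in replicate_pmf L ?coin. l \<in> {l. length l = L \<and> prefix m l} \<longleftrightarrow> l \<in> ?E m"
        unfolding AE_measure_pmf_iff
      proof
        fix l assume "l \<in> set_pmf (replicate_pmf L ?coin)"
        then have len: "length l = L" by (rule length_replicate_pmf)
        have "prefix m l \<longleftrightarrow> take (length m) l = m"
          by (metis append_eq_conv_conj prefix_def take_is_prefix)
        also have "\<dots> \<longleftrightarrow> (\<forall>i<length m. l ! i = m ! i)"
          using L[OF that] len by (auto simp: list_eq_iff_nth_eq)
        finally show "l \<in> {l. length l = L \<and> prefix m l} \<longleftrightarrow> l \<in> ?E m"
          using L[OF that] len by auto
      qed
    qed auto
    also have "\<dots> = (\<Prod>i<L. if i < length m then 1/2 else 1)"
      unfolding prob_replicate_pmf by (intro prod.cong) (auto simp: measure_pmf_single)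
    also have "\<dots> = (\<Prod>i<length m. 1/2)"
      using L[OF that] by (intro prod.mono_neutral_cong_right) auto
    finally show ?thesis by simp
  qed
  have "(\<Sum>m\<in>C. (1/2 :: real) ^ length m)
    = (\<Sum>m\<in>C. measure_pmf.prob (replicate_pmf L ?coin) {l. length l = L \<and> prefix m l})"
    by (intro sum.cong) (auto simp: E)
  also have "\<dots> = measure_pmf.prob (replicate_pmf L ?coin) (\<Union>m\<in>C. {l. length l = L \<and> prefix m l})"
  proof (rule measure_pmf.finite_measure_finite_Union[symmetric, OF fin])
    show "disjoint_family_on (\<lambda>m. {l. length l = L \<and> prefix m l}) C"
      unfolding disjoint_family_on_def
      using par by (auto simp: pairwise_def dest: prefix_same_cases)
  qed auto
  also have "\<dots> \<le> 1" by (rule measure_pmf.prob_le_1)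
  finally show ?thesis .
qed

text \<open>An infinite code is exhausted by its finitely many words of length at most
  \<open>L\<close>.\<close>

lemma kraft:
  assumes par: "pairwise parallel (C :: bool list set)"
  shows "(\<integral>\<^sup>+m. ennreal (indicator C m * (1/2) ^ length m) \<partial>count_space UNIV) \<le> 1"
proof -
  let ?C = "\<lambda>L. {m \<in> C. length m \<le> L}"
  let ?f = "\<lambda>L m. ennreal (indicator (?C L) m * (1/2) ^ length m)"
  have fin: "finite (?C L)" for L
    by (rule finite_subset[OF _ finite_lists_length_le[of "UNIV :: bool set" L]]) auto
  have "(\<integral>\<^sup>+m. ennreal (indicator C m * (1/2) ^ length m) \<partial>count_space UNIV)
    = (\<integral>\<^sup>+m. (SUP L. ?f L m) \<partial>count_space UNIV)"
  proof (rule nn_integral_cong)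
    fix m
    show "ennreal (indicator C m * (1/2) ^ length m) = (SUP L. ?f L m)"
    proof (rule antisym)
      show "ennreal (indicator C m * (1/2) ^ length m) \<le> (SUP L. ?f L m)"
        by (rule SUP_upper2[of "length m"]) (auto simp: indicator_def)
    qed (auto intro!: SUP_least simp: indicator_def)
  qed
  also have "\<dots> = (SUP L. \<integral>\<^sup>+m. ?f L m \<partial>count_space UNIV)"
    by (rule nn_integral_monotone_convergence_SUP) (auto simp: incseq_def le_fun_def indicator_def)
  also have "\<dots> \<le> 1"
  proof (rule SUP_least)
    fix L
    have "(\<integral>\<^sup>+m. ?f L m \<partial>count_space UNIV) = (\<Sum>m\<in>?C L. ?f L m)"
      by (rule nn_integral_count_space'[OF fin]) auto
    also have "\<dots> = ennreal (\<Sum>m\<in>?C L. (1/2) ^ length m)"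
      by (subst sum_ennreal[symmetric]) (auto intro!: sum.cong)
    also have "\<dots> \<le> ennreal 1"
      by (intro ennreal_leI kraft_finite fin) (use par in \<open>auto simp: pairwise_def\<close>)
    finally show "(\<integral>\<^sup>+m. ?f L m \<partial>count_space UNIV) \<le> 1" by simp
  qed
  finally show ?thesis .
qed

text \<open>The mutual information of \<open>U\<close> and \<open>M\<close> given \<open>Y\<close>
  is bounded by the length without passing through the entropy of \<open>M\<close>. The ratio
  \<open>r\<close> equals \<open>2^(-|M|) P(M | U, Y) / P(M | Y)\<close>. Bounding
  \<open>P(M | U, Y)\<close> by 1 and applying Kraft gives mean at most 1, while \<open>ln r\<close>
  is \<open>ln 2\<close> times information density minus length; so \<open>E ln r \<le> 0\<close> is
  the claim.\<close>

lemma expected_length_ge: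
  fixes U :: "'a \<Rightarrow> 'b" and M :: "'a \<Rightarrow> bool list" and Y :: "'a \<Rightarrow> 'c"
  assumes fin: "finite (U ` set_pmf p)" and par: "pairwise parallel (M ` set_pmf p)"
  shows "ennreal (cond_ent p U Y - cond_ent p U (\<lambda>w. (M w, Y w)))
    \<le> (\<integral>\<^sup>+w. of_nat (length (M w)) \<partial>measure_pmf p)"
proof (cases "(\<integral>\<^sup>+w. of_nat (length (M w)) \<partial>measure_pmf p) = \<infinity>")
  case False
  then have il: "integrable (measure_pmf p) (\<lambda>w. real (length (M w)))"
    by (intro integrableI_nonneg) (auto simp: ennreal_of_nat_eq_real_of_nat top.not_eq_extremum)
  define r where "r = (\<lambda>w. prob_val p Y w * prob_val p (\<lambda>w. (U w, M w, Y w)) w * (1/2) ^ length (M w)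
    / (prob_val p (\<lambda>w. (M w, Y w)) w * prob_val p (\<lambda>w. (U w, Y w)) w))"
  have r_pos: "r w > 0" if "w \<in> set_pmf p" for w
    by (simp add: r_def prob_val_pos[OF that])
  let ?k = "\<lambda>(m, y). indicator (M ` set_pmf p) m * (1/2) ^ length m * pmf (map_pmf Y p) y"
  have "(\<integral>\<^sup>+w. ennreal (r w) \<partial>measure_pmf p)
    \<le> (\<integral>\<^sup>+w. ennreal (?k (M w, Y w) / prob_val p (\<lambda>w. (M w, Y w)) w) \<partial>measure_pmf p)"
  proof (rule nn_integral_mono_AE, unfold AE_measure_pmf_iff, rule)
    fix w assume w: "w \<in> set_pmf p"
    have "prob_val p (\<lambda>w. (U w, M w, Y w)) w \<le> prob_val p (\<lambda>w. (U w, Y w)) w"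
      by (rule prob_val_mono) auto
    then have q: "prob_val p (\<lambda>w. (U w, M w, Y w)) w / prob_val p (\<lambda>w. (U w, Y w)) w \<le> 1"
      by (simp add: prob_val_pos[OF w])
    have "r w = (prob_val p Y w * (1/2) ^ length (M w) / prob_val p (\<lambda>w. (M w, Y w)) w)
      * (prob_val p (\<lambda>w. (U w, M w, Y w)) w / prob_val p (\<lambda>w. (U w, Y w)) w)"
      by (simp add: r_def)
    also have "\<dots> \<le> (prob_val p Y w * (1/2) ^ length (M w) / prob_val p (\<lambda>w. (M w, Y w)) w) * 1"
      by (intro mult_left_mono q) auto
    finally show "ennreal (r w) \<le> ennreal (?k (M w, Y w) / prob_val p (\<lambda>w. (M w, Y w)) w)"
      using w by (intro ennreal_leI) (simp add: prob_val_def[of p Y] mult.commute)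
  qed
  also have "\<dots> \<le> (\<integral>\<^sup>+c. ennreal (?k c) \<partial>count_space UNIV)"
    by (rule nn_integral_prob_val_ratio_le) auto
  also have "\<dots> = (\<integral>\<^sup>+m. \<integral>\<^sup>+y. ennreal (?k (m, y)) \<partial>count_space UNIV \<partial>count_space UNIV)"
    by (rule nn_integral_fst_count_space[symmetric])
  also have "\<dots> = (\<integral>\<^sup>+m. ennreal (indicator (M ` set_pmf p) m * (1/2) ^ length m) \<partial>count_space UNIV)"
    by (simp add: ennreal_mult' nn_integral_cmult nn_integral_pmf_eq_1)
  also have "\<dots> \<le> 1" by (rule kraft[OF par])
  finally have le: "(\<integral>\<^sup>+w. ennreal (r w) \<partial>measure_pmf p) \<le> 1" .
  let ?D = "\<lambda>w. log 2 (prob_val p Y w / prob_val p (\<lambda>w. (U w, Y w)) w)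
    - log 2 (prob_val p (\<lambda>w. (M w, Y w)) w / prob_val p (\<lambda>w. (U w, M w, Y w)) w)"
  note i1 = integrable_cond_ent[OF fin, of Y]
  note i2 = integrable_cond_ent[OF fin, of "\<lambda>w. (M w, Y w)"]
  have iD: "integrable (measure_pmf p) ?D" by (intro Bochner_Integration.integrable_diff i1 i2)
  have ED: "measure_pmf.expectation p ?D = cond_ent p U Y - cond_ent p U (\<lambda>w. (M w, Y w))"
    unfolding cond_ent_def by (rule Bochner_Integration.integral_diff[OF i1 i2])
  have iDl: "integrable (measure_pmf p) (\<lambda>w. ln 2 * (?D w - real (length (M w))))"
    by (intro Bochner_Integration.integrable_mult_right Bochner_Integration.integrable_diff iD il)
  have ln_r: "ln (r w) = ln 2 * (?D w - real (length (M w)))" if "w \<in> set_pmf p" for w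
    unfolding r_def log_def
    by (simp add: prob_val_pos[OF that, THEN less_imp_neq, symmetric] ln_div ln_mult ln_realpow
        right_diff_distrib diff_divide_distrib)
  have ae: "AE w in measure_pmf p. ln 2 * (?D w - real (length (M w))) = ln (r w)"
    unfolding AE_measure_pmf_iff using ln_r by simp
  have ir: "integrable (measure_pmf p) (\<lambda>w. ln (r w))"
    by (rule integrable_cong_AE_imp[OF iDl]) (use ae in auto)
  have "0 \<le> - 2 * measure_pmf.expectation p (\<lambda>w. ln (r w))"
    by (rule order_trans[OF zero_le_power2 expectation_defect_square_le[OF r_pos le ir]])
  also have "measure_pmf.expectation p (\<lambda>w. ln (r w))
    = measure_pmf.expectation p (\<lambda>w. ln 2 * (?D w - real (length (M w))))"
    by (rule integral_cong_AE) (use ae in \<open>auto elim!: eventually_mono\<close>)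
  also have "\<dots> = ln 2 * (measure_pmf.expectation p ?D - measure_pmf.expectation p (\<lambda>w. real (length (M w))))"
    unfolding integral_mult_right_zero
    by (subst Bochner_Integration.integral_diff[OF iD il]) simp
  finally have "measure_pmf.expectation p ?D \<le> measure_pmf.expectation p (\<lambda>w. real (length (M w)))"
    by (simp add: mult_le_0_iff)
  then have "ennreal (measure_pmf.expectation p ?D) \<le> (\<integral>\<^sup>+w. ennreal (real (length (M w))) \<partial>measure_pmf p)"
    by (subst nn_integral_eq_integral[OF il]) (auto intro: ennreal_leI)
  then show ?thesis by (simp add: ED ennreal_of_nat_eq_real_of_nat)
qed simp

section \<open>Transcripts and the joint law of an execution\<close>

definition admissible :: "('x, 'y, 'z) protocol \<Rightarrow> bool list list \<Rightarrow> bool" where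
  "admissible \<pi> h \<longleftrightarrow> (\<forall>t<length h. h ! t \<in> msg_code \<pi> (take t h))"

text \<open>Rounds in which the other user speaks impose nothing, so this is an event about Alice's
  randomness alone; likewise for \<open>consistent_B\<close>.\<close>

definition consistent_A :: "('x, 'y, 'z) protocol \<Rightarrow> 'x list \<Rightarrow> bool list list \<Rightarrow> real \<Rightarrow> bool" where
  "consistent_A \<pi> xs h a \<longleftrightarrow>
    (\<forall>t<length h. speaker \<pi> (take t h) = Alice \<longrightarrow> msg_A \<pi> xs a (take t h) = h ! t)"

definition consistent_B :: "('x, 'y, 'z) protocol \<Rightarrow> 'y list \<Rightarrow> bool list list \<Rightarrow> real \<Rightarrow> bool" where
  "consistent_B \<pi> ys h b \<longleftrightarrow>
    (\<forall>t<length h. speaker \<pi> (take t h) = Bob \<longrightarrow> msg_B \<pi> ys b (take t h) = h ! t)"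

lemma length_history [simp]: "length (history \<pi> xs ys a b t) = t"
  by (induction t) (simp_all add: Let_def)

text \<open>For fixed inputs the pairs \<open>(a, b)\<close> that produce a given history form a
  rectangle, because each round constrains only the randomness of its speaker.\<close>

lemma history_eq_iff:
  "history \<pi> xs ys a b (length h) = h \<longleftrightarrow> consistent_A \<pi> xs h a \<and> consistent_B \<pi> ys h b"
proof (induction h rule: rev_induct)
  case Nil
  then show ?case by (simp add: consistent_A_def consistent_B_def)
next
  case (snoc m h)
  have all: "(\<forall>t<length (h @ [m]). Q t (take t (h @ [m])) ((h @ [m]) ! t)) \<longleftrightarrow>
    (\<forall>t<length h. Q t (take t h) (h ! t)) \<and> Q (length h) h m" for Q
    by (auto simp: less_Suc_eq nth_append)
  have A: "consistent_A \<pi> xs (h @ [m]) a \<longleftrightarrow>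
      consistent_A \<pi> xs h a \<and> (speaker \<pi> h = Alice \<longrightarrow> msg_A \<pi> xs a h = m)"
    unfolding consistent_A_def by (rule all)
  have B: "consistent_B \<pi> ys (h @ [m]) b \<longleftrightarrow>
      consistent_B \<pi> ys h b \<and> (speaker \<pi> h = Bob \<longrightarrow> msg_B \<pi> ys b h = m)"
    unfolding consistent_B_def by (rule all)
  show ?case
    unfolding A B using snoc by (auto simp: Let_def split: user.splits)
qed

lemma admissible_history:
  assumes "valid_protocol n \<pi>"
  shows "admissible \<pi> (history \<pi> xs ys a b t)"
proof (induction t)
  case (Suc t)
  then show ?case
    using assms by (auto simp: admissible_def Let_def less_Suc_eq nth_append valid_protocol_def split: user.splits)
qed (simp add: admissible_def)

text \<open>At the first round where the histories differ, both messages belong to the same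
  prefix-free code, since that code is determined by the common past. Their incomparability survives
  whatever follows.\<close>

lemma parallel_concat_admissible:
  assumes val: "valid_protocol n \<pi>" and adm: "admissible \<pi> h" "admissible \<pi> h'"
    and len: "length h = length h'" and neq: "h \<noteq> h'"
  shows "parallel (concat h) (concat h')"
proof -
  obtain i where i: "i < length h" "h ! i \<noteq> h' ! i"
    using len neq by (auto simp: list_eq_iff_nth_eq)
  define t where "t = (LEAST i. i < length h \<and> h ! i \<noteq> h' ! i)"
  have t: "t < length h" "h ! t \<noteq> h' ! t"
    using LeastI[of "\<lambda>i. i < length h \<and> h ! i \<noteq> h' ! i" i] i unfolding t_def by auto
  have "h ! j = h' ! j" if "j < t" for j
    using not_less_Least[of j "\<lambda>i. i < length h \<and> h ! i \<noteq> h' ! i"] that t unfolding t_def[symmetric] by auto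
  then have take_eq: "take t h = take t h'"
    using t len by (auto simp: list_eq_iff_nth_eq)
  have "h ! t \<in> msg_code \<pi> (take t h)" "h' ! t \<in> msg_code \<pi> (take t h)"
    using adm t len take_eq by (auto simp: admissible_def)
  moreover have "prefix_free (msg_code \<pi> (take t h))" using val by (simp add: valid_protocol_def)
  ultimately have "parallel (h ! t) (h' ! t)" using t by (auto simp: prefix_free_def pairwise_def)
  then have "parallel (h ! t @ concat (drop (Suc t) h)) (h' ! t @ concat (drop (Suc t) h'))"
    by (rule parallel_append)
  then have "parallel (concat (take t h) @ h ! t @ concat (drop (Suc t) h))
    (concat (take t h') @ h' ! t @ concat (drop (Suc t) h'))"
    unfolding take_eq by (auto simp: parallel_def)
  moreover have "concat l = concat (take t l) @ l ! t @ concat (drop (Suc t) l)"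
    if "t < length l" for l :: "bool list list"
    using arg_cong[OF id_take_nth_drop[OF that], of concat] by simp
  ultimately show ?thesis using t len by metis
qed

text \<open>Concatenation loses nothing: prefix-freeness lets the bit string determine the history,
  so the rectangle property passes from histories to transcripts.\<close>

lemma transcript_eq_iff:
  assumes val: "valid_protocol n \<pi>" and adm: "admissible \<pi> h" and len: "length h = rounds \<pi>"
  shows "transcript \<pi> xs ys a b = concat h \<longleftrightarrow> consistent_A \<pi> xs h a \<and> consistent_B \<pi> ys h b"
proof
  assume *: "transcript \<pi> xs ys a b = concat h"
  have "history \<pi> xs ys a b (rounds \<pi>) = h"
  proof (rule ccontr)
    assume "history \<pi> xs ys a b (rounds \<pi>) \<noteq> h"
    then have "parallel (concat (history \<pi> xs ys a b (rounds \<pi>))) (concat h)"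
      by (intro parallel_concat_admissible[OF val admissible_history[OF val] adm]) (simp_all add: len)
    with * show False by (simp add: transcript_def parallel_def)
  qed
  then show "consistent_A \<pi> xs h a \<and> consistent_B \<pi> ys h b"
    using history_eq_iff[of \<pi> xs ys a b h] len by simp
next
  assume "consistent_A \<pi> xs h a \<and> consistent_B \<pi> ys h b"
  then show "transcript \<pi> xs ys a b = concat h"
    using history_eq_iff[of \<pi> xs ys a b h] len by (simp add: transcript_def)
qed

text \<open>Over all inputs and random values together the transcripts form one prefix-free code,
  which is what Kraft's inequality asks for.\<close>

lemma pairwise_parallel_transcripts:
  assumes val: "valid_protocol n \<pi>"
  shows "pairwise parallel {transcript \<pi> xs ys a b | xs ys a b. True}"
proof (rule pairwiseI)
  fix m m'
  assume "m \<in> {transcript \<pi> xs ys a b | xs ys a b. True}" "m' \<in> {transcript \<pi> xs ys a b | xs ys a b. True}"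
    and neq: "m \<noteq> m'"
  then obtain xs ys a b xs' ys' a' b'
    where "m = transcript \<pi> xs ys a b" "m' = transcript \<pi> xs' ys' a' b'" by blast
  then have m: "m = concat (history \<pi> xs ys a b (rounds \<pi>))"
    and m': "m' = concat (history \<pi> xs' ys' a' b' (rounds \<pi>))" by (simp_all add: transcript_def)
  show "parallel m m'"
    unfolding m m'
    by (rule parallel_concat_admissible[OF val admissible_history[OF val] admissible_history[OF val]])
      (use neq m m' in auto)
qed

definition joint_rv :: "('x, 'y, 'z) protocol \<Rightarrow> ('x, 'y) sample \<Rightarrow> 'x list \<times> 'y list \<times> bool list \<times> 'z list" where
  "joint_rv \<pi> w = (input_A w, input_B w, transcript_rv \<pi> w, output_rv \<pi> w)"

text \<open>Correctness, both leakages and the rate depend only on this discrete law.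
  \<open>distr_joint_rv\<close> shows that \<open>Abs_pmf\<close> is applied to a genuine
  pmf.\<close>

definition joint_pmf ::
  "('x \<times> 'y) pmf \<Rightarrow> nat \<Rightarrow> ('x, 'y, 'z) protocol \<Rightarrow> ('x list \<times> 'y list \<times> bool list \<times> 'z list) pmf" where
  "joint_pmf P n \<pi> = Abs_pmf (distr (exec_space P n \<pi>) (count_space UNIV) (joint_rv \<pi>))"

section \<open>Measurability and the discrete law of an execution\<close>

lemma measurable_history:
  assumes val: "valid_protocol n \<pi>"
  shows "(\<lambda>ab. history \<pi> xs ys (fst ab) (snd ab) t) \<in> measurable (borel \<Otimes>\<^sub>M borel) (count_space UNIV)"
proof (induction t)
  case (Suc t)
  let ?f = "\<lambda>h ab. h @ [case speaker \<pi> h of Alice \<Rightarrow> msg_A \<pi> xs (fst ab) h | Bob \<Rightarrow> msg_B \<pi> ys (snd ab) h]"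
  have A: "(\<lambda>ab. msg_A \<pi> xs (fst ab) h) \<in> measurable (borel \<Otimes>\<^sub>M borel) (count_space UNIV)" for h
    by (rule measurable_compose[OF measurable_fst]) (use val in \<open>auto simp: valid_protocol_def\<close>)
  have B: "(\<lambda>ab. msg_B \<pi> ys (snd ab) h) \<in> measurable (borel \<Otimes>\<^sub>M borel) (count_space UNIV)" for h
    by (rule measurable_compose[OF measurable_snd]) (use val in \<open>auto simp: valid_protocol_def\<close>)
  have f: "?f h \<in> measurable (borel \<Otimes>\<^sub>M borel) (count_space UNIV)" for h
    by (cases "speaker \<pi> h")
      (auto intro!: measurable_compose[OF A, where g="\<lambda>m. h @ [m]"] measurable_compose[OF B, where g="\<lambda>m. h @ [m]"])
  show ?case
    unfolding history.simps Let_def by (rule measurable_compose_countable[OF f Suc])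
qed simp

lemma measurable_transcript:
  assumes "valid_protocol n \<pi>"
  shows "(\<lambda>ab. transcript \<pi> xs ys (fst ab) (snd ab)) \<in> measurable (borel \<Otimes>\<^sub>M borel) (count_space UNIV)"
  unfolding transcript_def
  by (rule measurable_compose[OF measurable_history[OF assms]]) simp

lemma measurable_output:
  assumes val: "valid_protocol n \<pi>"
  shows "(\<lambda>ab. out_B \<pi> ys (snd ab) (transcript \<pi> xs ys (fst ab) (snd ab)))
    \<in> measurable (borel \<Otimes>\<^sub>M borel) (count_space UNIV)"
  by (rule measurable_compose_countable[OF _ measurable_transcript[OF val]],
      rule measurable_compose[OF measurable_snd])
    (use val in \<open>auto simp: valid_protocol_def\<close>)

lemma measurable_joint_rv:
  fixes \<pi> :: "('x::finite, 'y::finite, 'z::countable) protocol"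
  assumes val: "valid_protocol n \<pi>"
  shows "joint_rv \<pi> \<in> measurable (exec_space P n \<pi>) (count_space UNIV)"
proof -
  have sets: "sets (exec_space P n \<pi>) = sets (count_space UNIV \<Otimes>\<^sub>M (borel \<Otimes>\<^sub>M borel))"
    unfolding exec_space_def
    by (intro sets_pair_measure_cong) (use val in \<open>auto simp: valid_protocol_def\<close>)
  have "(\<lambda>ab. joint_rv \<pi> (w, ab)) \<in> measurable (borel \<Otimes>\<^sub>M borel) (count_space UNIV)" for w
  proof -
    let ?T = "\<lambda>ab. transcript \<pi> (map fst w) (map snd w) (fst ab) (snd ab)"
    let ?Z = "\<lambda>ab. out_B \<pi> (map snd w) (snd ab) (?T ab)"
    have "(\<lambda>ab. (map fst w, map snd w, m, ?Z ab)) \<in> measurable (borel \<Otimes>\<^sub>M borel) (count_space UNIV)" for m :: "bool list"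
      by (rule measurable_compose[OF measurable_output[OF val]]) simp
    then have "(\<lambda>ab. (map fst w, map snd w, ?T ab, ?Z ab)) \<in> measurable (borel \<Otimes>\<^sub>M borel) (count_space UNIV)"
      by (rule measurable_compose_countable[OF _ measurable_transcript[OF val]])
    then show ?thesis
      by (simp add: joint_rv_def input_A_def input_B_def transcript_rv_def output_rv_def case_prod_unfold)
  qed
  then have "joint_rv \<pi> \<in> measurable (count_space UNIV \<Otimes>\<^sub>M (borel \<Otimes>\<^sub>M borel)) (count_space UNIV)"
    by (intro measurable_pair_measure_countable1) auto
  then show ?thesis by (simp add: measurable_cong_sets[OF sets refl])
qed

lemma prob_space_exec_space:
  assumes "valid_protocol n \<pi>"
  shows "prob_space (exec_space P n \<pi>)"
  unfolding exec_space_def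
  by (intro prob_space_pair prob_space_measure_pmf) (use assms in \<open>auto simp: valid_protocol_def\<close>)

text \<open>The values form a countable type, so the law is carried by its atoms.\<close>

lemma distr_joint_rv:
  fixes \<pi> :: "('x::finite, 'y::finite, 'z::countable) protocol"
  assumes val: "valid_protocol n \<pi>"
  shows "distr (exec_space P n \<pi>) (count_space UNIV) (joint_rv \<pi>) = measure_pmf (joint_pmf P n \<pi>)"
proof -
  let ?D = "distr (exec_space P n \<pi>) (count_space UNIV) (joint_rv \<pi>)"
  interpret E: prob_space "exec_space P n \<pi>" by (rule prob_space_exec_space[OF val])
  interpret D: prob_space ?D by (rule E.prob_space_distr[OF measurable_joint_rv[OF val]])
  have "AE x in ?D. measure ?D {x} \<noteq> 0"
    by (subst D.AE_support_countable) (auto intro!: exI[of _ UNIV])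
  then show ?thesis
    unfolding joint_pmf_def
    by (subst Abs_pmf_inverse) (auto intro: D.prob_space_axioms)
qed

lemma joint_rv_Times:
  "joint_rv \<pi> -` {(xs, ys, m, zs)} = {w. map fst w = xs \<and> map snd w = ys} \<times>
    {(a, b). transcript \<pi> xs ys a b = m \<and> out_B \<pi> ys b m = zs}"
  by (auto simp: joint_rv_def input_A_def input_B_def transcript_rv_def output_rv_def)

lemma sets_borel_eq:
  fixes f :: "real \<Rightarrow> 'a"
  assumes "f \<in> measurable borel (count_space UNIV)"
  shows "{a. f a = m} \<in> sets borel"
  using measurable_sets[OF assms, of "{m}"] by (simp add: vimage_def)

text \<open>The rectangle property in terms of probabilities: \<open>\<alpha>\<close> is the
  probability that Alice's randomness is consistent with \<open>m\<close>, and
  \<open>\<beta>\<close> the probability that Bob's is consistent with \<open>m\<close> and makes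
  him output \<open>zs\<close>. The Markov chains of the lower bound and of the structure result
  both come from this factorisation.\<close>

lemma pmf_joint_factor:
  fixes \<pi> :: "('x::finite, 'y::finite, 'z::countable) protocol"
  assumes val: "valid_protocol n \<pi>"
  obtains \<alpha> \<beta> where "\<And>xs ys m zs. pmf (joint_pmf P n \<pi>) (xs, ys, m, zs) =
      measure_pmf.prob (replicate_pmf n P) {w. map fst w = xs \<and> map snd w = ys} * \<alpha> xs m * \<beta> ys m zs"
    and "\<And>xs m. \<alpha> xs m \<ge> (0::real)" and "\<And>ys m zs. \<beta> ys m zs \<ge> (0::real)"
proof -
  interpret A: prob_space "rand_A \<pi>" using val by (simp add: valid_protocol_def)
  interpret B: prob_space "rand_B \<pi>" using val by (simp add: valid_protocol_def)
  interpret AB: pair_prob_space "rand_A \<pi>" "rand_B \<pi>" ..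
  have sets: "sets (rand_A \<pi>) = sets borel" "sets (rand_B \<pi>) = sets borel"
    using val by (auto simp: valid_protocol_def)
  have space: "space (rand_A \<pi>) = UNIV" "space (rand_B \<pi>) = UNIV"
    using sets by (auto dest: sets_eq_imp_space_eq)
  have times_R: "measure (rand_A \<pi> \<Otimes>\<^sub>M rand_B \<pi>) (C \<times> D) = measure (rand_A \<pi>) C * measure (rand_B \<pi>) D"
    if "C \<in> sets (rand_A \<pi>)" "D \<in> sets (rand_B \<pi>)" for C D
    using that by (simp add: measure_def B.emeasure_pair_measure_Times enn2real_mult)
  have times_W: "measure (measure_pmf (replicate_pmf n P) \<Otimes>\<^sub>M (rand_A \<pi> \<Otimes>\<^sub>M rand_B \<pi>)) (C \<times> D)
      = measure_pmf.prob (replicate_pmf n P) C * measure (rand_A \<pi> \<Otimes>\<^sub>M rand_B \<pi>) D"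
    if "D \<in> sets (rand_A \<pi> \<Otimes>\<^sub>M rand_B \<pi>)" for C D
    using that by (simp add: measure_def AB.P.emeasure_pair_measure_Times enn2real_mult)
  \<comment> \<open>For a possible transcript \<open>m\<close> this is the history behind it; for
    other strings it is arbitrary, hence the factor \<open>of_bool (ok m)\<close> in
    \<open>\<alpha>\<close>.\<close>
  define hist where "hist m = (SOME h. admissible \<pi> h \<and> length h = rounds \<pi> \<and> concat h = m)" for m
  define ok where "ok m \<longleftrightarrow> (\<exists>h. admissible \<pi> h \<and> length h = rounds \<pi> \<and> concat h = m)" for m
  have hist: "admissible \<pi> (hist m)" "length (hist m) = rounds \<pi>" "concat (hist m) = m" if "ok m" for m
    using someI_ex[of "\<lambda>h. admissible \<pi> h \<and> length h = rounds \<pi> \<and> concat h = m"] that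
    unfolding hist_def ok_def by auto
  define \<alpha> where "\<alpha> xs m = of_bool (ok m) * measure (rand_A \<pi>) {a. consistent_A \<pi> xs (hist m) a}" for xs m
  define \<beta> where "\<beta> ys m zs = measure (rand_B \<pi>) {b. consistent_B \<pi> ys (hist m) b \<and> out_B \<pi> ys b m = zs}" for ys m zs
  have mA: "{a. consistent_A \<pi> xs h a} \<in> sets (rand_A \<pi>)" for xs h
  proof -
    have "{a. msg_A \<pi> xs a h' = m} \<in> sets borel" for h' m
      by (rule sets_borel_eq) (use val in \<open>auto simp: valid_protocol_def\<close>)
    then have "(\<Inter>t\<in>{t. t < length h \<and> speaker \<pi> (take t h) = Alice}. {a. msg_A \<pi> xs a (take t h) = h ! t}) \<in> sets borel"
      by (intro sets.countable_INT'') auto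
    also have "(\<Inter>t\<in>{t. t < length h \<and> speaker \<pi> (take t h) = Alice}. {a. msg_A \<pi> xs a (take t h) = h ! t})
      = {a. consistent_A \<pi> xs h a}" by (auto simp: consistent_A_def)
    finally show ?thesis by (simp add: sets)
  qed
  have mB: "{b. consistent_B \<pi> ys h b \<and> out_B \<pi> ys b m = zs} \<in> sets (rand_B \<pi>)" for ys h m zs
  proof -
    have 1: "{b. msg_B \<pi> ys b h' = m} \<in> sets borel" for h' m
      by (rule sets_borel_eq) (use val in \<open>auto simp: valid_protocol_def\<close>)
    have 2: "{b. out_B \<pi> ys b m = zs} \<in> sets borel"
      by (rule sets_borel_eq) (use val in \<open>auto simp: valid_protocol_def\<close>)
    have "(\<Inter>t\<in>{t. t < length h \<and> speaker \<pi> (take t h) = Bob}. {b. msg_B \<pi> ys b (take t h) = h ! t}) \<inter> {b. out_B \<pi> ys b m = zs} \<in> sets borel"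
      by (intro sets.Int sets.countable_INT'' 1 2) auto
    also have "(\<Inter>t\<in>{t. t < length h \<and> speaker \<pi> (take t h) = Bob}. {b. msg_B \<pi> ys b (take t h) = h ! t}) \<inter> {b. out_B \<pi> ys b m = zs}
      = {b. consistent_B \<pi> ys h b \<and> out_B \<pi> ys b m = zs}" by (auto simp: consistent_B_def)
    finally show ?thesis by (simp add: sets)
  qed
  have "pmf (joint_pmf P n \<pi>) (xs, ys, m, zs) =
    measure_pmf.prob (replicate_pmf n P) {w. map fst w = xs \<and> map snd w = ys} * \<alpha> xs m * \<beta> ys m zs" for xs ys m zs
  proof -
    let ?W = "{w. map fst w = xs \<and> map snd w = ys}"
    let ?R = "{(a, b). transcript \<pi> xs ys a b = m \<and> out_B \<pi> ys b m = zs}"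
    have R: "?R = (if ok m then {a. consistent_A \<pi> xs (hist m) a} \<times> {b. consistent_B \<pi> ys (hist m) b \<and> out_B \<pi> ys b m = zs} else {})"
    proof (cases "ok m")
      case True
      show ?thesis
        using transcript_eq_iff[OF val hist(1,2)[OF True], unfolded hist(3)[OF True]] True by auto
    next
      case False
      have "transcript \<pi> xs ys a b \<noteq> m" for a b
        using False admissible_history[OF val, of xs ys a b "rounds \<pi>"]
        unfolding ok_def transcript_def by auto
      with False show ?thesis by simp
    qed
    have mR: "?R \<in> sets (rand_A \<pi> \<Otimes>\<^sub>M rand_B \<pi>)"
      unfolding R using mA mB by auto
    have "pmf (joint_pmf P n \<pi>) (xs, ys, m, zs) = measure (distr (exec_space P n \<pi>) (count_space UNIV) (joint_rv \<pi>)) {(xs, ys, m, zs)}"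
      unfolding distr_joint_rv[OF val] by (simp add: measure_pmf_single)
    also have "\<dots> = measure (exec_space P n \<pi>) (?W \<times> ?R)"
      by (subst measure_distr[OF measurable_joint_rv[OF val]])
        (auto simp: joint_rv_Times exec_space_def space_pair_measure space)
    also have "\<dots> = measure_pmf.prob (replicate_pmf n P) ?W * measure (rand_A \<pi> \<Otimes>\<^sub>M rand_B \<pi>) ?R"
      unfolding exec_space_def by (rule times_W[OF mR])
    also have "measure (rand_A \<pi> \<Otimes>\<^sub>M rand_B \<pi>) ?R = \<alpha> xs m * \<beta> ys m zs"
      unfolding R \<alpha>_def \<beta>_def by (auto simp: times_R[OF mA mB])
    finally show ?thesis by simp
  qed
  moreover have "\<alpha> xs m \<ge> 0" "\<beta> ys m zs \<ge> 0" for xs ys m zs by (auto simp: \<alpha>_def \<beta>_def)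
  ultimately show ?thesis by (rule that)
qed

section \<open>Comparison of an execution with the ideal law\<close>

definition target_pmf :: "('x \<times> 'y) pmf \<Rightarrow> ('x \<Rightarrow> 'y \<Rightarrow> 'z pmf) \<Rightarrow> (('x \<times> 'y) \<times> 'z) pmf" where
  "target_pmf P W = bind_pmf P (\<lambda>w. map_pmf (Pair w) (W (fst w) (snd w)))"

lemma pmf_target_pmf: "pmf (target_pmf P W) (w, z) = pmf P w * pmf (W (fst w) (snd w)) z"
proof -
  have "pmf (target_pmf P W) (w, z) = measure_pmf.expectation P (\<lambda>v. indicator {w} v * pmf (W (fst w) (snd w)) z)"
    unfolding target_pmf_def pmf_bind
  proof (rule Bochner_Integration.integral_cong)
    fix v
    have "Pair v -` {(w, z)} = (if v = w then {z} else {})" by auto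
    then show "pmf (map_pmf (Pair v) (W (fst v) (snd v))) (w, z) = indicator {w} v * pmf (W (fst w) (snd w)) z"
      by (simp add: pmf_map measure_pmf_single)
  qed simp
  also have "\<dots> = pmf P w * pmf (W (fst w) (snd w)) z"
    by (simp add: measure_pmf_single)
  finally show ?thesis .
qed

lemma set_target_pmf: "((x, y), z) \<in> set_pmf (target_pmf P W) \<longleftrightarrow> pmf P (x, y) > 0 \<and> pmf (W x y) z > 0"
  using pmf_target_pmf[of P W "(x, y)" z] by (auto simp: set_pmf_iff less_le)

definition triples :: "'x list \<times> 'y list \<times> bool list \<times> 'z list \<Rightarrow> (('x \<times> 'y) \<times> 'z) list" where
  "triples = (\<lambda>(xs, ys, m, zs). zip (zip xs ys) zs)"

context
  fixes P :: "('x::finite \<times> 'y::finite) pmf" and n :: nat and \<pi> :: "('x, 'y, 'z::finite) protocol"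
  assumes val: "valid_protocol n \<pi>"
begin

lemma prob_joint_pmf:
  "measure_pmf.prob (joint_pmf P n \<pi>) A = measure (exec_space P n \<pi>) {w \<in> space (exec_space P n \<pi>). joint_rv \<pi> w \<in> A}"
  unfolding distr_joint_rv[OF val, symmetric]
  by (subst measure_distr[OF measurable_joint_rv[OF val]]) (auto intro!: arg_cong[where f="measure _"])

lemma joint_pmf_support:
  assumes "q \<in> set_pmf (joint_pmf P n \<pi>)"
  shows "\<exists>w. q = joint_rv \<pi> w"
proof (rule ccontr)
  assume "\<not> ?thesis"
  then have "{w \<in> space (exec_space P n \<pi>). joint_rv \<pi> w \<in> {q}} = {}" by blast
  then have "measure_pmf.prob (joint_pmf P n \<pi>) {q} = 0"
    unfolding prob_joint_pmf by (simp only: measure_empty)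
  with assms show False by (simp add: measure_pmf_single set_pmf_iff)
qed

lemma map_inputs_joint_pmf: "map_pmf (\<lambda>(xs, ys, m, zs). zip xs ys) (joint_pmf P n \<pi>) = replicate_pmf n P"
proof -
  interpret A: prob_space "rand_A \<pi>" using val by (simp add: valid_protocol_def)
  interpret B: prob_space "rand_B \<pi>" using val by (simp add: valid_protocol_def)
  interpret AB: pair_prob_space "rand_A \<pi>" "rand_B \<pi>" ..
  let ?f = "\<lambda>(xs, ys, m, zs). zip xs ys"
  have "measure_pmf (map_pmf ?f (joint_pmf P n \<pi>)) = distr (distr (exec_space P n \<pi>) (count_space UNIV) (joint_rv \<pi>)) (count_space UNIV) ?f"
    by (simp add: distr_joint_rv[OF val] map_pmf_rep_eq)
  also have "\<dots> = distr (exec_space P n \<pi>) (count_space UNIV) (?f \<circ> joint_rv \<pi>)"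
    by (rule distr_distr) (use measurable_joint_rv[OF val] in auto)
  also have "?f \<circ> joint_rv \<pi> = fst"
    by (auto simp: joint_rv_def input_A_def input_B_def fun_eq_iff zip_map_fst_snd)
  also have "distr (exec_space P n \<pi>) (count_space UNIV) fst
    = distr (exec_space P n \<pi>) (measure_pmf (replicate_pmf n P)) fst"
    by (rule distr_cong) auto
  also have "\<dots> = measure_pmf (replicate_pmf n P)"
    unfolding exec_space_def by (rule AB.P.distr_pair_fst)
  finally show ?thesis by (rule measure_pmf_inject[THEN iffD1])
qed

lemma joint_pmf_lengths:
  assumes "(xs, ys, m, zs) \<in> set_pmf (joint_pmf P n \<pi>)"
  shows "length xs = n" "length ys = n" "length zs = n" "zip xs ys \<in> set_pmf (replicate_pmf n P)"
    "m \<in> {transcript \<pi> xs ys a b | xs ys a b. True}"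
proof -
  obtain w a b where J: "(xs, ys, m, zs) = joint_rv \<pi> (w, a, b)"
    using joint_pmf_support[OF assms] by (metis prod.collapse)
  have "zip xs ys \<in> set_pmf (map_pmf (\<lambda>(xs, ys, m, zs). zip xs ys) (joint_pmf P n \<pi>))"
    using assms by force
  then show *: "zip xs ys \<in> set_pmf (replicate_pmf n P)" by (simp only: map_inputs_joint_pmf)
  moreover have "zip xs ys = w" "length xs = length w" "length ys = length w"
    using J by (auto simp: joint_rv_def input_A_def input_B_def zip_map_fst_snd)
  ultimately show "length xs = n" "length ys = n" using length_replicate_pmf by auto
  show "length zs = n" using J val by (auto simp: joint_rv_def output_rv_def valid_protocol_def)
  show "m \<in> {transcript \<pi> xs ys a b | xs ys a b. True}"
    using J by (auto simp: joint_rv_def transcript_rv_def)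
qed

lemma length_triples: "q \<in> set_pmf (joint_pmf P n \<pi>) \<Longrightarrow> length (triples q) = n"
  using joint_pmf_lengths by (cases q) (auto simp: triples_def)

text \<open>Multiplied out, so that inputs of probability zero, where the conditional probability
  defaults to 0, form no exception.\<close>

lemma output_prob_times:
  assumes "length xs = n" "length ys = n"
  shows "pmf (replicate_pmf n P) (zip xs ys) * output_prob P n \<pi> xs ys zs
    = measure_pmf.prob (joint_pmf P n \<pi>) {(xs', ys', m, zs'). xs' = xs \<and> ys' = ys \<and> zs' = zs}"
proof -
  let ?A = "{(xs', ys', m :: bool list, zs' :: 'z list). xs' = xs \<and> ys' = ys}"
  let ?B = "{(xs', ys', m :: bool list, zs'). xs' = xs \<and> ys' = ys \<and> zs' = zs}"
  have "measure_pmf.prob (joint_pmf P n \<pi>) ?A = measure_pmf.prob (joint_pmf P n \<pi>) ((\<lambda>(xs, ys, m, zs). zip xs ys) -` {zip xs ys})"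
  proof (rule measure_pmf.finite_measure_eq_AE; (unfold AE_measure_pmf_iff)?)
    show "\<forall>q\<in>set_pmf (joint_pmf P n \<pi>). q \<in> ?A \<longleftrightarrow> q \<in> (\<lambda>(xs, ys, m, zs). zip xs ys) -` {zip xs ys}"
    proof
      fix q assume q: "q \<in> set_pmf (joint_pmf P n \<pi>)"
      obtain xs' ys' m zs' where qe: "q = (xs', ys', m, zs')" by (metis prod.collapse)
      show "q \<in> ?A \<longleftrightarrow> q \<in> (\<lambda>(xs, ys, m, zs). zip xs ys) -` {zip xs ys}"
        using joint_pmf_lengths[OF q[unfolded qe]] assms by (auto simp: qe list_eq_iff_nth_eq)
    qed
  qed auto
  also have "\<dots> = pmf (map_pmf (\<lambda>(xs, ys, m, zs). zip xs ys) (joint_pmf P n \<pi>)) (zip xs ys)"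
    by (simp add: pmf_map)
  also have "\<dots> = pmf (replicate_pmf n P) (zip xs ys)" by (simp only: map_inputs_joint_pmf)
  finally have A: "measure_pmf.prob (joint_pmf P n \<pi>) ?A = pmf (replicate_pmf n P) (zip xs ys)" .
  have "output_prob P n \<pi> xs ys zs = measure_pmf.prob (joint_pmf P n \<pi>) ?B / measure_pmf.prob (joint_pmf P n \<pi>) ?A"
    unfolding output_prob_def cond_prob_def prob_joint_pmf
    by (intro arg_cong2[where f="(/)"] arg_cong[where f="measure _"]) (auto simp: joint_rv_def)
  moreover have "measure_pmf.prob (joint_pmf P n \<pi>) ?B \<le> measure_pmf.prob (joint_pmf P n \<pi>) ?A"
    by (rule measure_pmf.finite_measure_mono) auto
  ultimately show ?thesis unfolding A[symmetric] by (cases "measure_pmf.prob (joint_pmf P n \<pi>) ?A = 0") (auto simp: measure_le_0_iff)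
qed

text \<open>The inputs have the same law in the actual and in the ideal experiment, so averaging the
  conditional l1 distances over them gives the l1 distance of the joint laws. This is the form in
  which continuity of entropy applies.\<close>

lemma correctness_error_eq:
  "correctness_error P W n \<pi> = (\<Sum>l | length l = n.
    \<bar>pmf (map_pmf triples (joint_pmf P n \<pi>)) l - pmf (replicate_pmf n (target_pmf P W)) l\<bar>)"
proof -
  let ?N = "{w :: ('x \<times> 'y) list. length w = n}" and ?Z = "{zs :: 'z list. length zs = n}"
  let ?d = "\<lambda>w zs. \<bar>output_prob P n \<pi> (map fst w) (map snd w) zs - ideal_prob W n (map fst w) (map snd w) zs\<bar>"
  have finN: "finite ?N" using finite_lists_length_eq[of "UNIV :: ('x \<times> 'y) set" n] by simp
  have "correctness_error P W n \<pi> = (\<Sum>w\<in>?N. pmf (replicate_pmf n P) w *\<^sub>R (\<Sum>zs\<in>?Z. ?d w zs))"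
    unfolding correctness_error_def
    by (rule integral_measure_pmf[OF finN]) (auto dest: length_replicate_pmf)
  also have "\<dots> = (\<Sum>w\<in>?N. \<Sum>zs\<in>?Z. pmf (replicate_pmf n P) w * ?d w zs)"
    by (simp add: sum_distrib_left)
  also have "\<dots> = (\<Sum>(w, zs)\<in>?N \<times> ?Z. pmf (replicate_pmf n P) w * ?d w zs)"
    by (rule sum.cartesian_product)
  also have "\<dots> = (\<Sum>l | length l = n.
    \<bar>pmf (map_pmf triples (joint_pmf P n \<pi>)) l - pmf (replicate_pmf n (target_pmf P W)) l\<bar>)"
  proof (rule sum.reindex_bij_witness[where i="\<lambda>l. (map fst l, map snd l)" and j="\<lambda>(w, zs). zip w zs"])
    fix a assume "a \<in> ?N \<times> ?Z"
    then obtain w zs where a: "a = (w, zs)" and len: "length w = n" "length zs = n" by auto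
    have "pmf (map_pmf triples (joint_pmf P n \<pi>)) (zip w zs)
      = measure_pmf.prob (joint_pmf P n \<pi>) {(xs', ys', m, zs'). xs' = map fst w \<and> ys' = map snd w \<and> zs' = zs}"
      unfolding pmf_map
    proof (rule measure_pmf.finite_measure_eq_AE; (unfold AE_measure_pmf_iff)?)
      show "\<forall>q\<in>set_pmf (joint_pmf P n \<pi>). q \<in> triples -` {zip w zs} \<longleftrightarrow>
        q \<in> {(xs', ys', m, zs'). xs' = map fst w \<and> ys' = map snd w \<and> zs' = zs}"
      proof
        fix q assume q: "q \<in> set_pmf (joint_pmf P n \<pi>)"
        obtain xs ys m zs' where qe: "q = (xs, ys, m, zs')" by (metis prod.collapse)
        note L = joint_pmf_lengths[OF q[unfolded qe]]
        show "q \<in> triples -` {zip w zs} \<longleftrightarrow>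
          q \<in> {(xs', ys', m, zs'). xs' = map fst w \<and> ys' = map snd w \<and> zs' = zs}"
          using L len by (auto simp: qe triples_def list_eq_iff_nth_eq prod_eq_iff)
      qed
    qed auto
    also have "\<dots> = pmf (replicate_pmf n P) w * output_prob P n \<pi> (map fst w) (map snd w) zs"
      using output_prob_times[of "map fst w" "map snd w" zs] len by (simp add: zip_map_fst_snd)
    finally have 1: "pmf (map_pmf triples (joint_pmf P n \<pi>)) (zip w zs) = pmf (replicate_pmf n P) w * output_prob P n \<pi> (map fst w) (map snd w) zs" .
    have 2: "pmf (replicate_pmf n (target_pmf P W)) (zip w zs) = pmf (replicate_pmf n P) w * ideal_prob W n (map fst w) (map snd w) zs"
      using len by (simp add: pmf_replicate_pmf ideal_prob_def pmf_target_pmf prod.distrib)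
    show "\<bar>pmf (map_pmf triples (joint_pmf P n \<pi>)) (case a of (w, zs) \<Rightarrow> zip w zs)
        - pmf (replicate_pmf n (target_pmf P W)) (case a of (w, zs) \<Rightarrow> zip w zs)\<bar>
      = (case a of (w, zs) \<Rightarrow> pmf (replicate_pmf n P) w * ?d w zs)"
      unfolding a prod.case 1 2 by (simp add: right_diff_distrib[symmetric] abs_mult)
  qed (auto simp: zip_map_fst_snd)
  finally show ?thesis .
qed

text \<open>Feeds the finiteness conditions of the entropy lemmas; the transcript is projected away
  because it may take infinitely many values.\<close>

lemma finite_range_joint:
  "finite ((\<lambda>(xs, ys, m, zs). (xs, ys, zs)) ` set_pmf (joint_pmf P n \<pi>))"
proof (rule finite_subset)
  let ?L = "{xs :: 'x list. length xs = n}" and ?M = "{xs :: 'y list. length xs = n}"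
    and ?N = "{xs :: 'z list. length xs = n}"
  show "(\<lambda>(xs, ys, m, zs). (xs, ys, zs)) ` set_pmf (joint_pmf P n \<pi>) \<subseteq> ?L \<times> ?M \<times> ?N"
    by (auto dest: joint_pmf_lengths)
  show "finite (?L \<times> ?M \<times> ?N)"
    using finite_lists_length_eq[of "UNIV :: 'x set" n] finite_lists_length_eq[of "UNIV :: 'y set" n]
      finite_lists_length_eq[of "UNIV :: 'z set" n] by simp
qed

lemma finite_range_joint_comp:
  "finite ((\<lambda>(xs, ys, m, zs). f xs ys zs) ` set_pmf (joint_pmf P n \<pi>))"
proof -
  have "(\<lambda>(xs, ys, m, zs). f xs ys zs) ` set_pmf (joint_pmf P n \<pi>)
    = (\<lambda>(xs, ys, zs). f xs ys zs) ` (\<lambda>(xs, ys, m, zs). (xs, ys, zs)) ` set_pmf (joint_pmf P n \<pi>)"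
    by (force simp: image_iff)
  then show ?thesis using finite_range_joint by simp
qed

lemma cond_mutual_info_joint:
  fixes f :: "'x list \<Rightarrow> 'y list \<Rightarrow> 'z list \<Rightarrow> 'b::countable" and g :: "'x list \<Rightarrow> 'y list \<Rightarrow> 'z list \<Rightarrow> 'c::countable"
  shows "cond_mutual_info_bits (exec_space P n \<pi>) (transcript_rv \<pi>)
      (\<lambda>w. f (input_A w) (input_B w) (output_rv \<pi> w)) (\<lambda>w. g (input_A w) (input_B w) (output_rv \<pi> w))
    = cond_ent (joint_pmf P n \<pi>) (\<lambda>(xs, ys, m, zs). f xs ys zs) (\<lambda>(xs, ys, m, zs). g xs ys zs)
      - cond_ent (joint_pmf P n \<pi>) (\<lambda>(xs, ys, m, zs). f xs ys zs) (\<lambda>(xs, ys, m, zs). (m, g xs ys zs))"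
  using cond_mutual_info_bits_comp_pmf[OF prob_space_exec_space[OF val] measurable_joint_rv[OF val]
      distr_joint_rv[OF val] finite_range_joint_comp[of f] finite_range_joint_comp[of g],
      of "\<lambda>(xs, ys, m, zs). m"]
  by (simp add: joint_rv_def case_prod_unfold)

lemma leakage_A_eq:
  "leakage_A P n \<pi> = cond_ent (joint_pmf P n \<pi>) (\<lambda>(xs, ys, m, zs). (ys, zs)) (\<lambda>(xs, ys, m, zs). xs)
    - cond_ent (joint_pmf P n \<pi>) (\<lambda>(xs, ys, m, zs). (ys, zs)) (\<lambda>(xs, ys, m, zs). (m, xs))"
  unfolding leakage_A_def by (rule cond_mutual_info_joint[of "\<lambda>_ ys zs. (ys, zs)" "\<lambda>xs _ _. xs"])

lemma leakage_B_eq: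
  "leakage_B P n \<pi> = cond_ent (joint_pmf P n \<pi>) (\<lambda>(xs, ys, m, zs). xs) (\<lambda>(xs, ys, m, zs). (ys, zs))
    - cond_ent (joint_pmf P n \<pi>) (\<lambda>(xs, ys, m, zs). xs) (\<lambda>(xs, ys, m, zs). (m, ys, zs))"
  unfolding leakage_B_def by (rule cond_mutual_info_joint[of "\<lambda>xs _ _. xs" "\<lambda>_ ys zs. (ys, zs)"])

lemma protocol_rate_eq:
  "protocol_rate P n \<pi> = (\<integral>\<^sup>+q. of_nat (length (case q of (xs, ys, m, zs) \<Rightarrow> m)) \<partial>measure_pmf (joint_pmf P n \<pi>)) / of_nat n"
proof -
  have "(\<integral>\<^sup>+q. of_nat (length (case q of (xs, ys, m, zs) \<Rightarrow> m)) \<partial>measure_pmf (joint_pmf P n \<pi>))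
    = (\<integral>\<^sup>+w. of_nat (length (case joint_rv \<pi> w of (xs, ys, m, zs) \<Rightarrow> m)) \<partial>exec_space P n \<pi>)"
    unfolding distr_joint_rv[OF val, symmetric]
    by (rule nn_integral_distr[OF measurable_joint_rv[OF val]]) simp
  then show ?thesis by (simp add: protocol_rate_def joint_rv_def)
qed

text \<open>Both parts compare with the ideal i.i.d. law in l1 norm. For the block the modulus grows
  linearly in \<open>n\<close>; for one coordinate the marginal inherits the distance
  \<open>T\<close> by data processing.\<close>

lemma block_cond_ent_dev:
  assumes n: "n > 0" and T: "correctness_error P W n \<pi> \<le> T"
  defines "K \<equiv> real (CARD(('x \<times> 'y) \<times> 'z))"
  shows "\<bar>cond_ent (joint_pmf P n \<pi>) (\<lambda>q. map f (triples q)) (\<lambda>q. map g (triples q)) - n * cond_ent (target_pmf P W) f g\<bar> \<le> n * ent_dev K T"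
    and "i < n \<Longrightarrow> \<bar>cond_ent (joint_pmf P n \<pi>) (\<lambda>q. f (triples q ! i)) (\<lambda>q. g (triples q ! i)) - cond_ent (target_pmf P W) f g\<bar> \<le> ent_dev K T"
proof -
  let ?R = "target_pmf P W" and ?I = "replicate_pmf n (target_pmf P W)" and ?Q = "map_pmf triples (joint_pmf P n \<pi>)"
  let ?A = "{l :: (('x \<times> 'y) \<times> 'z) list. length l = n}"
  have finA: "finite ?A" and cardA: "card ?A = CARD(('x \<times> 'y) \<times> 'z) ^ n"
    using finite_lists_length_eq[of "UNIV :: (('x \<times> 'y) \<times> 'z) set" n]
      card_lists_length_eq[of "UNIV :: (('x \<times> 'y) \<times> 'z) set" n] by simp_all
  have sQ: "set_pmf ?Q \<subseteq> ?A" using length_triples by auto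
  have sI: "set_pmf ?I \<subseteq> ?A" by (auto dest: length_replicate_pmf)
  have T1: "(\<Sum>l\<in>?A. \<bar>pmf ?Q l - pmf ?I l\<bar>) \<le> T" using T by (simp add: correctness_error_eq)
  then have T2: "(\<Sum>l\<in>?A. \<bar>pmf ?I l - pmf ?Q l\<bar>) \<le> T" by (simp add: abs_minus_commute)
  have T0: "T \<ge> 0" by (rule order_trans[OF _ T1]) (auto intro: sum_nonneg)
  have K1: "K \<ge> 1" 
    using zero_less_card_finite[where 'a = "('x \<times> 'y) \<times> 'z"]
    unfolding K_def real_of_nat_ge_one_iff by linarith
  have "ent_dev (card ?A) T \<le> n * ent_dev K T"
    using ent_dev_power_le[OF T0 K1 n] by (simp add: cardA K_def)
  moreover have "cond_ent ?Q (map f) (map g) \<le> cond_ent ?I (map f) (map g) + ent_dev (card ?A) T"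
    by (rule cond_ent_dev[OF finA sQ sI T1])
  moreover have "cond_ent ?I (map f) (map g) \<le> cond_ent ?Q (map f) (map g) + ent_dev (card ?A) T"
    by (rule cond_ent_dev[OF finA sI sQ T2])
  moreover have "cond_ent ?I (map f) (map g) = n * cond_ent ?R f g"
    by (rule cond_ent_replicate_pmf) simp
  moreover have "cond_ent ?Q (map f) (map g) = cond_ent (joint_pmf P n \<pi>) (\<lambda>q. map f (triples q)) (\<lambda>q. map g (triples q))"
    by (rule cond_ent_map)
  ultimately show "\<bar>cond_ent (joint_pmf P n \<pi>) (\<lambda>q. map f (triples q)) (\<lambda>q. map g (triples q)) - n * cond_ent ?R f g\<bar> \<le> n * ent_dev K T"
    by linarith
  assume i: "i < n"
  let ?f = "\<lambda>l :: (('x \<times> 'y) \<times> 'z) list. l ! i"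
  have im: "?f ` ?A = UNIV"
  proof (rule set_eqI)
    fix a show "a \<in> ?f ` ?A \<longleftrightarrow> a \<in> UNIV" using i by (auto intro!: image_eqI[of _ _ "replicate n a"])
  qed
  have mI: "map_pmf ?f ?I = ?R" by (rule map_nth_replicate_pmf[OF i])
  have t1: "(\<Sum>a\<in>UNIV. \<bar>pmf (map_pmf ?f ?Q) a - pmf ?R a\<bar>) \<le> T"
    using order_trans[OF sum_abs_pmf_map_le[OF finA sQ sI, of ?f] T1] unfolding im mI .
  have t2: "(\<Sum>a\<in>UNIV. \<bar>pmf ?R a - pmf (map_pmf ?f ?Q) a\<bar>) \<le> T"
    using t1 by (simp add: abs_minus_commute)
  have "cond_ent (map_pmf ?f ?Q) f g \<le> cond_ent ?R f g + ent_dev K T"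
    unfolding K_def by (rule cond_ent_dev[OF _ _ _ t1]) auto
  moreover have "cond_ent ?R f g \<le> cond_ent (map_pmf ?f ?Q) f g + ent_dev K T"
    unfolding K_def by (rule cond_ent_dev[OF _ _ _ t2]) auto
  moreover have "cond_ent (map_pmf ?f ?Q) f g = cond_ent (joint_pmf P n \<pi>) (\<lambda>q. f (triples q ! i)) (\<lambda>q. g (triples q ! i))"
    by (simp add: cond_ent_map)
  ultimately show "\<bar>cond_ent (joint_pmf P n \<pi>) (\<lambda>q. f (triples q ! i)) (\<lambda>q. g (triples q ! i)) - cond_ent ?R f g\<bar> \<le> ent_dev K T"
    by linarith
qed

lemma letter_prob_dev:
  assumes T: "correctness_error P W n \<pi> \<le> T" and i: "i < n"
  shows "\<bar>measure_pmf.prob (joint_pmf P n \<pi>) {q. triples q ! i = t} - pmf (target_pmf P W) t\<bar> \<le> T"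
proof -
  let ?I = "replicate_pmf n (target_pmf P W)" and ?Q = "map_pmf triples (joint_pmf P n \<pi>)"
  let ?A = "{l :: (('x \<times> 'y) \<times> 'z) list. length l = n}"
  let ?f = "\<lambda>l :: (('x \<times> 'y) \<times> 'z) list. l ! i"
  have finA: "finite ?A" using finite_lists_length_eq[of "UNIV :: (('x \<times> 'y) \<times> 'z) set" n] by simp
  have sQ: "set_pmf ?Q \<subseteq> ?A" using length_triples by auto
  have sI: "set_pmf ?I \<subseteq> ?A" by (auto dest: length_replicate_pmf)
  have T1: "(\<Sum>l\<in>?A. \<bar>pmf ?Q l - pmf ?I l\<bar>) \<le> T" using T by (simp add: correctness_error_eq)
  have t: "t \<in> ?f ` ?A" using i by (auto intro!: image_eqI[of _ _ "replicate n t"])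
  have "\<bar>pmf (map_pmf ?f ?Q) t - pmf (map_pmf ?f ?I) t\<bar> \<le> (\<Sum>b\<in>?f ` ?A. \<bar>pmf (map_pmf ?f ?Q) b - pmf (map_pmf ?f ?I) b\<bar>)"
    by (rule member_le_sum[OF t]) (use finA in auto)
  also have "\<dots> \<le> T" using order_trans[OF sum_abs_pmf_map_le[OF finA sQ sI, of ?f] T1] .
  finally show ?thesis
    unfolding map_nth_replicate_pmf[OF i] by (simp add: map_pmf_comp pmf_map vimage_def)
qed

end

section \<open>The lower bound on the rate\<close>

lemma cond_ent_condition_indep:
  assumes "\<And>w. w \<in> set_pmf p \<Longrightarrow> prob_val p (\<lambda>w. (f w, h w, g w)) w * prob_val p g w
    = prob_val p (\<lambda>w. (f w, g w)) w * prob_val p (\<lambda>w. (h w, g w)) w"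
  shows "cond_ent p f (\<lambda>w. (h w, g w)) = cond_ent p f g"
  unfolding cond_ent_def
proof (rule expectation_pmf_cong)
  fix w assume w: "w \<in> set_pmf p"
  show "log 2 (prob_val p (\<lambda>w. (h w, g w)) w / prob_val p (\<lambda>w. (f w, h w, g w)) w)
    = log 2 (prob_val p g w / prob_val p (\<lambda>w. (f w, g w)) w)"
    using assms[OF w]
    by (intro arg_cong[where f="log 2"])
      (simp add: frac_eq_eq prob_val_pos[OF w, THEN less_imp_neq, symmetric] mult.commute)
qed

lemma prob_factor_eq_sum:
  fixes p :: "'a pmf" and L :: "'a \<Rightarrow> 'l" and S :: "'a \<Rightarrow> 's" and R :: "'a \<Rightarrow> 'r"
  assumes fac: "\<And>l r. measure_pmf.prob p {w. L w = l \<and> S w = s \<and> R w = r} = A l * B r"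
    and fL: "finite (L ` set_pmf p)" and fR: "finite (R ` set_pmf p)"
  shows "measure_pmf.prob p {w. PL (L w) \<and> S w = s \<and> PR (R w)}
    = (\<Sum>l\<in>{l \<in> L ` set_pmf p. PL l}. A l) * (\<Sum>r\<in>{r \<in> R ` set_pmf p. PR r}. B r)"
proof -
  let ?I = "{l \<in> L ` set_pmf p. PL l}" and ?J = "{r \<in> R ` set_pmf p. PR r}"
  let ?E = "\<lambda>(l, r). {w. L w = l \<and> S w = s \<and> R w = r}"
  have "measure_pmf.prob p {w. PL (L w) \<and> S w = s \<and> PR (R w)} = measure_pmf.prob p (\<Union>x\<in>?I \<times> ?J. ?E x)"
    by (rule measure_pmf.finite_measure_eq_AE) (auto simp: AE_measure_pmf_iff)
  also have "\<dots> = (\<Sum>x\<in>?I \<times> ?J. measure_pmf.prob p (?E x))"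
    by (rule measure_pmf.finite_measure_finite_Union) (use fL fR in \<open>auto simp: disjoint_family_on_def\<close>)
  also have "\<dots> = (\<Sum>(l, r)\<in>?I \<times> ?J. A l * B r)"
    by (intro sum.cong) (auto simp: fac)
  finally show ?thesis by (simp add: sum_product sum.cartesian_product)
qed

text \<open>A law of the form \<open>A(l, s) B(s, r)\<close> makes \<open>L\<close>,
  \<open>S\<close>, \<open>R\<close> a Markov chain, stated here without division. Coarsening the
  ends by \<open>f\<close> and \<open>g\<close> preserves this, since sums over rectangles still
  factor.\<close>

lemma pmf_factor_markov:
  fixes p :: "'a pmf" and L :: "'a \<Rightarrow> 'l" and S :: "'a \<Rightarrow> 's" and R :: "'a \<Rightarrow> 'r"
  assumes fac: "\<And>l r s. measure_pmf.prob p {w. L w = l \<and> S w = s \<and> R w = r} = A l s * B s r"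
    and fL: "finite (L ` set_pmf p)" and fR: "finite (R ` set_pmf p)"
  shows "pmf (map_pmf (\<lambda>w. (f (L w), g (R w), S w)) p) (a, b, s) * pmf (map_pmf S p) s
    = pmf (map_pmf (\<lambda>w. (f (L w), S w)) p) (a, s) * pmf (map_pmf (\<lambda>w. (g (R w), S w)) p) (b, s)"
proof -
  note * = prob_factor_eq_sum[where s = s, OF fac fL fR]
  have 1: "pmf (map_pmf (\<lambda>w. (f (L w), g (R w), S w)) p) (a, b, s)
    = measure_pmf.prob p {w'. f (L w') = a \<and> S w' = s \<and> g (R w') = b}"
    unfolding pmf_map by (rule arg_cong[where f="measure_pmf.prob p"]) auto
  have 2: "pmf (map_pmf S p) s = measure_pmf.prob p {w'. True \<and> S w' = s \<and> True}"
    unfolding pmf_map by (rule arg_cong[where f="measure_pmf.prob p"]) auto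
  have 3: "pmf (map_pmf (\<lambda>w. (f (L w), S w)) p) (a, s)
    = measure_pmf.prob p {w'. f (L w') = a \<and> S w' = s \<and> True}"
    unfolding pmf_map by (rule arg_cong[where f="measure_pmf.prob p"]) auto
  have 4: "pmf (map_pmf (\<lambda>w. (g (R w), S w)) p) (b, s)
    = measure_pmf.prob p {w'. True \<and> S w' = s \<and> g (R w') = b}"
    unfolding pmf_map by (rule arg_cong[where f="measure_pmf.prob p"]) auto
  show ?thesis
    unfolding 1 2 3 4
      *[of "\<lambda>l. f l = a" "\<lambda>r. g r = b"] *[of "\<lambda>_. True" "\<lambda>_. True"]
      *[of "\<lambda>l. f l = a" "\<lambda>_. True"] *[of "\<lambda>_. True" "\<lambda>r. g r = b"]
    by (simp add: mult_ac)
qed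

lemma x_EQ_determined:
  assumes "pmf P (x, y) > 0" "pmf (W x y) z > 0" "pmf P (x', y) > 0" "pmf (W x' y) z > 0"
  shows "x_EQ P W x = x_EQ P W x'"
proof -
  have "x = x' \<or> x_sim P W x x'" using assms unfolding x_sim_def by blast
  then have "x_equiv P W x x'" by (auto simp: x_equiv_def)
  then show ?thesis by (simp add: x_EQ_representative)
qed

lemma cond_ent_x_EQ_target:
  "cond_ent (target_pmf P W) (\<lambda>t. x_EQ P W (fst (fst t))) (\<lambda>t. (snd (fst t), snd t)) = 0"
proof -
  let ?R = "target_pmf P W" and ?f = "\<lambda>t. x_EQ P W (fst (fst t))" and ?g = "\<lambda>t. (snd (fst t), snd t)"
  have "cond_ent ?R ?f ?g = measure_pmf.expectation ?R (\<lambda>_. 0)"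
    unfolding cond_ent_def
  proof (rule expectation_pmf_cong)
    fix t assume t: "t \<in> set_pmf ?R"
    have "prob_val ?R ?g t = prob_val ?R (\<lambda>t. (?f t, ?g t)) t"
    proof (rule prob_val_cong)
      fix t' assume t': "t' \<in> set_pmf ?R"
      obtain x y z x' y' z' where e: "t = ((x, y), z)" "t' = ((x', y'), z')" by (metis prod.collapse)
      show "?g t' = ?g t \<longleftrightarrow> (?f t', ?g t') = (?f t, ?g t)"
        using t t' x_EQ_determined[of P x' y W z x] by (auto simp: e set_target_pmf)
    qed
    then show "log 2 (prob_val ?R ?g t / prob_val ?R (\<lambda>t. (?f t, ?g t)) t) = 0"
      using prob_val_pos[OF t, of "\<lambda>t. (?f t, ?g t)"] by simp
  qed
  then show ?thesis by simp
qed

context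
  fixes P :: "('x::finite \<times> 'y::finite) pmf" and n :: nat and \<pi> :: "('x, 'y, 'z::finite) protocol"
    and W :: "'x \<Rightarrow> 'y \<Rightarrow> 'z pmf" and T :: real
  assumes val: "valid_protocol n \<pi>" and n: "n > 0" and err: "correctness_error P W n \<pi> \<le> T"
begin

lemma cond_ent_x_EQ_outputs_le:
  "cond_ent (joint_pmf P n \<pi>) (\<lambda>(xs, ys, m, zs). map (x_EQ P W) xs) (\<lambda>(xs, ys, m, zs). (ys, zs))
    \<le> n * ent_dev (CARD(('x \<times> 'y) \<times> 'z)) T"
proof -
  let ?f = "\<lambda>t :: ('x \<times> 'y) \<times> 'z. x_EQ P W (fst (fst t))"
  let ?g = "\<lambda>t :: ('x \<times> 'y) \<times> 'z. (snd (fst t), snd t)"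
  have eq: "map ?f (triples (xs, ys, m, zs)) = map (x_EQ P W) xs"
      "map ?g (triples (xs, ys, m, zs)) = zip ys zs"
    if "(xs, ys, m, zs) \<in> set_pmf (joint_pmf P n \<pi>)" for xs ys m zs
    using joint_pmf_lengths[OF val that] by (auto simp: triples_def list_eq_iff_nth_eq)
  have "cond_ent (joint_pmf P n \<pi>) (\<lambda>(xs, ys, m, zs). map (x_EQ P W) xs) (\<lambda>(xs, ys, m, zs). (ys, zs))
    = cond_ent (joint_pmf P n \<pi>) (\<lambda>w. map ?f (triples w)) (\<lambda>w. map ?g (triples w))"
  proof (rule cond_ent_cong)
    fix v w assume v: "v \<in> set_pmf (joint_pmf P n \<pi>)" and w: "w \<in> set_pmf (joint_pmf P n \<pi>)"
    obtain xs ys m zs xs' ys' m' zs' where e: "v = (xs, ys, m, zs)" "w = (xs', ys', m', zs')"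
      by (metis prod.collapse)
    have z: "zip ys zs = zip ys' zs' \<longleftrightarrow> ys = ys' \<and> zs = zs'"
      using joint_pmf_lengths[OF val v[unfolded e]] joint_pmf_lengths[OF val w[unfolded e]]
      by (auto simp: zip_eq_conv)
    show "(case v of (xs, ys, m, zs) \<Rightarrow> (ys, zs)) = (case w of (xs, ys, m, zs) \<Rightarrow> (ys, zs)) \<longleftrightarrow>
      map ?g (triples v) = map ?g (triples w)"
      using eq v w z by (simp add: e)
    then show "(case v of (xs, ys, m, zs) \<Rightarrow> map (x_EQ P W) xs) = (case w of (xs, ys, m, zs) \<Rightarrow> map (x_EQ P W) xs)
      \<and> (case v of (xs, ys, m, zs) \<Rightarrow> (ys, zs)) = (case w of (xs, ys, m, zs) \<Rightarrow> (ys, zs)) \<longleftrightarrow>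
      map ?f (triples v) = map ?f (triples w) \<and> map ?g (triples v) = map ?g (triples w)"
      using eq v w by (simp add: e)
  qed
  also have "\<dots> \<le> n * ent_dev (CARD(('x \<times> 'y) \<times> 'z)) T"
    using block_cond_ent_dev(1)[OF val n err, of ?f ?g] unfolding cond_ent_x_EQ_target by simp
  finally show ?thesis .
qed

lemma rate_lower_bound:
  "ennreal (entropy_XEQ_given_Y P W - ent_dev (CARD(('x \<times> 'y) \<times> 'z)) T) \<le> protocol_rate P n \<pi>"
proof -
  let ?M = "\<lambda>(xs :: 'x list, ys :: 'y list, m :: bool list, zs :: 'z list). m"
  let ?X = "\<lambda>(xs :: 'x list, ys :: 'y list, m :: bool list, zs :: 'z list). xs"
  let ?Y = "\<lambda>(xs :: 'x list, ys :: 'y list, m :: bool list, zs :: 'z list). ys"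
  let ?Z = "\<lambda>(xs :: 'x list, ys :: 'y list, m :: bool list, zs :: 'z list). zs"
  let ?U = "\<lambda>w. map (x_EQ P W) (?X w)"
  let ?K = "real (CARD(('x \<times> 'y) \<times> 'z))"
  have fX: "finite (?X ` set_pmf (joint_pmf P n \<pi>))" and fZ: "finite (?Z ` set_pmf (joint_pmf P n \<pi>))"
    using finite_range_joint_comp[OF val, of "\<lambda>xs ys zs. xs"] finite_range_joint_comp[OF val, of "\<lambda>xs ys zs. zs"] by auto
  have fU: "finite (?U ` set_pmf (joint_pmf P n \<pi>))"
    using finite_imageI[OF fX, of "map (x_EQ P W)"] by (simp add: image_image)
  have "cond_ent (joint_pmf P n \<pi>) ?U ?Y = n * entropy_XEQ_given_Y P W"
  proof -
    have "cond_ent (joint_pmf P n \<pi>) ?U ?Y = cond_ent (joint_pmf P n \<pi>) (\<lambda>w. map (\<lambda>(x, y). x_EQ P W x) ((\<lambda>(xs, ys, m, zs). zip xs ys) w))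
      (\<lambda>w. map snd ((\<lambda>(xs, ys, m, zs). zip xs ys) w))"
    proof -
      have eq: "map (\<lambda>(x, y). x_EQ P W x) (zip xs ys) = map (x_EQ P W) xs" "map snd (zip xs ys) = ys"
        if "(xs, ys, m, zs) \<in> set_pmf (joint_pmf P n \<pi>)" for xs ys m zs
        using joint_pmf_lengths[OF val that] by (auto simp: list_eq_iff_nth_eq)
      show ?thesis
        by (rule cond_ent_cong) (auto simp: eq)
    qed
    also have "\<dots> = cond_ent (map_pmf (\<lambda>(xs, ys, m, zs). zip xs ys) (joint_pmf P n \<pi>)) (map (\<lambda>(x, y). x_EQ P W x)) (map snd)"
      by (rule cond_ent_map[symmetric])
    also have "\<dots> = n * entropy_XEQ_given_Y P W"
      unfolding map_inputs_joint_pmf[OF val] entropy_XEQ_given_Y_eq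
      by (rule cond_ent_replicate_pmf) simp
    finally show ?thesis .
  qed
  moreover have "cond_ent (joint_pmf P n \<pi>) ?U (\<lambda>w. (?M w, ?Y w)) \<le> n * ent_dev ?K T"
  proof -
    obtain \<alpha> \<beta> where fac: "\<And>xs ys m zs. pmf (joint_pmf P n \<pi>) (xs, ys, m, zs) =
        measure_pmf.prob (replicate_pmf n P) {w. map fst w = xs \<and> map snd w = ys} * \<alpha> xs m * \<beta> ys m zs"
      by (rule pmf_joint_factor[OF val]) blast
    \<comment> \<open>The ends of the Markov chain are Alice's block and the output, its middle is
      \<open>(M, Y^n)\<close>: the factor \<open>\<beta>\<close> involves no input of Alice.\<close>
    have "measure_pmf.prob (joint_pmf P n \<pi>) {w. ?X w = xs \<and> (?M w, ?Y w) = s \<and> ?Z w = zs}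
      = (measure_pmf.prob (replicate_pmf n P) {w. map fst w = xs \<and> map snd w = snd s} * \<alpha> xs (fst s)) * \<beta> (snd s) (fst s) zs"
      for xs s zs
    proof -
      have "{w. ?X w = xs \<and> (?M w, ?Y w) = s \<and> ?Z w = zs} = {(xs, snd s, fst s, zs)}" by force
      then show ?thesis by (simp add: measure_pmf_single fac)
    qed
    note markov = pmf_factor_markov[OF this fX fZ, of "map (x_EQ P W)" "\<lambda>z. z"]
    have "cond_ent (joint_pmf P n \<pi>) ?U (\<lambda>w. (?M w, ?Y w)) = cond_ent (joint_pmf P n \<pi>) ?U (\<lambda>w. (?Z w, ?M w, ?Y w))"
      by (intro cond_ent_condition_indep[symmetric]) (unfold prob_val_def, rule markov)
    also have "\<dots> \<le> cond_ent (joint_pmf P n \<pi>) ?U (\<lambda>w. (?Y w, ?Z w))"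
      by (rule cond_ent_mono_cond[OF fU]) auto
    also have "\<dots> \<le> n * ent_dev ?K T"
      using cond_ent_x_EQ_outputs_le by (simp add: case_prod_unfold)
    finally show ?thesis .
  qed
  moreover have "ennreal (cond_ent (joint_pmf P n \<pi>) ?U ?Y - cond_ent (joint_pmf P n \<pi>) ?U (\<lambda>w. (?M w, ?Y w))) \<le> (\<integral>\<^sup>+w. of_nat (length (?M w)) \<partial>measure_pmf (joint_pmf P n \<pi>))"
  proof (rule expected_length_ge[OF fU])
    show "pairwise parallel (?M ` set_pmf (joint_pmf P n \<pi>))"
      by (rule pairwise_subset[OF pairwise_parallel_transcripts[OF val]])
        (use joint_pmf_lengths(5)[OF val] in force)
  qed
  ultimately have "ennreal (n * (entropy_XEQ_given_Y P W - ent_dev ?K T)) \<le> (\<integral>\<^sup>+w. of_nat (length (?M w)) \<partial>measure_pmf (joint_pmf P n \<pi>))"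
    by (elim order_trans[rotated]) (auto intro!: ennreal_leI simp: algebra_simps)
  then have "ennreal (n * (entropy_XEQ_given_Y P W - ent_dev ?K T)) / of_nat n \<le> protocol_rate P n \<pi>"
    unfolding protocol_rate_eq[OF val] by (rule divide_right_mono_ennreal)
  \<comment> \<open>If the difference is negative, \<open>ennreal\<close> sends both sides to
    0.\<close>
  moreover have "ennreal (n * (entropy_XEQ_given_Y P W - ent_dev ?K T)) / of_nat n = ennreal (entropy_XEQ_given_Y P W - ent_dev ?K T)"
    using n by (cases "entropy_XEQ_given_Y P W - ent_dev ?K T \<ge> 0")
      (auto simp: divide_ennreal ennreal_of_nat_eq_real_of_nat ennreal_neg mult_nonneg_nonpos)
  ultimately show ?thesis by simp
qed

end

lemma achievable_AS_ge:
  fixes P :: "('x::finite \<times> 'y::finite) pmf" and W :: "'x \<Rightarrow> 'y \<Rightarrow> 'z::finite pmf"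
  assumes "achievable_AS P W R"
  shows "ennreal (entropy_XEQ_given_Y P W) \<le> R"
proof -
  let ?K = "real (CARD(('x \<times> 'y) \<times> 'z))"
  obtain \<pi> where \<pi>: "\<And>n. n > 0 \<Longrightarrow> valid_protocol n (\<pi> n)" "\<And>n. n > 0 \<Longrightarrow> protocol_rate P n (\<pi> n) \<le> R"
    and sec: "\<And>\<epsilon> N. \<epsilon> > 0 \<Longrightarrow> \<exists>n>N. eps_secure P W n \<epsilon> (\<pi> n)"
    using assms unfolding achievable_AS_def by blast
  have le: "ennreal (entropy_XEQ_given_Y P W - ent_dev ?K (1 / Suc k)) \<le> R" for k
  proof -
    obtain n where n: "n > 0" "eps_secure P W n (1 / Suc k) (\<pi> n)"
      using sec[of "1 / Suc k" 0] by auto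
    then have "correctness_error P W n (\<pi> n) \<le> 1 / Suc k" by (simp add: eps_secure_def)
    from rate_lower_bound[OF \<pi>(1)[OF n(1)] n(1) this] \<pi>(2)[OF n(1)] show ?thesis by (rule order_trans)
  qed
  have "(\<lambda>k. ent_dev ?K (1 / real (Suc k))) \<longlonglongrightarrow> 0"
    by (rule ent_dev_tendsto) (use LIMSEQ_inverse_real_of_nat in \<open>simp add: inverse_eq_divide\<close>)
  then have "(\<lambda>k. ennreal (entropy_XEQ_given_Y P W - ent_dev ?K (1 / real (Suc k)))) \<longlonglongrightarrow> ennreal (entropy_XEQ_given_Y P W - 0)"
    by (intro tendsto_ennrealI tendsto_diff tendsto_const)
  then have "ennreal (entropy_XEQ_given_Y P W - 0) \<le> R"
    by (rule LIMSEQ_le_const2) (use le in blast)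
  then show ?thesis by simp
qed

section \<open>Necessary structure of securely computable functions\<close>

text \<open>The one-sided bound applied to \<open>\<phi>\<close> and to \<open>1 - \<phi>\<close>.
  \<open>D\<close> is a free upper bound, so that a fixed null sequence can be inserted.\<close>

lemma test_function_deviation:
  fixes f :: "'a \<Rightarrow> 'b" and g :: "'a \<Rightarrow> 'c" and h :: "'a \<Rightarrow> 'd" and p :: "'a pmf"
  assumes fin: "finite (f ` set_pmf p)"
    and phi: "\<And>v. 0 \<le> \<phi> v" "\<And>v. \<phi> v \<le> (1::real)"
    and pos: "measure_pmf.prob p {w. g w = c} > 0"
    and D: "2 * ln 2 * (cond_ent p f g - cond_ent p f (\<lambda>w. (h w, g w))) \<le> D\<^sup>2" "D \<ge> 0"
  shows "\<bar>measure_pmf.expectation p (\<lambda>w. \<phi> (h w) * indicator {w. f w = a \<and> g w = c} w) -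
    measure_pmf.prob p {w. f w = a \<and> g w = c} *
      (measure_pmf.expectation p (\<lambda>w. \<phi> (h w) * indicator {w. g w = c} w)
        / measure_pmf.prob p {w. g w = c})\<bar> \<le> D"
proof -
  have sq: "sqrt (2 * ln 2 * (cond_ent p f g - cond_ent p f (\<lambda>w. (h w, g w)))) \<le> D"
    using D by (rule real_le_lsqrt[rotated])
  have compl: "measure_pmf.expectation p (\<lambda>w. (1 - \<phi> (h w)) * indicator A w)
    = measure_pmf.prob p A - measure_pmf.expectation p (\<lambda>w. \<phi> (h w) * indicator A w)" for A
  proof -
    have i1: "integrable (measure_pmf p) (\<lambda>w. \<phi> (h w) * indicator A w)"
      by (rule measure_pmf.integrable_const_bound[of _ 1]) (auto simp: phi indicator_def)
    have "measure_pmf.expectation p (\<lambda>w. (1 - \<phi> (h w)) * indicator A w)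
      = measure_pmf.expectation p (\<lambda>w. indicator A w - \<phi> (h w) * indicator A w)"
      by (simp add: left_diff_distrib)
    also have "\<dots> = measure_pmf.expectation p (indicator A) - measure_pmf.expectation p (\<lambda>w. \<phi> (h w) * indicator A w)"
      by (rule Bochner_Integration.integral_diff[OF _ i1]) (simp add: integrable_indicator_iff measure_pmf.emeasure_eq_measure)
    finally show ?thesis by simp
  qed
  let ?e = "measure_pmf.expectation p (\<lambda>w. \<phi> (h w) * indicator {w. f w = a \<and> g w = c} w)"
  let ?m = "measure_pmf.prob p {w. f w = a \<and> g w = c}"
  let ?ec = "measure_pmf.expectation p (\<lambda>w. \<phi> (h w) * indicator {w. g w = c} w)"
  let ?mc = "measure_pmf.prob p {w. g w = c}"
  have "?e \<le> ?m * (?ec / ?mc) + D"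
    using test_function_deviation_le[OF fin, where \<phi> = \<phi> and h = h and a = a and g = g and c = c, OF phi] sq by linarith
  moreover have "?m - ?e \<le> ?m * ((?mc - ?ec) / ?mc) + D"
    using test_function_deviation_le[OF fin, where \<phi> = "\<lambda>v. 1 - \<phi> v" and h = h and a = a and g = g and c = c] phi sq
    unfolding compl by fastforce
  moreover have "?m * ((?mc - ?ec) / ?mc) = ?m - ?m * (?ec / ?mc)"
    using pos by (simp add: field_simps)
  ultimately show ?thesis by linarith
qed

text \<open>\<open>\<phi> y z v\<close> is the conditional probability of \<open>z\<close> given
  \<open>(v, y)\<close>. By the Markov chain it is also the one given \<open>(x, v, y)\<close>, so
  averaging over \<open>V\<close> on the event of \<open>x\<close> and \<open>y\<close> gives the
  probability of \<open>(x, y, z)\<close>. This expresses the output law as the mean of a test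
  function of \<open>V\<close> with values in the unit interval.\<close>

lemma markov_expectation:
  fixes p :: "'a pmf" and X :: "'a \<Rightarrow> 'x" and Z :: "'a \<Rightarrow> 'z" and Y :: "'a \<Rightarrow> 'y" and V :: "'a \<Rightarrow> 'v"
  assumes markov: "\<And>x z s. pmf (map_pmf (\<lambda>w. (X w, Z w, V w, Y w)) p) (x, z, s) * pmf (map_pmf (\<lambda>w. (V w, Y w)) p) s
    = pmf (map_pmf (\<lambda>w. (X w, V w, Y w)) p) (x, s) * pmf (map_pmf (\<lambda>w. (Z w, V w, Y w)) p) (z, s)"
  defines "\<phi> \<equiv> \<lambda>y z v. pmf (map_pmf (\<lambda>w. (Z w, V w, Y w)) p) (z, v, y) / pmf (map_pmf (\<lambda>w. (V w, Y w)) p) (v, y)"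
  shows "measure_pmf.expectation p (\<lambda>w. \<phi> y z (V w) * indicator {w. X w = x \<and> Y w = y} w)
    = measure_pmf.prob p {w. X w = x \<and> Y w = y \<and> Z w = z}"
    and "0 \<le> \<phi> y z v" and "\<phi> y z v \<le> 1"
proof -
  show nn: "0 \<le> \<phi> y z v" for v by (simp add: \<phi>_def)
  show le1: "\<phi> y z v \<le> 1" for v
  proof -
    have "pmf (map_pmf (\<lambda>w. (Z w, V w, Y w)) p) (z, v, y) \<le> pmf (map_pmf (\<lambda>w. (V w, Y w)) p) (v, y)"
      unfolding pmf_map by (rule measure_pmf.finite_measure_mono) auto
    then show ?thesis unfolding \<phi>_def by (intro divide_le_eq_1[THEN iffD2]) auto
  qed
  let ?P = "pmf (map_pmf (\<lambda>w. (V w, X w, Y w, Z w)) p)"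
  let ?k = "\<lambda>(x', v, y'). (if x' = x \<and> y' = y then ?P (v, x, y, z) else 0)"
  let ?XVY = "\<lambda>w. (X w, V w, Y w)"
  let ?f = "\<lambda>w. \<phi> y z (V w) * indicator {w. X w = x \<and> Y w = y} w"
  have "(\<integral>\<^sup>+w. ennreal (?f w) \<partial>measure_pmf p)
    = (\<integral>\<^sup>+w. ennreal (?k (?XVY w) / prob_val p ?XVY w) \<partial>measure_pmf p)"
  proof (rule nn_integral_cong_AE, unfold AE_measure_pmf_iff, rule)
    fix w assume w: "w \<in> set_pmf p"
    show "ennreal (?f w) = ennreal (?k (?XVY w) / prob_val p ?XVY w)"
    proof (cases "X w = x \<and> Y w = y")
      case True
      let ?a = "pmf (map_pmf (\<lambda>w. (Z w, V w, Y w)) p) (z, V w, y)"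
      let ?b = "pmf (map_pmf (\<lambda>w. (V w, Y w)) p) (V w, y)"
      let ?d = "pmf (map_pmf ?XVY p) (x, V w, y)"
      have b: "?b > 0" and d: "?d > 0"
        using w True by (auto intro!: pmf_positive image_eqI[of _ _ w])
      have "pmf (map_pmf (\<lambda>w. (X w, Z w, V w, Y w)) p) (x, z, V w, y) = ?P (V w, x, y, z)"
        unfolding pmf_map by (rule arg_cong[where f="measure_pmf.prob p"]) auto
      then have "?P (V w, x, y, z) * ?b = ?d * ?a"
        using markov[of x z "(V w, y)"] by simp
      then have "?a / ?b = ?P (V w, x, y, z) / ?d" using b d by (simp add: field_simps)
      then show ?thesis using True by (simp add: \<phi>_def prob_val_def)
    qed auto
  qed
  also have "\<dots> = (\<integral>\<^sup>+c. ennreal (?k c) \<partial>count_space (?XVY ` set_pmf p))"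
    by (rule nn_integral_prob_val_ratio) auto
  also have "\<dots> = (\<integral>\<^sup>+c. ennreal (?k c) \<partial>count_space (range (\<lambda>v. (x, v, y))))"
  proof (rule nn_integral_count_space_eq)
    fix c assume c: "c \<in> range (\<lambda>v. (x, v, y)) - ?XVY ` set_pmf p"
    then obtain v where v: "c = (x, v, y)" by auto
    have "(v, x, y, z) \<notin> (\<lambda>w. (V w, X w, Y w, Z w)) ` set_pmf p" using c v by auto
    then show "ennreal (?k c) = 0" by (simp add: v pmf_eq_0_set_pmf)
  qed auto
  also have "\<dots> = (\<integral>\<^sup>+v. ennreal (?k (x, v, y)) \<partial>count_space UNIV)"
    by (rule nn_integral_bij_count_space[symmetric]) (auto simp: bij_betw_def inj_on_def)
  also have "\<dots> = (\<integral>\<^sup>+v. ennreal (?P (v, x, y, z)) \<partial>count_space UNIV)" by simp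
  also have "\<dots> = ennreal (pmf (map_pmf (\<lambda>w. (X w, Y w, Z w)) p) (x, y, z))"
    by (rule nn_integral_pmf_fst)
  also have "pmf (map_pmf (\<lambda>w. (X w, Y w, Z w)) p) (x, y, z) = measure_pmf.prob p {w. X w = x \<and> Y w = y \<and> Z w = z}"
    unfolding pmf_map by (rule arg_cong[where f="measure_pmf.prob p"]) auto
  finally have "(\<integral>\<^sup>+w. ennreal (?f w) \<partial>measure_pmf p) = ennreal (measure_pmf.prob p {w. X w = x \<and> Y w = y \<and> Z w = z})" .
  moreover have "integrable (measure_pmf p) ?f"
    by (rule measure_pmf.integrable_const_bound[of _ 1]) (auto simp: nn le1 indicator_def)
  ultimately show "measure_pmf.expectation p ?f = measure_pmf.prob p {w. X w = x \<and> Y w = y \<and> Z w = z}"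
    by (subst (asm) nn_integral_eq_integral) (auto simp: nn integral_nonneg_AE)
qed

text \<open>
  Here \<open>r\<close> is the law of \<open>(((X, Y), Z), V)\<close>. The first conjunct is the Markov chain
  \<open>X \<rightarrow> (V, Y) \<rightarrow> Z\<close>, the next two bound \<open>I(V; Y Z | X)\<close> and \<open>I(V; X | Y Z)\<close>.
\<close>

definition letter_secure ::
  "('x \<times> 'y) pmf \<Rightarrow> ('x \<Rightarrow> 'y \<Rightarrow> 'z pmf) \<Rightarrow> real \<Rightarrow> real \<Rightarrow> ((('x \<times> 'y) \<times> 'z) \<times> 'v) pmf \<Rightarrow> bool" where
  "letter_secure P W \<epsilon> \<delta> r \<longleftrightarrow>
    (\<forall>x z s. pmf (map_pmf (\<lambda>w. (fst (fst (fst w)), snd (fst w), snd w, snd (fst (fst w)))) r) (x, z, s)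
        * pmf (map_pmf (\<lambda>w. (snd w, snd (fst (fst w)))) r) s
      = pmf (map_pmf (\<lambda>w. (fst (fst (fst w)), snd w, snd (fst (fst w)))) r) (x, s)
        * pmf (map_pmf (\<lambda>w. (snd (fst w), snd w, snd (fst (fst w)))) r) (z, s)) \<and>
    cond_ent r (\<lambda>w. (snd (fst (fst w)), snd (fst w))) (\<lambda>w. fst (fst (fst w)))
      - cond_ent r (\<lambda>w. (snd (fst (fst w)), snd (fst w))) (\<lambda>w. (snd w, fst (fst (fst w)))) \<le> \<delta> \<and>
    cond_ent r (\<lambda>w. fst (fst (fst w))) (\<lambda>w. (snd (fst (fst w)), snd (fst w)))
      - cond_ent r (\<lambda>w. fst (fst (fst w))) (\<lambda>w. (snd w, snd (fst (fst w)), snd (fst w))) \<le> \<delta> \<and>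
    (\<forall>t. \<bar>pmf (map_pmf fst r) t - pmf (target_pmf P W) t\<bar> \<le> \<epsilon>)"

text \<open>
  The limit argument: \<open>\<rho> k A\<close> is the mean of a fixed test function of \<open>V\<close> given the event \<open>A\<close>. Vanishing
  leakage makes it asymptotically equal given \<open>(x, y, z)\<close>, given \<open>x\<close>, and given \<open>(y, z)\<close>.
\<close>

lemma structure_limit:
  fixes r :: "nat \<Rightarrow> ((('x::finite \<times> 'y::finite) \<times> 'z::finite) \<times> 'v) pmf" and P :: "('x \<times> 'y) pmf"
    and W :: "'x \<Rightarrow> 'y \<Rightarrow> 'z pmf"
  assumes sec: "\<And>k. letter_secure P W (\<epsilon> k) (\<delta> k) (r k)"
    and eps: "\<epsilon> \<longlonglongrightarrow> 0" and delta: "\<delta> \<longlonglongrightarrow> 0"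
    and equiv: "x_equiv P W x x'" and px: "pmf P (x, y) > 0" and px': "pmf P (x', y) > 0"
  shows "W x y = W x' y"
proof (rule pmf_eqI)
  fix z
  define X Y Z V where rvs: "X = (\<lambda>w :: (('x \<times> 'y) \<times> 'z) \<times> 'v. fst (fst (fst w)))"
    "Y = (\<lambda>w :: (('x \<times> 'y) \<times> 'z) \<times> 'v. snd (fst (fst w)))"
    "Z = (\<lambda>w :: (('x \<times> 'y) \<times> 'z) \<times> 'v. snd (fst w))" "V = (\<lambda>w :: (('x \<times> 'y) \<times> 'z) \<times> 'v. snd w)"
  \<comment> \<open>The Pinsker-type deviation bound as a null sequence; the absolute value guards
    against negative \<open>\<delta> k\<close>.\<close>
  define D where "D k = sqrt (2 * ln 2 * \<bar>\<delta> k\<bar>)" for k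
  have D0: "D k \<ge> 0" for k by (simp add: D_def)
  have "(\<lambda>k. sqrt (2 * ln 2 * \<bar>\<delta> k\<bar>)) \<longlonglongrightarrow> sqrt (2 * ln 2 * \<bar>0\<bar>)"
    by (intro tendsto_intros delta)
  then have D: "D \<longlonglongrightarrow> 0" by (simp add: D_def[abs_def])
  have D2: "2 * ln 2 * u \<le> (D k)\<^sup>2" if "u \<le> \<delta> k" for u k
  proof -
    have "2 * ln 2 * u \<le> 2 * ln 2 * \<bar>\<delta> k\<bar>" using that by (intro mult_left_mono) auto
    then show ?thesis by (simp add: D_def)
  qed
  have markov: "pmf (map_pmf (\<lambda>w. (X w, Z w, V w, Y w)) (r k)) (x, z, s) * pmf (map_pmf (\<lambda>w. (V w, Y w)) (r k)) s
      = pmf (map_pmf (\<lambda>w. (X w, V w, Y w)) (r k)) (x, s) * pmf (map_pmf (\<lambda>w. (Z w, V w, Y w)) (r k)) (z, s)"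
    and leakA: "2 * ln 2 * (cond_ent (r k) (\<lambda>w. (Y w, Z w)) X - cond_ent (r k) (\<lambda>w. (Y w, Z w)) (\<lambda>w. (V w, X w))) \<le> (D k)\<^sup>2"
    and leakB: "2 * ln 2 * (cond_ent (r k) X (\<lambda>w. (Y w, Z w)) - cond_ent (r k) X (\<lambda>w. (V w, Y w, Z w))) \<le> (D k)\<^sup>2"
    and dist: "\<bar>pmf (map_pmf fst (r k)) t - pmf (target_pmf P W) t\<bar> \<le> \<epsilon> k" for k x z s t
    using sec[of k] unfolding letter_secure_def rvs by (blast intro: D2)+
  have law: "(\<lambda>k. pmf (map_pmf fst (r k)) t) \<longlonglongrightarrow> pmf (target_pmf P W) t" for t
  proof (rule LIM_zero_cancel, rule Lim_null_comparison[OF _ eps])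
    show "\<forall>\<^sub>F k in sequentially. norm (pmf (map_pmf fst (r k)) t - pmf (target_pmf P W) t) \<le> \<epsilon> k"
      unfolding real_norm_def
      by (intro always_eventually allI dist)
  qed
  \<comment> \<open>The test function belongs to the fixed \<open>y\<close> and \<open>z\<close> of
    the goal. It stays the same while the chain of related letters passes through other pairs
    \<open>(y0, z0)\<close>.\<close>
  define \<phi> where "\<phi> k v = pmf (map_pmf (\<lambda>w. (Z w, V w, Y w)) (r k)) (z, v, y) / pmf (map_pmf (\<lambda>w. (V w, Y w)) (r k)) (v, y)" for k v
  define m where "m k A = measure_pmf.prob (r k) A" for k A
  define e where "e k A = measure_pmf.expectation (r k) (\<lambda>w. \<phi> k (V w) * indicator A w)" for k A
  define \<rho> where "\<rho> k A = e k A / m k A" for k A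
  let ?x = "\<lambda>x. {w. X w = x}" and ?xy = "\<lambda>x y. {w. X w = x \<and> Y w = y}"
    and ?yz = "\<lambda>y z. {w. (Y w, Z w) = (y, z)}" and ?xyz = "\<lambda>x y z. {w. (Y w, Z w) = (y, z) \<and> X w = x}"
  have \<phi>01: "0 \<le> \<phi> k v" "\<phi> k v \<le> 1" for k v
    unfolding \<phi>_def using markov_expectation(2,3)[OF markov] by auto
  have m_xyz: "(\<lambda>k. m k (?xyz x y z)) \<longlonglongrightarrow> pmf P (x, y) * pmf (W x y) z" for x y z
  proof -
    have "m k (?xyz x y z) = pmf (map_pmf fst (r k)) ((x, y), z)" for k
      unfolding m_def pmf_map rvs by (rule arg_cong[where f="measure_pmf.prob (r k)"]) auto
    then show ?thesis using law[of "((x, y), z)"] by (simp add: pmf_target_pmf)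
  qed
  have m_xy_sum: "m k (?xy x y) = (\<Sum>z\<in>UNIV. m k (?xyz x y z))" for k x y
  proof -
    have "?xy x y = (\<Union>z\<in>UNIV. ?xyz x y z)" by auto
    then show ?thesis unfolding m_def
      by (simp only:) (rule measure_pmf.finite_measure_finite_Union, auto simp: disjoint_family_on_def)
  qed
  have e_xy_sum: "e k (?xy x y) = (\<Sum>z\<in>UNIV. e k (?xyz x y z))" for k x y
  proof -
    have "e k (?xy x y) = measure_pmf.expectation (r k) (\<lambda>w. \<Sum>z\<in>UNIV. \<phi> k (V w) * indicator (?xyz x y z) w)"
      unfolding e_def
    proof (rule Bochner_Integration.integral_cong)
      fix w
      have "(\<Sum>z\<in>UNIV. \<phi> k (V w) * indicator (?xyz x y z) w)
        = (\<Sum>z\<in>UNIV. if z = Z w then \<phi> k (V w) * indicator (?xy x y) w else 0)"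
        by (rule sum.cong) (auto simp: indicator_def)
      also have "\<dots> = \<phi> k (V w) * indicator (?xy x y) w" by simp
      finally show "\<phi> k (V w) * indicator (?xy x y) w = (\<Sum>z\<in>UNIV. \<phi> k (V w) * indicator (?xyz x y z) w)"
        by (rule sym)
    qed simp
    also have "\<dots> = (\<Sum>z\<in>UNIV. e k (?xyz x y z))"
      unfolding e_def
      by (rule Bochner_Integration.integral_sum, rule measure_pmf.integrable_const_bound[of _ 1])
        (auto simp: \<phi>01 indicator_def)
    finally show ?thesis .
  qed
  \<comment> \<open>\<open>devA\<close> uses the leakage to Alice: given \<open>x\<close>,
    conditioning further on \<open>(y, z)\<close> hardly changes the mean. \<open>devB\<close> uses
    the leakage to Bob, with the roles of \<open>x\<close> and \<open>(y, z)\<close>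
    exchanged.\<close>
  have devA: "\<bar>e k (?xyz x y z) - m k (?xyz x y z) * \<rho> k (?x x)\<bar> \<le> D k" if "m k (?x x) > 0" for k x y z
    using test_function_deviation[of "\<lambda>w. (Y w, Z w)" "r k" "\<phi> k" X x V "D k" "(y, z)"] \<phi>01 leakA D0 that
    unfolding e_def m_def \<rho>_def by (simp add: finite_subset[OF subset_UNIV])
  have devB: "\<bar>e k (?xyz x y z) - m k (?xyz x y z) * \<rho> k (?yz y z)\<bar> \<le> D k" if "m k (?yz y z) > 0" for k x y z
  proof -
    have "?xyz x y z = {w. X w = x \<and> (Y w, Z w) = (y, z)}" by auto
    then show ?thesis
      using test_function_deviation[of X "r k" "\<phi> k" "\<lambda>w. (Y w, Z w)" "(y, z)" V "D k" x] \<phi>01 leakB D0 that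
      unfolding e_def m_def \<rho>_def by (simp add: finite_subset[OF subset_UNIV])
  qed
  \<comment> \<open>Dividing by the mass of \<open>A\<close> is harmless because this mass has a
    positive limit; the positivity conditions in \<open>x_sim\<close> provide that.\<close>
  have close: "(\<lambda>k. \<rho> k A - \<rho> k B) \<longlonglongrightarrow> 0"
    if dev: "\<And>k. m k B > 0 \<Longrightarrow> \<bar>e k A - m k A * \<rho> k B\<bar> \<le> D k" and sub: "A \<subseteq> B"
      and lim: "(\<lambda>k. m k A) \<longlonglongrightarrow> c" "c > 0" for A B c
  proof (rule Lim_null_comparison)
    have "\<forall>\<^sub>F k in sequentially. m k A > 0" using lim by (rule order_tendstoD)
    then show "\<forall>\<^sub>F k in sequentially. norm (\<rho> k A - \<rho> k B) \<le> D k / m k A"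
    proof eventually_elim
      case (elim k)
      then have "m k B > 0"
        using measure_pmf.finite_measure_mono[OF sub, of "r k"] by (auto simp: m_def)
      from dev[OF this] have "\<bar>e k A - m k A * \<rho> k B\<bar> / m k A \<le> D k / m k A"
        using elim by (intro divide_right_mono) auto
      moreover have "\<bar>e k A - m k A * \<rho> k B\<bar> / m k A = \<bar>(e k A - m k A * \<rho> k B) / m k A\<bar>"
        using elim by simp
      moreover have "(e k A - m k A * \<rho> k B) / m k A = \<rho> k A - \<rho> k B"
        using elim by (simp add: \<rho>_def[of k A] diff_divide_distrib)
      ultimately show ?case by simp
    qed
    show "(\<lambda>k. D k / m k A) \<longlonglongrightarrow> 0" using tendsto_divide[OF D lim(1)] lim(2) by simp
  qed
  \<comment> \<open>Adjacent members of the list \<open>x1\<close>, \<open>(x1, y0, z0)\<close>,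
    \<open>(y0, z0)\<close>, \<open>(x2, y0, z0)\<close>, \<open>x2\<close> have asymptotically
    equal conditional means.\<close>
  have step: "(\<lambda>k. \<rho> k (?x x1) - \<rho> k (?x x2)) \<longlonglongrightarrow> 0" if sim: "x_sim P W x1 x2" for x1 x2
  proof -
    obtain y0 z0 where pos: "pmf P (x1, y0) > 0" "pmf P (x2, y0) > 0" "pmf (W x1 y0) z0 > 0" "pmf (W x2 y0) z0 > 0"
      using sim unfolding x_sim_def by blast
    have a: "(\<lambda>k. \<rho> k (?xyz x1 y0 z0) - \<rho> k (?x x1)) \<longlonglongrightarrow> 0" "(\<lambda>k. \<rho> k (?xyz x2 y0 z0) - \<rho> k (?x x2)) \<longlonglongrightarrow> 0"
      by (rule close[OF devA _ m_xyz]; use pos in auto)+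
    have b: "(\<lambda>k. \<rho> k (?xyz x1 y0 z0) - \<rho> k (?yz y0 z0)) \<longlonglongrightarrow> 0" "(\<lambda>k. \<rho> k (?xyz x2 y0 z0) - \<rho> k (?yz y0 z0)) \<longlonglongrightarrow> 0"
      by (rule close[OF devB _ m_xyz]; use pos in auto)+
    show ?thesis
      using tendsto_add[OF tendsto_diff[OF b(1) a(1)] tendsto_diff[OF a(2) b(2)]] by (simp add: algebra_simps)
  qed
  have chain: "(\<lambda>k. \<rho> k (?x x) - \<rho> k (?x x')) \<longlonglongrightarrow> 0"
    using equiv unfolding x_equiv_def
  proof (induction rule: rtranclp_induct)
    case (step x1 x2)
    from tendsto_add[OF step.IH \<open>\<And>x1 x2. x_sim P W x1 x2 \<Longrightarrow> (\<lambda>k. \<rho> k (?x x1) - \<rho> k (?x x2)) \<longlonglongrightarrow> 0\<close>[OF step.hyps(2)]]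
    show ?case by simp
  qed simp
  \<comment> \<open>Given \<open>(x, y)\<close> the mean of the test function is exactly the
    conditional probability of \<open>z\<close>; given \<open>x\<close> alone it is asymptotically
    the same, by the leakage to Alice.\<close>
  have limit: "(\<lambda>k. \<rho> k (?x x)) \<longlonglongrightarrow> pmf (W x y) z" if p: "pmf P (x, y) > 0" for x
  proof -
    have m_xy: "(\<lambda>k. m k (?xy x y)) \<longlonglongrightarrow> pmf P (x, y)"
    proof -
      have "(\<lambda>k. m k (?xy x y)) \<longlonglongrightarrow> (\<Sum>z\<in>UNIV. pmf P (x, y) * pmf (W x y) z)"
        unfolding m_xy_sum by (intro tendsto_sum m_xyz)
      also have "(\<Sum>z\<in>UNIV. pmf P (x, y) * pmf (W x y) z) = pmf P (x, y)"
        by (simp add: sum_distrib_left[symmetric] sum_pmf_eq_1)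
      finally show ?thesis .
    qed
    have e_xy: "e k (?xy x y) = m k (?xyz x y z)" for k
      unfolding e_def m_def \<phi>_def markov_expectation(1)[OF markov]
      by (rule arg_cong[where f="measure_pmf.prob (r k)"]) auto
    have "(\<lambda>k. m k (?xyz x y z) - m k (?xy x y) * \<rho> k (?x x)) \<longlonglongrightarrow> 0"
    proof (rule Lim_null_comparison)
      have "\<forall>\<^sub>F k in sequentially. m k (?xy x y) > 0" using m_xy p by (rule order_tendstoD)
      then show "\<forall>\<^sub>F k in sequentially. norm (m k (?xyz x y z) - m k (?xy x y) * \<rho> k (?x x)) \<le> CARD('z) * D k"
      proof eventually_elim
        case (elim k)
        have "m k (?xy x y) \<le> m k (?x x)" unfolding m_def by (rule measure_pmf.finite_measure_mono) auto
        with elim have pos: "m k (?x x) > 0" by simp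
        \<comment> \<open>Only events fixing all of \<open>x\<close>, \<open>y\<close> and
          \<open>z'\<close> are controlled by \<open>devA\<close>, so the event of
          \<open>(x, y)\<close> is split over the finitely many \<open>z'\<close>; hence the factor
          \<open>CARD('z)\<close>.\<close>
        have "m k (?xyz x y z) - m k (?xy x y) * \<rho> k (?x x)
          = (\<Sum>z'\<in>UNIV. e k (?xyz x y z') - m k (?xyz x y z') * \<rho> k (?x x))"
          unfolding e_xy[symmetric] e_xy_sum m_xy_sum by (simp add: sum_subtractf sum_distrib_right)
        also have "\<bar>\<dots>\<bar> \<le> (\<Sum>z'\<in>(UNIV :: 'z set). D k)"
          by (rule order_trans[OF sum_abs sum_mono]) (rule devA[OF pos])
        finally show ?case by simp
      qed
      show "(\<lambda>k. CARD('z) * D k) \<longlonglongrightarrow> 0" using tendsto_mult_left[OF D, of "real CARD('z)"] by simp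
    qed
    from tendsto_diff[OF m_xyz[where x = x and y = y and z = z] this]
    have "(\<lambda>k. m k (?xy x y) * \<rho> k (?x x)) \<longlonglongrightarrow> pmf P (x, y) * pmf (W x y) z" by simp
    from tendsto_divide[OF this m_xy] p
    have "(\<lambda>k. m k (?xy x y) * \<rho> k (?x x) / m k (?xy x y)) \<longlonglongrightarrow> pmf (W x y) z" by simp
    moreover have "\<forall>\<^sub>F k in sequentially. m k (?xy x y) * \<rho> k (?x x) / m k (?xy x y) = \<rho> k (?x x)"
      using order_tendstoD(1)[OF m_xy p] by eventually_elim simp
    ultimately show ?thesis by (rule Lim_transform_eventually)
  qed
  from tendsto_diff[OF limit[OF px] limit[OF px']] chain
  have "pmf (W x y) z - pmf (W x' y) z = 0" by (rule LIMSEQ_unique)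
  then show "pmf (W x y) z = pmf (W x' y) z" by simp
qed

section \<open>From blocks to a single letter\<close>

lemma prob_replicate_unzip:
  assumes "length xs = n" "length ys = n"
  shows "measure_pmf.prob (replicate_pmf n P) {w. map fst w = xs \<and> map snd w = ys} = prod_list (map (pmf P) (zip xs ys))"
proof -
  have "{w. map fst w = xs \<and> map snd w = ys} = {zip xs ys}"
    using assms by (auto simp: zip_map_fst_snd)
  then show ?thesis
    using assms by (simp add: measure_pmf_single pmf_replicate_pmf prod.list_conv_set_nth atLeast0LessThan)
qed

lemma take_Suc_eq_iff:
  assumes "k < length l" "k < length l'"
  shows "take (Suc k) l = take (Suc k) l' \<longleftrightarrow> take k l = take k l' \<and> l ! k = l' ! k"
  using assms by (simp add: take_Suc_conv_app_nth)

lemma drop_eq_iff_Suc: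
  assumes "k < length l" "k < length l'"
  shows "drop k l = drop k l' \<longleftrightarrow> drop (Suc k) l = drop (Suc k) l' \<and> l ! k = l' ! k"
  using assms by (auto simp: Cons_nth_drop_Suc[symmetric])

lemma finite_image_determined:
  assumes "finite (g ` A)" and det: "\<And>v w. v \<in> A \<Longrightarrow> w \<in> A \<Longrightarrow> g v = g w \<Longrightarrow> f v = f w"
  shows "finite (f ` A)"
proof (rule finite_subset)
  have "f v = f (SOME w. w \<in> A \<and> g w = g v)" if "v \<in> A" for v
    using someI[of "\<lambda>w. w \<in> A \<and> g w = g v" v] that det[of v "SOME w. w \<in> A \<and> g w = g v"] by simp
  then show "f ` A \<subseteq> (\<lambda>c. f (SOME w. w \<in> A \<and> g w = c)) ` g ` A" by auto
qed (use assms in simp)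

text \<open>Chosen so that both chain rules produce it: together with \<open>X_i\<close> it is a
  function of \<open>M\<close>, all inputs of Alice and the earlier pairs \<open>(Y, Z)\<close>;
  together with \<open>(Y_i, Z_i)\<close> it is a function of \<open>M\<close>, Bob's whole block
  and the later inputs of Alice. Positions count from 0, so \<open>drop (Suc i)\<close> leaves out
  position \<open>i\<close> itself.\<close>

definition side_info :: "nat \<Rightarrow> 'x list \<times> 'y list \<times> bool list \<times> 'z list \<Rightarrow> bool list \<times> 'x list \<times> 'y list \<times> 'z list" where
  "side_info i = (\<lambda>(xs, ys, m, zs). (m, drop (Suc i) xs, take i ys, take i zs))"

context
  fixes P :: "('x::finite \<times> 'y::finite) pmf" and n :: nat and \<pi> :: "('x, 'y, 'z::finite) protocol"
  assumes val: "valid_protocol n \<pi>"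
begin

lemma triples_nth:
  assumes "w \<in> set_pmf (joint_pmf P n \<pi>)" "i < n"
  shows "triples w ! i = ((fst w ! i, fst (snd w) ! i), snd (snd (snd w)) ! i)"
proof -
  obtain xs ys m zs where w: "w = (xs, ys, m, zs)" by (metis prod.collapse)
  show ?thesis
    using joint_pmf_lengths[OF val assms(1)[unfolded w]] assms(2) by (simp add: w triples_def)
qed

text \<open>Fixing the side information and \<open>Y_i\<close> separates the block: Alice's inputs
  up to \<open>i\<close> lie on the left, Bob's later inputs and the outputs from \<open>i\<close>
  on lie on the right. Each input pair has at least one component fixed, its \<open>y\<close> up to
  position \<open>i\<close> and its \<open>x\<close> afterwards, so the product law of the inputs
  splits at \<open>i\<close>, and \<open>\<alpha>\<close> and \<open>\<beta>\<close> go to opposite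
  sides.\<close>

lemma markov_side_info:
  assumes i: "i < n"
  shows "pmf (map_pmf (\<lambda>w. (fst (fst (triples w ! i)), snd (triples w ! i), side_info i w, snd (fst (triples w ! i)))) (joint_pmf P n \<pi>)) (x, z, s)
      * pmf (map_pmf (\<lambda>w. (side_info i w, snd (fst (triples w ! i)))) (joint_pmf P n \<pi>)) s
    = pmf (map_pmf (\<lambda>w. (fst (fst (triples w ! i)), side_info i w, snd (fst (triples w ! i)))) (joint_pmf P n \<pi>)) (x, s)
      * pmf (map_pmf (\<lambda>w. (snd (triples w ! i), side_info i w, snd (fst (triples w ! i)))) (joint_pmf P n \<pi>)) (z, s)"
proof -
  let ?q = "joint_pmf P n \<pi>"
  obtain \<alpha> \<beta> where fac: "\<And>xs ys m zs. pmf ?q (xs, ys, m, zs) =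
      measure_pmf.prob (replicate_pmf n P) {w. map fst w = xs \<and> map snd w = ys} * \<alpha> xs m * \<beta> ys m zs"
    by (rule pmf_joint_factor[OF val]) blast
  let ?L = "\<lambda>w :: 'x list \<times> 'y list \<times> bool list \<times> 'z list. take (Suc i) (fst w)"
  let ?S = "\<lambda>w :: 'x list \<times> 'y list \<times> bool list \<times> 'z list. (side_info i w, fst (snd w) ! i)"
  let ?R = "\<lambda>w :: 'x list \<times> 'y list \<times> bool list \<times> 'z list. (drop (Suc i) (fst (snd w)), drop i (snd (snd (snd w))))"
  \<comment> \<open>The length guards make the zipped and appended pieces line up with the cut at
    \<open>i\<close>; where a guard fails, the event has probability 0.\<close>
  define A where "A = (\<lambda>l ((m :: bool list, x2, y1, z1 :: 'z list), y).
    of_bool (length l = Suc i \<and> length x2 = n - Suc i \<and> length y1 = i \<and> length z1 = i) *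
      (prod_list (map (pmf P) (zip l (y1 @ [y]))) * \<alpha> (l @ x2) m))"
  define B where "B = (\<lambda>((m :: bool list, x2, y1, z1), y) (y2, z2).
    of_bool (length y2 = n - Suc i \<and> length z2 = n - i) *
      (prod_list (map (pmf P) (zip x2 y2)) * \<beta> (y1 @ [y] @ y2) m (z1 @ z2)))"
  have fac': "measure_pmf.prob ?q {w. ?L w = l \<and> ?S w = s \<and> ?R w = r} = A l s * B s r" for l s r
  proof -
    obtain m x2 y1 z1 y where s: "s = ((m, x2, y1, z1), y)" by (metis prod.collapse)
    obtain y2 z2 where r: "r = (y2, z2)" by fastforce
    let ?ok = "length l = Suc i \<and> length x2 = n - Suc i \<and> length y1 = i \<and> length z1 = i \<and> length y2 = n - Suc i \<and> length z2 = n - i"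
    let ?w = "(l @ x2, y1 @ y # y2, m, z1 @ z2)"
    have iff: "?L w = l \<and> ?S w = s \<and> ?R w = r \<longleftrightarrow> ?ok \<and> w = ?w" if w: "w \<in> set_pmf ?q" for w
    proof -
      obtain xs ys m' zs where we: "w = (xs, ys, m', zs)" by (metis prod.collapse)
      note len = joint_pmf_lengths(1-3)[OF val w[unfolded we]]
      show ?thesis
      proof
        assume *: "?L w = l \<and> ?S w = s \<and> ?R w = r"
        then have e: "l = take (Suc i) xs" "x2 = drop (Suc i) xs" "m = m'" "y1 = take i ys" "y = ys ! i"
          "y2 = drop (Suc i) ys" "z1 = take i zs" "z2 = drop i zs"
          by (auto simp: we s r side_info_def)
        have "ys = take i ys @ ys ! i # drop (Suc i) ys" using i len by (simp add: id_take_nth_drop)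
        then show "?ok \<and> w = ?w" using i len unfolding e we by simp
      next
        assume "?ok \<and> w = ?w"
        then show "?L w = l \<and> ?S w = s \<and> ?R w = r"
          using i by (auto simp: s r side_info_def nth_append)
      qed
    qed
    have "measure_pmf.prob ?q {w. ?L w = l \<and> ?S w = s \<and> ?R w = r} = measure_pmf.prob ?q {w. ?ok \<and> w = ?w}"
      by (rule measure_pmf.finite_measure_eq_AE) (use iff in \<open>auto simp: AE_measure_pmf_iff\<close>)
    also have "\<dots> = of_bool ?ok * pmf ?q ?w"
    proof (cases ?ok)
      case True
      then have "{w. ?ok \<and> w = ?w} = {?w}" by blast
      with True show ?thesis by (simp only: measure_pmf_single) simp
    next
      case False
      then have "{w. ?ok \<and> w = ?w} = {}" by blast
      with False show ?thesis by (simp only: measure_empty) simp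
    qed
    also have "\<dots> = A l s * B s r"
    proof (cases ?ok)
      case True
      then have "prod_list (map (pmf P) (zip (l @ x2) (y1 @ y # y2)))
        = prod_list (map (pmf P) (zip l (y1 @ [y]))) * prod_list (map (pmf P) (zip x2 y2))"
        using zip_append[of l "y1 @ [y]" x2 y2] by simp
      moreover have "measure_pmf.prob (replicate_pmf n P) {w. map fst w = l @ x2 \<and> map snd w = y1 @ y # y2}
        = prod_list (map (pmf P) (zip (l @ x2) (y1 @ y # y2)))"
        by (rule prob_replicate_unzip) (use True i in auto)
      ultimately show ?thesis using True by (simp add: A_def B_def s r fac)
    qed (auto simp: A_def B_def s r)
    finally show ?thesis .
  qed
  have fin: "finite (?L ` set_pmf ?q)" "finite (?R ` set_pmf ?q)"
    using finite_range_joint_comp[OF val, of "\<lambda>xs ys zs. take (Suc i) xs" P]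
      finite_range_joint_comp[OF val, of "\<lambda>xs ys zs. (drop (Suc i) ys, drop i zs)" P]
    by (simp_all add: case_prod_unfold)
  have cong: "map_pmf f ?q = map_pmf f' ?q" if "\<And>w. w \<in> set_pmf ?q \<Longrightarrow> f w = f' w" for f f' :: "_ \<Rightarrow> 'b"
    using that by (rule map_pmf_cong[OF refl])
  have X: "?L w ! i = fst (fst (triples w ! i))" and Y: "fst (snd w) ! i = snd (fst (triples w ! i))"
    and Z: "hd (snd (?R w)) = snd (triples w ! i)" if "w \<in> set_pmf ?q" for w
  proof -
    obtain xs ys m' zs where we: "w = (xs, ys, m', zs)" by (metis prod.collapse)
    note len = joint_pmf_lengths(1-3)[OF val that[unfolded we]]
    show "?L w ! i = fst (fst (triples w ! i))" "fst (snd w) ! i = snd (fst (triples w ! i))"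
      "hd (snd (?R w)) = snd (triples w ! i)"
      using triples_nth[OF that i] i len by (simp_all add: we hd_drop_conv_nth)
  qed
  have "map_pmf (\<lambda>w. (?L w ! i, hd (snd (?R w)), ?S w)) ?q
    = map_pmf (\<lambda>w. (fst (fst (triples w ! i)), snd (triples w ! i), side_info i w, snd (fst (triples w ! i)))) ?q"
    "map_pmf ?S ?q = map_pmf (\<lambda>w. (side_info i w, snd (fst (triples w ! i)))) ?q"
    "map_pmf (\<lambda>w. (?L w ! i, ?S w)) ?q = map_pmf (\<lambda>w. (fst (fst (triples w ! i)), side_info i w, snd (fst (triples w ! i)))) ?q"
    "map_pmf (\<lambda>w. (hd (snd (?R w)), ?S w)) ?q = map_pmf (\<lambda>w. (snd (triples w ! i), side_info i w, snd (fst (triples w ! i)))) ?q"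
    by (rule map_pmf_cong[OF refl]; simp only: X Y Z)+
  with pmf_factor_markov[OF fac' fin, of "\<lambda>l. l ! i" "\<lambda>r. hd (snd r)" x z s] show ?thesis by simp
qed

text \<open>The summands are the conditional mutual informations of the side information with
  \<open>(Y_i, Z_i)\<close> given \<open>X_i\<close>, and with \<open>X_i\<close> given
  \<open>(Y_i, Z_i)\<close>. The actual output letters are not independent, so single-letter and
  block entropies are each compared with the ideal ones at a cost of \<open>\<kappa>\<close> per
  letter. Conditioning on the side information instead of on all that the chain rule provides only
  increases the subtracted entropies.\<close>

lemma sum_leakage_le:
  fixes \<epsilon> \<kappa> :: real
  assumes n: "n > 0" and sec: "eps_secure P W n \<epsilon> \<pi>"
  defines "\<kappa> \<equiv> ent_dev (CARD(('x \<times> 'y) \<times> 'z)) \<epsilon>"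
  defines "q \<equiv> joint_pmf P n \<pi>"
  defines "X \<equiv> \<lambda>i w. fst (fst (triples w ! i))"
    and "YZ \<equiv> \<lambda>i w. (snd (fst (triples w ! i)), snd (triples w ! i))"
  shows "(\<Sum>i<n. cond_ent q (YZ i) (X i) - cond_ent q (YZ i) (\<lambda>w. (side_info i w, X i w))) \<le> n * (\<epsilon> + 2 * \<kappa>)"
    and "(\<Sum>i<n. cond_ent q (X i) (YZ i) - cond_ent q (X i) (\<lambda>w. (side_info i w, YZ i w))) \<le> n * (\<epsilon> + 2 * \<kappa>)"
proof -
  have err: "correctness_error P W n \<pi> \<le> \<epsilon>" and lA: "leakage_A P n \<pi> \<le> n * \<epsilon>" and lB: "leakage_B P n \<pi> \<le> n * \<epsilon>"
    using sec by (auto simp: eps_secure_def)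
  let ?xs = "\<lambda>w :: 'x list \<times> 'y list \<times> bool list \<times> 'z list. fst w"
  let ?ys = "\<lambda>w :: 'x list \<times> 'y list \<times> bool list \<times> 'z list. fst (snd w)"
  let ?m = "\<lambda>w :: 'x list \<times> 'y list \<times> bool list \<times> 'z list. fst (snd (snd w))"
  let ?zs = "\<lambda>w :: 'x list \<times> 'y list \<times> bool list \<times> 'z list. snd (snd (snd w))"
  let ?fX = "\<lambda>t :: ('x \<times> 'y) \<times> 'z. fst (fst t)" and ?fYZ = "\<lambda>t :: ('x \<times> 'y) \<times> 'z. (snd (fst t), snd t)"
  let ?h1 = "cond_ent (target_pmf P W) ?fYZ ?fX" and ?h2 = "cond_ent (target_pmf P W) ?fX ?fYZ"
  have len: "length (?xs w) = n" "length (?ys w) = n" "length (?zs w) = n" if "w \<in> set_pmf q" for w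
    using joint_pmf_lengths[OF val, of "?xs w" "?ys w" "?m w" "?zs w" P] that by (auto simp: q_def)
  have Xn: "X i w = ?xs w ! i" and YZn: "YZ i w = (?ys w ! i, ?zs w ! i)" if "w \<in> set_pmf q" "i < n" for i w
    using triples_nth[OF that[unfolded q_def]] by (simp_all add: X_def YZ_def)
  have mapX: "map ?fX (triples w) = ?xs w" and mapYZ: "map ?fYZ (triples w) = zip (?ys w) (?zs w)" if "w \<in> set_pmf q" for w
    using len[OF that] triples_nth[OF that[unfolded q_def]] length_triples[OF val that[unfolded q_def]]
    by (auto simp: list_eq_iff_nth_eq)
  have zip_iff: "zip (?ys v) (?zs v) = zip (?ys w) (?zs w) \<longleftrightarrow> ?ys v = ?ys w \<and> ?zs v = ?zs w"
    if "v \<in> set_pmf q" "w \<in> set_pmf q" for v w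
    using len[OF that(1)] len[OF that(2)] by (auto simp: zip_eq_conv)
  note fin = finite_image_determined[OF finite_range_joint[OF val, of P, folded q_def]]
  have b1: "cond_ent q (\<lambda>w. (?ys w, ?zs w)) ?xs \<ge> n * ?h1 - n * \<kappa>"
  proof -
    have "cond_ent q (\<lambda>w. (?ys w, ?zs w)) ?xs = cond_ent q (\<lambda>w. map ?fYZ (triples w)) (\<lambda>w. map ?fX (triples w))"
      by (rule cond_ent_cong) (simp_all add: mapX mapYZ zip_iff)
    with block_cond_ent_dev(1)[OF val n err, of ?fYZ ?fX] show ?thesis by (simp add: q_def \<kappa>_def abs_le_iff)
  qed
  have b2: "cond_ent q ?xs (\<lambda>w. (?ys w, ?zs w)) \<ge> n * ?h2 - n * \<kappa>"
  proof -
    have "cond_ent q ?xs (\<lambda>w. (?ys w, ?zs w)) = cond_ent q (\<lambda>w. map ?fX (triples w)) (\<lambda>w. map ?fYZ (triples w))"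
      by (rule cond_ent_cong) (simp_all add: mapX mapYZ zip_iff)
    with block_cond_ent_dev(1)[OF val n err, of ?fX ?fYZ] show ?thesis by (simp add: q_def \<kappa>_def abs_le_iff)
  qed
  have l1: "cond_ent q (YZ i) (X i) \<le> ?h1 + \<kappa>" and l2: "cond_ent q (X i) (YZ i) \<le> ?h2 + \<kappa>" if "i < n" for i
    using block_cond_ent_dev(2)[OF val n err that, of ?fYZ ?fX] block_cond_ent_dev(2)[OF val n err that, of ?fX ?fYZ]
    by (simp_all add: X_def YZ_def q_def \<kappa>_def abs_le_iff)
  have c1: "(\<Sum>i<n. cond_ent q (YZ i) (\<lambda>w. (side_info i w, X i w))) \<ge> cond_ent q (\<lambda>w. (?ys w, ?zs w)) (\<lambda>w. (?m w, ?xs w))"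
  proof -
    let ?S = "\<lambda>k w. (take k (?ys w), take k (?zs w))"
    have "cond_ent q (\<lambda>w. (?ys w, ?zs w)) (\<lambda>w. (?m w, ?xs w)) = cond_ent q (?S n) (\<lambda>w. (?m w, ?xs w))"
      by (rule cond_ent_cong) (simp_all add: len)
    also have "\<dots> = (\<Sum>k<n. cond_ent q (YZ k) (\<lambda>w. (?S k w, ?m w, ?xs w)))"
    proof (rule cond_ent_chain_sum)
      fix k v w assume "k < n" "v \<in> set_pmf q" "w \<in> set_pmf q"
      then show "?S (Suc k) v = ?S (Suc k) w \<longleftrightarrow> ?S k v = ?S k w \<and> YZ k v = YZ k w"
        by (auto simp: YZn take_Suc_eq_iff len)
    qed (auto intro!: fin simp: YZn case_prod_unfold)
    also have "\<dots> \<le> (\<Sum>i<n. cond_ent q (YZ i) (\<lambda>w. (side_info i w, X i w)))"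
    proof (rule sum_mono, rule cond_ent_mono_cond)
      fix k v w assume *: "k \<in> {..<n}" "v \<in> set_pmf q" "w \<in> set_pmf q" "(?S k v, ?m v, ?xs v) = (?S k w, ?m w, ?xs w)"
      then show "(side_info k v, X k v) = (side_info k w, X k w)"
        by (auto simp: Xn side_info_def case_prod_unfold)
    qed (auto intro!: fin simp: YZn case_prod_unfold)
    finally show ?thesis .
  qed
  have c2: "(\<Sum>i<n. cond_ent q (X i) (\<lambda>w. (side_info i w, YZ i w))) \<ge> cond_ent q ?xs (\<lambda>w. (?m w, ?ys w, ?zs w))"
  proof -
    \<comment> \<open>Reverse order: \<open>?S k\<close> consists of the last \<open>k\<close>
      inputs, so term \<open>k\<close> concerns position \<open>n - Suc k\<close>.\<close>
    let ?S = "\<lambda>k w. drop (n - k) (?xs w)"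
    have "cond_ent q ?xs (\<lambda>w. (?m w, ?ys w, ?zs w)) = cond_ent q (?S n) (\<lambda>w. (?m w, ?ys w, ?zs w))"
      by (rule cond_ent_cong) simp_all
    also have "\<dots> = (\<Sum>k<n. cond_ent q (X (n - Suc k)) (\<lambda>w. (?S k w, ?m w, ?ys w, ?zs w)))"
    proof (rule cond_ent_chain_sum)
      fix k v w assume "k < n" "v \<in> set_pmf q" "w \<in> set_pmf q"
      then show "?S (Suc k) v = ?S (Suc k) w \<longleftrightarrow> ?S k v = ?S k w \<and> X (n - Suc k) v = X (n - Suc k) w"
        using drop_eq_iff_Suc[of "n - Suc k" "?xs v" "?xs w"] by (simp add: Xn len Suc_diff_Suc)
    qed (auto intro!: fin simp: Xn len case_prod_unfold)
    also have "\<dots> \<le> (\<Sum>k<n. cond_ent q (X (n - Suc k)) (\<lambda>w. (side_info (n - Suc k) w, YZ (n - Suc k) w)))"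
    proof (rule sum_mono, rule cond_ent_mono_cond)
      fix k v w assume *: "k \<in> {..<n}" "v \<in> set_pmf q" "w \<in> set_pmf q" "(?S k v, ?m v, ?ys v, ?zs v) = (?S k w, ?m w, ?ys w, ?zs w)"
      then show "(side_info (n - Suc k) v, YZ (n - Suc k) v) = (side_info (n - Suc k) w, YZ (n - Suc k) w)"
        by (auto simp: YZn side_info_def case_prod_unfold Suc_diff_Suc)
    qed (auto intro!: fin simp: Xn case_prod_unfold)
    also have "\<dots> = (\<Sum>i<n. cond_ent q (X i) (\<lambda>w. (side_info i w, YZ i w)))"
      by (rule sum.nat_diff_reindex)
    finally show ?thesis .
  qed
  have A: "leakage_A P n \<pi> = cond_ent q (\<lambda>w. (?ys w, ?zs w)) ?xs - cond_ent q (\<lambda>w. (?ys w, ?zs w)) (\<lambda>w. (?m w, ?xs w))"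
    unfolding leakage_A_eq[OF val] q_def by (simp add: case_prod_unfold)
  have B: "leakage_B P n \<pi> = cond_ent q ?xs (\<lambda>w. (?ys w, ?zs w)) - cond_ent q ?xs (\<lambda>w. (?m w, ?ys w, ?zs w))"
    unfolding leakage_B_eq[OF val] q_def by (simp add: case_prod_unfold)
  have "(\<Sum>i<n. cond_ent q (YZ i) (X i)) \<le> (\<Sum>i<n. ?h1 + \<kappa>)" by (rule sum_mono) (simp add: l1)
  then show "(\<Sum>i<n. cond_ent q (YZ i) (X i) - cond_ent q (YZ i) (\<lambda>w. (side_info i w, X i w))) \<le> n * (\<epsilon> + 2 * \<kappa>)"
    using c1 b1 lA A by (simp add: sum_subtractf algebra_simps)
  have "(\<Sum>i<n. cond_ent q (X i) (YZ i)) \<le> (\<Sum>i<n. ?h2 + \<kappa>)" by (rule sum_mono) (simp add: l2)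
  then show "(\<Sum>i<n. cond_ent q (X i) (YZ i) - cond_ent q (X i) (\<lambda>w. (side_info i w, YZ i w))) \<le> n * (\<epsilon> + 2 * \<kappa>)"
    using c2 b2 lB B by (simp add: sum_subtractf algebra_simps)
qed

end

text \<open>Averaging: both leakage sums are small, so at some position the two terms together are
  at most twice the bound per letter. The side information has the same list type for all block
  lengths, which allows a sequence of such laws to be formed.\<close>

lemma single_letter:
  fixes P :: "('x::finite \<times> 'y::finite) pmf" and \<pi> :: "('x, 'y, 'z::finite) protocol" and \<epsilon> :: real
  assumes val: "valid_protocol n \<pi>" and n: "n > 0" and sec: "eps_secure P W n \<epsilon> \<pi>"
  defines "\<delta> \<equiv> 2 * (\<epsilon> + 2 * ent_dev (CARD(('x \<times> 'y) \<times> 'z)) \<epsilon>)"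
  shows "\<exists>r :: ((('x \<times> 'y) \<times> 'z) \<times> bool list \<times> 'x list \<times> 'y list \<times> 'z list) pmf. letter_secure P W \<epsilon> \<delta> r"
proof -
  let ?q = "joint_pmf P n \<pi>"
  let ?X = "\<lambda>i w. fst (fst (triples w ! i)) :: 'x"
  let ?YZ = "\<lambda>i w. (snd (fst (triples w ! i)) :: 'y, snd (triples w ! i) :: 'z)"
  let ?A = "\<lambda>i. cond_ent ?q (?YZ i) (?X i) - cond_ent ?q (?YZ i) (\<lambda>w. (side_info i w, ?X i w))"
  let ?B = "\<lambda>i. cond_ent ?q (?X i) (?YZ i) - cond_ent ?q (?X i) (\<lambda>w. (side_info i w, ?YZ i w))"
  have A0: "?A i \<ge> 0" and B0: "?B i \<ge> 0" for i
    using cond_ent_condition_le[of "?YZ i" ?q "side_info i" "?X i"] cond_ent_condition_le[of "?X i" ?q "side_info i" "?YZ i"]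
    by (simp_all add: finite_subset[OF subset_UNIV])
  have "\<exists>i<n. ?A i + ?B i \<le> \<delta>"
  proof (rule ccontr)
    assume "\<not> ?thesis"
    then have "\<delta> \<le> ?A i + ?B i" "\<delta> < ?A i + ?B i" if "i < n" for i
      using that by (auto simp: not_le intro: less_imp_le)
    then have "(\<Sum>i<n. \<delta>) < (\<Sum>i<n. ?A i + ?B i)" using n by (intro sum_strict_mono) auto
    also have "\<dots> = (\<Sum>i<n. ?A i) + (\<Sum>i<n. ?B i)" by (rule sum.distrib)
    also have "\<dots> \<le> n * (\<epsilon> + 2 * ent_dev (CARD(('x \<times> 'y) \<times> 'z)) \<epsilon>) + n * (\<epsilon> + 2 * ent_dev (CARD(('x \<times> 'y) \<times> 'z)) \<epsilon>)"
      by (rule add_mono[OF sum_leakage_le[OF val n sec]])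
    also have "\<dots> = n * \<delta>" unfolding \<delta>_def by (simp only: mult_2 distrib_left)
    finally show False by simp
  qed
  then obtain i where i: "i < n" "?A i + ?B i \<le> \<delta>" by blast
  let ?f = "\<lambda>w. (triples w ! i, side_info i w)"
  have "\<bar>pmf (map_pmf fst (map_pmf ?f ?q)) t - pmf (target_pmf P W) t\<bar> \<le> \<epsilon>" for t
    using letter_prob_dev[OF val _ i(1), of P W \<epsilon> t] sec
    by (simp add: map_pmf_comp pmf_map vimage_def eps_secure_def)
  then have "letter_secure P W \<epsilon> \<delta> (map_pmf ?f ?q)"
    unfolding letter_secure_def cond_ent_map map_pmf_comp fst_conv snd_conv
    using markov_side_info[OF val i(1), of P] i(2) A0[of i] B0[of i] by auto
  then show ?thesis ..
qed

lemma computable_AS_structure: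
  fixes P :: "('x::finite \<times> 'y::finite) pmf" and W :: "'x \<Rightarrow> 'y \<Rightarrow> 'z::finite pmf"
  assumes comp: "computable_AS P W"
    and equiv: "x_equiv P W x x'" and px: "pmf P (x, y) > 0" and px': "pmf P (x', y) > 0"
  shows "W x y = W x' y"
proof -
  let ?K = "real (CARD(('x \<times> 'y) \<times> 'z))"
  define \<delta> where "\<delta> k = 2 * (1 / Suc k + 2 * ent_dev ?K (1 / Suc k))" for k
  have "\<exists>r :: ((('x \<times> 'y) \<times> 'z) \<times> bool list \<times> 'x list \<times> 'y list \<times> 'z list) pmf.
    letter_secure P W (1 / Suc k) (\<delta> k) r" for k
  proof -
    have "0 < 1 / real (Suc k)" by simp
    with comp obtain n \<pi> where n: "n > 0" and \<pi>: "valid_protocol n \<pi>" "eps_secure P W n (1 / real (Suc k)) \<pi>"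
      unfolding computable_AS_def by blast
    show ?thesis unfolding \<delta>_def by (rule single_letter[OF \<pi>(1) n \<pi>(2)])
  qed
  then have "\<forall>k. \<exists>r :: ((('x \<times> 'y) \<times> 'z) \<times> bool list \<times> 'x list \<times> 'y list \<times> 'z list) pmf.
    letter_secure P W (1 / Suc k) (\<delta> k) r" ..
  then obtain r :: "nat \<Rightarrow> ((('x \<times> 'y) \<times> 'z) \<times> bool list \<times> 'x list \<times> 'y list \<times> 'z list) pmf"
    where r: "\<forall>k. letter_secure P W (1 / Suc k) (\<delta> k) (r k)" by (rule choice[THEN exE])
  have eps: "(\<lambda>k. 1 / real (Suc k)) \<longlonglongrightarrow> 0"
    using LIMSEQ_inverse_real_of_nat by (simp add: inverse_eq_divide)
  have "\<delta> \<longlonglongrightarrow> 2 * (0 + 2 * 0)"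
    unfolding \<delta>_def by (intro tendsto_mult tendsto_add tendsto_const eps ent_dev_tendsto[OF eps])
  then show ?thesis
    using structure_limit[OF r[rule_format] eps _ equiv px px'] by simp
qed

section \<open>Slepian-Wolf coding by random binning\<close>

lemma expectation_replicate_pmf_Suc:
  fixes h :: "'a list \<Rightarrow> real"
  assumes fin: "finite (set_pmf p)"
  shows "measure_pmf.expectation (replicate_pmf (Suc n) p) h
    = measure_pmf.expectation p (\<lambda>a. measure_pmf.expectation (replicate_pmf n p) (\<lambda>l. h (a # l)))"
proof -
  have "replicate_pmf (Suc n) p = bind_pmf p (\<lambda>a. map_pmf ((#) a) (replicate_pmf n p))"
    by (simp add: map_pmf_def)
  then have "measure_pmf.expectation (replicate_pmf (Suc n) p) h
    = (\<Sum>a\<in>set_pmf p. pmf p a *\<^sub>R measure_pmf.expectation (map_pmf ((#) a) (replicate_pmf n p)) h)"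
    using fin finite_set_replicate_pmf[OF fin] by (simp only:) (rule pmf_expectation_bind, auto)
  also have "\<dots> = measure_pmf.expectation p (\<lambda>a. measure_pmf.expectation (replicate_pmf n p) (\<lambda>l. h (a # l)))"
    using fin by (subst integral_measure_pmf[of "set_pmf p"]) auto
  finally show ?thesis .
qed

text \<open>Cross terms vanish because the first letter is independent of the rest, whose sum has
  mean 0.\<close>

lemma variance_replicate_pmf:
  fixes g :: "'a \<Rightarrow> real"
  assumes fin: "finite (set_pmf p)" and g: "measure_pmf.expectation p g = 0"
  shows "measure_pmf.expectation (replicate_pmf n p) (\<lambda>l. (\<Sum>x\<leftarrow>l. g x)\<^sup>2) = n * measure_pmf.expectation p (\<lambda>x. (g x)\<^sup>2)"
proof -
  note int = integrable_measure_pmf_finite[OF fin] integrable_measure_pmf_finite[OF finite_set_replicate_pmf[OF fin]]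
  have mean: "measure_pmf.expectation (replicate_pmf n p) (\<lambda>l. \<Sum>x\<leftarrow>l. g x) = 0" for n
    by (induction n) (simp_all add: expectation_replicate_pmf_Suc[OF fin] int g del: replicate_pmf.simps(2))
  show ?thesis
  proof (induction n)
    case (Suc n)
    have "measure_pmf.expectation (replicate_pmf n p) (\<lambda>l. (g a + (\<Sum>x\<leftarrow>l. g x))\<^sup>2)
      = (g a)\<^sup>2 + n * measure_pmf.expectation p (\<lambda>x. (g x)\<^sup>2)" for a
    proof -
      have "measure_pmf.expectation (replicate_pmf n p) (\<lambda>l. (g a + (\<Sum>x\<leftarrow>l. g x))\<^sup>2)
        = measure_pmf.expectation (replicate_pmf n p) (\<lambda>l. (g a)\<^sup>2 + (2 * g a * (\<Sum>x\<leftarrow>l. g x) + (\<Sum>x\<leftarrow>l. g x)\<^sup>2))"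
        by (simp add: power2_sum algebra_simps)
      then show ?thesis by (simp add: int mean Suc)
    qed
    then show ?case
      by (simp add: expectation_replicate_pmf_Suc[OF fin] int algebra_simps del: replicate_pmf.simps(2))
  qed simp
qed

lemma chebyshev_replicate_pmf:
  fixes f :: "'a \<Rightarrow> real"
  assumes fin: "finite (set_pmf p)" and n: "n > 0" and d: "d > 0"
  shows "measure_pmf.prob (replicate_pmf n p) {l. (\<Sum>x\<leftarrow>l. f x) \<ge> n * (measure_pmf.expectation p f + d)}
    \<le> measure_pmf.variance p f / (n * d\<^sup>2)"
proof -
  let ?\<mu> = "measure_pmf.expectation p f" and ?q = "replicate_pmf n p"
  let ?g = "\<lambda>x. f x - ?\<mu>"
  note int = integrable_measure_pmf_finite[OF fin] integrable_measure_pmf_finite[OF finite_set_replicate_pmf[OF fin]]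
  have "(n * d)\<^sup>2 * measure_pmf.prob ?q {l. (\<Sum>x\<leftarrow>l. f x) \<ge> n * (?\<mu> + d)}
    = measure_pmf.expectation ?q (\<lambda>l. (n * d)\<^sup>2 * indicator {l. (\<Sum>x\<leftarrow>l. f x) \<ge> n * (?\<mu> + d)} l)"
    by simp
  also have "\<dots> \<le> measure_pmf.expectation ?q (\<lambda>l. (\<Sum>x\<leftarrow>l. ?g x)\<^sup>2)"
  proof (rule integral_mono_AE)
    show "AE l in measure_pmf ?q. (n * d)\<^sup>2 * indicator {l. (\<Sum>x\<leftarrow>l. f x) \<ge> n * (?\<mu> + d)} l \<le> (\<Sum>x\<leftarrow>l. ?g x)\<^sup>2"
      unfolding AE_measure_pmf_iff
    proof
      fix l assume "l \<in> set_pmf ?q"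
      then have "length l = n" by (rule length_replicate_pmf)
      then have "(\<Sum>x\<leftarrow>l. ?g x) = (\<Sum>x\<leftarrow>l. f x) - n * ?\<mu>"
        by (simp add: sum_list_subtractf sum_list_triv)
      moreover have "0 \<le> n * d" using d by simp
      ultimately have "(n * d)\<^sup>2 \<le> (\<Sum>x\<leftarrow>l. ?g x)\<^sup>2" if "(\<Sum>x\<leftarrow>l. f x) \<ge> n * (?\<mu> + d)"
        using that by (intro power_mono) (simp_all add: distrib_left)
      then show "(n * d)\<^sup>2 * indicator {l. (\<Sum>x\<leftarrow>l. f x) \<ge> n * (?\<mu> + d)} l \<le> (\<Sum>x\<leftarrow>l. ?g x)\<^sup>2"
        by (simp add: indicator_def)
    qed
  qed (rule int)+
  also have "\<dots> = n * measure_pmf.variance p f"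
    by (rule variance_replicate_pmf[OF fin]) (simp add: int)
  finally show ?thesis using n d by (simp add: field_simps power2_eq_square)
qed

section \<open>Random codes and their decoding error\<close>

lemma exists_le_expectation:
  fixes F :: "'a \<Rightarrow> real"
  assumes fin: "finite (set_pmf p)" and le: "measure_pmf.expectation p F \<le> c"
  shows "\<exists>x\<in>set_pmf p. F x \<le> c"
proof (rule ccontr)
  assume "\<not> ?thesis"
  then have gt: "F x > c" if "x \<in> set_pmf p" for x using that by auto
  have "c = (\<Sum>x\<in>set_pmf p. pmf p x * c)"
    using sum_pmf_eq_1[OF fin subset_refl] by (simp add: sum_distrib_right[symmetric])
  also have "\<dots> < (\<Sum>x\<in>set_pmf p. pmf p x * F x)"
    by (rule sum_strict_mono) (use fin gt set_pmf_not_empty in \<open>auto simp: pmf_positive\<close>)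
  also have "\<dots> = measure_pmf.expectation p F"
    using fin by (subst integral_measure_pmf[of "set_pmf p"]) auto
  finally show False using le by simp
qed

text \<open>Both values fall into a given bin with probability \<open>(1 / card B)^2\<close>; sum
  over the bins.\<close>

lemma prob_collision:
  fixes B :: "'b set"
  assumes U: "finite U" "u \<in> U" "u' \<in> U" "u \<noteq> u'" and B: "finite B" "B \<noteq> {}"
  shows "measure_pmf.prob (Pi_pmf U dflt (\<lambda>_. pmf_of_set B)) {e. e u = e u'} \<le> 1 / card B"
proof -
  let ?q = "Pi_pmf U dflt (\<lambda>_. pmf_of_set B)"
  let ?E = "\<lambda>b. Pi U (\<lambda>v. if v = u \<or> v = u' then {b} else UNIV)"
  have prob: "measure_pmf.prob ?q (?E b) = (1 / card B)\<^sup>2" if "b \<in> B" for b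
  proof -
    have "measure_pmf.prob ?q (?E b) = (\<Prod>v\<in>U. measure_pmf.prob (pmf_of_set B) (if v = u \<or> v = u' then {b} else UNIV))"
      by (rule measure_Pi_pmf_Pi) (rule U)
    also have "\<dots> = (\<Prod>v\<in>U. if v \<in> {u, u'} then 1 / card B else 1)"
      using B that by (intro prod.cong) (auto simp: measure_pmf_single)
    also have "\<dots> = (\<Prod>v\<in>{u, u'}. 1 / card B)"
      using U by (subst prod.inter_restrict[symmetric]) (auto intro!: prod.cong)
    finally show ?thesis using U by (simp add: power2_eq_square)
  qed
  have "measure_pmf.prob ?q {e. e u = e u'} \<le> measure_pmf.prob ?q (\<Union>b\<in>B. ?E b)"
  proof (rule measure_pmf.finite_measure_mono_AE)
    show "AE e in ?q. e \<in> {e. e u = e u'} \<longrightarrow> e \<in> (\<Union>b\<in>B. ?E b)"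
      unfolding AE_measure_pmf_iff set_Pi_pmf[OF U(1)]
      using U B by (auto simp: PiE_dflt_def)
  qed simp
  also have "\<dots> \<le> (\<Sum>b\<in>B. measure_pmf.prob ?q (?E b))"
    by (rule measure_pmf.finite_measure_subadditive_finite) (use B in auto)
  also have "\<dots> = 1 / card B" using B prob by (simp add: power2_eq_square)
  finally show ?thesis .
qed

text \<open>The decoder searches the announced bin for a block whose conditional probability given
  \<open>ys\<close> is at least \<open>\<tau>\<close>. It errs only if the true block is below the
  threshold or shares its bin with another candidate, and there are at most
  \<open>1 / \<tau>\<close> candidates. Some binning does as well as the average one.\<close>

lemma slepian_wolf_one_shot:
  fixes p :: "('u::finite \<times> 'y::finite) pmf" and \<tau> :: real and L :: nat
  assumes \<tau>: "\<tau> > 0"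
  shows "\<exists>(e :: 'u list \<Rightarrow> bool list) dec. (\<forall>us. length (e us) = L) \<and>
    measure_pmf.prob (replicate_pmf n p) {w. dec (map snd w) (e (map fst w)) \<noteq> map fst w}
    \<le> measure_pmf.prob (replicate_pmf n p) {w. (\<Prod>i<n. pmf p (w ! i) / pmf (map_pmf snd p) (snd (w ! i))) < \<tau>}
      + 1 / (\<tau> * 2 ^ L)"
proof -
  let ?U = "{us :: 'u list. length us = n}" and ?B = "{b :: bool list. length b = L}"
  let ?q = "replicate_pmf n p"
  have finU: "finite ?U" using finite_lists_length_eq[of "UNIV :: 'u set" n] by simp
  have finB: "finite ?B" and cardB: "card ?B = 2 ^ L"
    using finite_lists_length_eq[of "UNIV :: bool set" L] card_lists_length_eq[of "UNIV :: bool set" L] by simp_all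
  have neB: "?B \<noteq> {}" by (auto intro!: exI[of _ "replicate L True"])
  \<comment> \<open>The conditional probability of the block \<open>us\<close> given
    \<open>ys\<close>.\<close>
  define c where "c us ys = pmf ?q (zip us ys) / pmf (map_pmf (map snd) ?q) ys" for us ys
  define cand where "cand ys = {us \<in> ?U. c us ys \<ge> \<tau>}" for ys
  \<comment> \<open>The default \<open>replicate L True\<close> is the value on lists of length
    other than \<open>n\<close>; it keeps every codeword at length \<open>L\<close>.\<close>
  define Pe where "Pe = Pi_pmf ?U (replicate L True) (\<lambda>_. pmf_of_set ?B)"
  define bad where "bad e = {w. \<exists>us\<in>cand (map snd w) - {map fst w}. e us = e (map fst w)}" for e :: "'u list \<Rightarrow> bool list"
  \<comment> \<open>Each candidate has conditional probability at least \<open>\<tau>\<close>, and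
    these probabilities sum to at most 1.\<close>
  have card_cand: "card (cand ys) \<le> 1 / \<tau>" if "ys \<in> map snd ` set_pmf ?q" for ys
  proof -
    have pos: "pmf (map_pmf (map snd) ?q) ys > 0" using that by (simp add: pmf_positive)
    have len: "length ys = n" using that length_replicate_pmf by auto
    have "\<tau> * card (cand ys) = (\<Sum>us\<in>cand ys. \<tau>)" by simp
    also have "\<dots> \<le> (\<Sum>us\<in>cand ys. c us ys)" by (rule sum_mono) (simp add: cand_def)
    also have "\<dots> = (\<Sum>w\<in>(\<lambda>us. zip us ys) ` cand ys. pmf ?q w) / pmf (map_pmf (map snd) ?q) ys"
    proof (subst sum.reindex)
      show "inj_on (\<lambda>us. zip us ys) (cand ys)"
        by (rule inj_on_inverseI[where g = "map fst"]) (simp add: cand_def len)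
    qed (simp add: c_def sum_divide_distrib)
    also have "(\<Sum>w\<in>(\<lambda>us. zip us ys) ` cand ys. pmf ?q w) = measure_pmf.prob ?q ((\<lambda>us. zip us ys) ` cand ys)"
      by (rule measure_measure_pmf_finite[symmetric]) (use finU in \<open>auto simp: cand_def\<close>)
    also have "\<dots> / pmf (map_pmf (map snd) ?q) ys \<le> 1"
    proof -
      have "measure_pmf.prob ?q ((\<lambda>us. zip us ys) ` cand ys) \<le> pmf (map_pmf (map snd) ?q) ys"
        unfolding pmf_map by (rule measure_pmf.finite_measure_mono) (auto simp: cand_def len)
      then show ?thesis using pos by simp
    qed
    finally show ?thesis using \<tau> by (simp add: field_simps)
  qed
  have "measure_pmf.expectation Pe (\<lambda>e. measure_pmf.prob ?q (bad e)) \<le> 1 / (\<tau> * 2 ^ L)"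
  proof -
    have finPe: "finite (set_pmf Pe)"
      unfolding Pe_def by (subst set_Pi_pmf[OF finU]) (use finU finB neB in auto)
    have finq: "finite (set_pmf ?q)" by (rule finite_set_replicate_pmf) simp
    have "measure_pmf.expectation Pe (\<lambda>e. measure_pmf.prob ?q (bad e))
      = measure_pmf.expectation Pe (\<lambda>e. \<Sum>w\<in>set_pmf ?q. pmf ?q w * indicator (bad e) w)"
    proof (rule Bochner_Integration.integral_cong)
      fix e
      have "measure_pmf.prob ?q (bad e) = measure_pmf.expectation ?q (indicator (bad e))" by simp
      also have "\<dots> = (\<Sum>w\<in>set_pmf ?q. pmf ?q w *\<^sub>R indicator (bad e) w)"
        by (rule integral_measure_pmf[OF finq])
      finally show "measure_pmf.prob ?q (bad e) = (\<Sum>w\<in>set_pmf ?q. pmf ?q w * indicator (bad e) w)" by simp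
    qed simp
    also have "\<dots> = (\<Sum>w\<in>set_pmf ?q. pmf ?q w * measure_pmf.expectation Pe (\<lambda>e. indicator (bad e) w))"
      by (simp add: integrable_measure_pmf_finite[OF finPe])
    also have "\<dots> \<le> (\<Sum>w\<in>set_pmf ?q. pmf ?q w * (1 / (\<tau> * 2 ^ L)))"
    proof (intro sum_mono mult_left_mono)
      fix w assume w: "w \<in> set_pmf ?q"
      let ?C = "cand (map snd w) - {map fst w}"
      have finC: "finite ?C" using finU by (auto simp: cand_def)
      have "measure_pmf.expectation Pe (\<lambda>e. indicator (bad e) w)
        = measure_pmf.prob Pe (\<Union>us\<in>?C. {e. e us = e (map fst w)})"
      proof -
        have "(\<lambda>e. indicator (bad e) w :: real) = indicator (\<Union>us\<in>?C. {e. e us = e (map fst w)})"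
          by (auto simp: bad_def indicator_def fun_eq_iff)
        then show ?thesis by simp
      qed
      also have "\<dots> \<le> (\<Sum>us\<in>?C. measure_pmf.prob Pe {e. e us = e (map fst w)})"
        by (rule measure_pmf.finite_measure_subadditive_finite[OF finC]) auto
      also have "\<dots> \<le> (\<Sum>us\<in>?C. 1 / 2 ^ L)"
      proof (rule sum_mono)
        fix us assume us: "us \<in> ?C"
        have "measure_pmf.prob Pe {e. e us = e (map fst w)} \<le> 1 / card ?B"
          unfolding Pe_def
          by (rule prob_collision) (use us finU finB neB length_replicate_pmf[OF w] in \<open>auto simp: cand_def\<close>)
        then show "measure_pmf.prob Pe {e. e us = e (map fst w)} \<le> 1 / 2 ^ L" by (simp add: cardB)
      qed
      also have "\<dots> = real (card ?C) / 2 ^ L" by simp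
      also have "\<dots> \<le> (1 / \<tau>) / 2 ^ L"
      proof (rule divide_right_mono)
        have "card ?C \<le> card (cand (map snd w))" by (rule card_mono) (use finU in \<open>auto simp: cand_def\<close>)
        also have "real (card (cand (map snd w))) \<le> 1 / \<tau>" by (rule card_cand) (use w in auto)
        finally show "real (card ?C) \<le> 1 / \<tau>" by simp
      qed simp
      finally show "measure_pmf.expectation Pe (\<lambda>e. indicator (bad e) w) \<le> 1 / (\<tau> * 2 ^ L)" by simp
    qed simp
    also have "\<dots> = 1 / (\<tau> * 2 ^ L)"
      using sum_pmf_eq_1[OF finq subset_refl] by (simp add: sum_divide_distrib[symmetric])
    finally show ?thesis .
  qed
  moreover have finPe: "finite (set_pmf Pe)"
    unfolding Pe_def by (subst set_Pi_pmf[OF finU]) (use finU finB neB in auto)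
  ultimately obtain e where e: "e \<in> set_pmf Pe" "measure_pmf.prob ?q (bad e) \<le> 1 / (\<tau> * 2 ^ L)"
    using exists_le_expectation by blast
  have len: "length (e us) = L" for us
    using e(1) unfolding Pe_def set_Pi_pmf[OF finU]
    by (cases "length us = n") (auto simp: PiE_dflt_def comp_def set_pmf_of_set[OF neB finB])
  \<comment> \<open>Any candidate in the bin may be returned: outside \<open>bad e\<close> the true
    block has no rival there.\<close>
  define dec where "dec ys m = (SOME us. us \<in> cand ys \<and> e us = m)" for ys m
  let ?low = "{w. (\<Prod>i<n. pmf p (w ! i) / pmf (map_pmf snd p) (snd (w ! i))) < \<tau>}"
  have "measure_pmf.prob ?q {w. dec (map snd w) (e (map fst w)) \<noteq> map fst w} \<le> measure_pmf.prob ?q (?low \<union> bad e)"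
  proof (rule measure_pmf.finite_measure_mono_AE)
    show "AE w in measure_pmf ?q. w \<in> {w. dec (map snd w) (e (map fst w)) \<noteq> map fst w} \<longrightarrow> w \<in> ?low \<union> bad e"
      unfolding AE_measure_pmf_iff
    proof (intro ballI impI, rule ccontr)
      fix w assume w: "w \<in> set_pmf ?q" and err: "w \<in> {w. dec (map snd w) (e (map fst w)) \<noteq> map fst w}"
        and n: "w \<notin> ?low \<union> bad e"
      have len: "length w = n" by (rule length_replicate_pmf[OF w])
      have "c (map fst w) (map snd w) = (\<Prod>i<n. pmf p (w ! i) / pmf (map_pmf snd p) (snd (w ! i)))"
        by (simp add: c_def zip_map_fst_snd map_map_replicate_pmf pmf_replicate_pmf len prod_dividef)
      then have in_cand: "map fst w \<in> cand (map snd w)" using n len by (simp add: cand_def)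
      have "dec (map snd w) (e (map fst w)) \<in> cand (map snd w) \<and> e (dec (map snd w) (e (map fst w))) = e (map fst w)"
        unfolding dec_def by (rule someI[of _ "map fst w"]) (use in_cand in simp)
      then show False using err n by (auto simp: bad_def)
    qed
  qed simp
  also have "\<dots> \<le> measure_pmf.prob ?q ?low + measure_pmf.prob ?q (bad e)"
    by (rule measure_Un_le) auto
  finally show ?thesis using e(2) len by (intro exI[of _ e] exI[of _ dec]) auto
qed

text \<open>The threshold is \<open>2^(-n (H + d))\<close> and the codeword length about
  \<open>n (H + 2 d)\<close>. Chebyshev's inequality bounds the atypical blocks, and the gap
  \<open>n d\<close> between the exponents makes collisions exponentially rare. The factor 2 in the
  last term pays for rounding the length down.\<close>

lemma slepian_wolf:
  fixes p :: "('u::finite \<times> 'y::finite) pmf" and d :: real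
  assumes d: "d > 0" and n: "n > 0"
  defines "H \<equiv> cond_ent p fst snd"
  shows "\<exists>(e :: 'u list \<Rightarrow> bool list) dec. (\<forall>us. length (e us) = nat \<lfloor>n * (H + 2 * d)\<rfloor>) \<and>
    measure_pmf.prob (replicate_pmf n p) {w. dec (map snd w) (e (map fst w)) \<noteq> map fst w}
    \<le> measure_pmf.variance p (\<lambda>w. log 2 (pmf (map_pmf snd p) (snd w) / pmf p w)) / (n * d\<^sup>2) + 2 * (2 powr - d) ^ n"
proof -
  let ?L = "nat \<lfloor>n * (H + 2 * d)\<rfloor>" and ?f = "\<lambda>w. log 2 (pmf (map_pmf snd p) (snd w) / pmf p w)"
  let ?q = "replicate_pmf n p"
  define \<tau> where "\<tau> = 2 powr (- (n * (H + d)))"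
  have \<tau>: "\<tau> > 0" by (simp add: \<tau>_def)
  have H0: "H \<ge> 0" by (simp add: H_def cond_ent_nonneg)
  have H: "H = measure_pmf.expectation p ?f"
    by (simp add: H_def cond_ent_def prob_val_def)
  obtain e :: "'u list \<Rightarrow> bool list" and dec where e: "\<forall>us. length (e us) = ?L" and
    err: "measure_pmf.prob ?q {w. dec (map snd w) (e (map fst w)) \<noteq> map fst w}
      \<le> measure_pmf.prob ?q {w. (\<Prod>i<n. pmf p (w ! i) / pmf (map_pmf snd p) (snd (w ! i))) < \<tau>} + 1 / (\<tau> * 2 ^ ?L)"
    using slepian_wolf_one_shot[OF \<tau>, of ?L n p] by blast
  have "measure_pmf.prob ?q {w. (\<Prod>i<n. pmf p (w ! i) / pmf (map_pmf snd p) (snd (w ! i))) < \<tau>}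
    \<le> measure_pmf.prob ?q {l. (\<Sum>x\<leftarrow>l. ?f x) \<ge> n * (measure_pmf.expectation p ?f + d)}"
  proof (rule measure_pmf.finite_measure_mono_AE)
    show "AE w in measure_pmf ?q. w \<in> {w. (\<Prod>i<n. pmf p (w ! i) / pmf (map_pmf snd p) (snd (w ! i))) < \<tau>} \<longrightarrow>
      w \<in> {l. (\<Sum>x\<leftarrow>l. ?f x) \<ge> n * (measure_pmf.expectation p ?f + d)}"
      unfolding AE_measure_pmf_iff
    proof (intro ballI impI)
      fix w assume w: "w \<in> set_pmf ?q" and low: "w \<in> {w. (\<Prod>i<n. pmf p (w ! i) / pmf (map_pmf snd p) (snd (w ! i))) < \<tau>}"
      have len: "length w = n" by (rule length_replicate_pmf[OF w])
      let ?t = "\<lambda>i. pmf p (w ! i) / pmf (map_pmf snd p) (snd (w ! i))"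
      have nz: "pmf p (w ! i) > 0" "pmf (map_pmf snd p) (snd (w ! i)) > 0" if "i < n" for i
        using nth_replicate_pmf_in[OF w that] by (auto intro!: pmf_positive)
      have tpos: "?t i > 0" if "i < n" for i using nz[OF that] by simp
      have "ln (\<Prod>i<n. ?t i) < ln \<tau>"
      proof (subst ln_less_cancel_iff)
        show "0 < (\<Prod>i<n. ?t i)" using tpos by (intro prod_pos) auto
      qed (use \<tau> low in auto)
      also have "ln \<tau> = - (n * (H + d)) * ln 2" by (simp add: \<tau>_def ln_powr)
      also have "ln (\<Prod>i<n. ?t i) = (\<Sum>i<n. ln (?t i))"
        using tpos by (intro ln_prod) (auto dest!: less_imp_neq[OF tpos])
      also have "\<dots> = (\<Sum>i<n. - (ln 2 * ?f (w ! i)))"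
        by (rule sum.cong) (use nz[THEN less_imp_neq] in \<open>auto simp: log_def ln_div\<close>)
      also have "\<dots> = - (ln 2 * (\<Sum>x\<leftarrow>w. ?f x))"
        by (simp add: sum_list_sum_nth len atLeast0LessThan sum_negf sum_distrib_left)
      finally have "ln 2 * (n * (H + d)) < ln 2 * (\<Sum>x\<leftarrow>w. ?f x)" by (simp add: mult.commute)
      then have "n * (H + d) < (\<Sum>x\<leftarrow>w. ?f x)" by (simp add: mult_less_cancel_left_pos)
      then show "w \<in> {l. (\<Sum>x\<leftarrow>l. ?f x) \<ge> n * (measure_pmf.expectation p ?f + d)}"
        by (simp add: H)
    qed
  qed simp
  also have "\<dots> \<le> measure_pmf.variance p ?f / (n * d\<^sup>2)"
    by (rule chebyshev_replicate_pmf) (use n d in auto)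
  finally have 1: "measure_pmf.prob ?q {w. (\<Prod>i<n. pmf p (w ! i) / pmf (map_pmf snd p) (snd (w ! i))) < \<tau>}
    \<le> measure_pmf.variance p ?f / (n * d\<^sup>2)" .
  have "n * (H + 2 * d) - 1 \<le> ?L"
    using H0 d n by linarith
  then have "2 powr (n * (H + 2 * d) - 1) \<le> 2 ^ ?L"
    by (subst powr_realpow[symmetric]) auto
  then have "\<tau> * 2 powr (n * (H + 2 * d) - 1) \<le> \<tau> * 2 ^ ?L" using \<tau> by (intro mult_left_mono) auto
  moreover have "\<tau> * 2 powr (n * (H + 2 * d) - 1) = 2 powr (n * d - 1)"
    by (simp add: \<tau>_def powr_add[symmetric] algebra_simps)
  ultimately have "1 / (\<tau> * 2 ^ ?L) \<le> 1 / 2 powr (n * d - 1)"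
    by (intro divide_left_mono) (use \<tau> in auto)
  also have "\<dots> = 2 * 2 powr (- (n * d))"
    by (simp add: powr_diff powr_minus_divide)
  also have "2 powr (- (n * d)) = (2 powr - d) ^ n"
    by (simp add: powr_power mult.commute)
  finally have 2: "1 / (\<tau> * 2 ^ ?L) \<le> 2 * (2 powr - d) ^ n" .
  show ?thesis
    using e err 1 2 by (intro exI[of _ e] exI[of _ dec]) auto
qed

section \<open>Achievability\<close>

text \<open>
  Alice sends \<open>e\<close> of her block of class representatives. Bob's private randomness encodes, for every
  coordinate, a random function \<open>f\<close> with \<open>f (u, y)\<close> distributed as \<open>V u y\<close>.
\<close>

definition sampler :: "nat \<Rightarrow> ('u \<Rightarrow> 'y \<Rightarrow> 'z pmf) \<Rightarrow> (('u::finite \<times> 'y::finite) \<Rightarrow> 'z) list pmf" where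
  "sampler n V = replicate_pmf n (Pi_pmf UNIV undefined (\<lambda>(u, y). V u y))"

text \<open>Private randomness is a real number in this model, so Bob's list of random functions is
  stored as its code number and read back here.\<close>

definition decode_real :: "real \<Rightarrow> 'a::countable" where
  "decode_real r = from_nat (nat \<lfloor>r\<rfloor>)"

definition binning_protocol ::
  "nat \<Rightarrow> ('x \<Rightarrow> 'u) \<Rightarrow> ('u::finite list \<Rightarrow> bool list) \<Rightarrow> ('y list \<Rightarrow> bool list \<Rightarrow> 'u list) \<Rightarrow> nat \<Rightarrow>
    ('u \<Rightarrow> 'y \<Rightarrow> 'z::finite pmf) \<Rightarrow> ('x, 'y::finite, 'z) protocol" where
  "binning_protocol n cls e dec L V =
    \<lparr>rand_A = return borel 0,
     rand_B = distr (measure_pmf (sampler n V)) borel (\<lambda>fs. real (to_nat fs)),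
     rounds = 1,
     speaker = (\<lambda>_. Alice),
     msg_code = (\<lambda>_. {m. length m = L}),
     msg_A = (\<lambda>xs _ _. e (map cls xs)),
     msg_B = (\<lambda>_ _ _. []),
     out_B = (\<lambda>ys r m. map (\<lambda>i. (decode_real r ! i) (dec ys m ! i, ys ! i)) [0..<n])\<rparr>"

lemma decode_real_to_nat [simp]: "decode_real (real (to_nat a)) = a"
  by (simp add: decode_real_def)

lemma measurable_decode_real: "decode_real \<in> measurable borel (count_space UNIV)"
proof -
  have "floor \<in> measurable (borel :: real measure) (count_space UNIV)" by simp
  then have "(\<lambda>r. from_nat (nat \<lfloor>r\<rfloor>)) \<in> measurable (borel :: real measure) (count_space UNIV)"
    by (rule measurable_compose) simp
  then show ?thesis by (simp add: decode_real_def[abs_def])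
qed

lemma valid_binning_protocol:
  assumes "\<And>us. length (e us) = L"
  shows "valid_protocol n (binning_protocol n cls e dec L V)"
proof -
  let ?\<pi> = "binning_protocol n cls e dec L V"
  have "prob_space (rand_B ?\<pi>)"
    by (simp add: binning_protocol_def prob_space.prob_space_distr[OF prob_space_measure_pmf])
  moreover have "(\<lambda>r. out_B ?\<pi> ys r m) \<in> measurable borel (count_space UNIV)" for ys m
  proof -
    have "out_B ?\<pi> ys r m = (\<lambda>fs. map (\<lambda>i. (fs ! i) (dec ys m ! i, ys ! i)) [0..<n]) (decode_real r)" for r
      by (simp add: binning_protocol_def)
    moreover have "(\<lambda>r. (\<lambda>fs. map (\<lambda>i. (fs ! i) (dec ys m ! i, ys ! i)) [0..<n]) (decode_real r))
      \<in> measurable borel (count_space UNIV)"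
      by (rule measurable_compose[OF measurable_decode_real]) (rule measurable_count_space)
    ultimately show ?thesis by (simp only:)
  qed
  moreover have "prefix_free {m :: bool list. length m = L}"
    unfolding prefix_free_def by (rule pairwiseI) (simp add: not_equal_is_parallel)
  moreover have "prob_space (rand_A ?\<pi>)"
    unfolding binning_protocol_def by (simp, rule prob_space_return) simp
  moreover have "sets (rand_A ?\<pi>) = sets borel" "sets (rand_B ?\<pi>) = sets borel"
    "msg_A ?\<pi> xs r h = e (map cls xs)" "msg_B ?\<pi> ys r h = []" "speaker ?\<pi> h = Alice"
    "msg_code ?\<pi> h = {m. length m = L}" "length (out_B ?\<pi> ys r m) = n" for xs ys r h m
    by (simp_all add: binning_protocol_def)
  ultimately show ?thesis
    unfolding valid_protocol_def by (simp add: assms)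
qed

lemma prob_sampler:
  assumes "length zs = n"
  shows "measure_pmf.prob (sampler n V) {fs. map (\<lambda>i. (fs ! i) (us ! i, ys ! i)) [0..<n] = zs}
    = (\<Prod>i<n. pmf (V (us ! i) (ys ! i)) (zs ! i))"
proof -
  let ?F = "Pi_pmf UNIV undefined (\<lambda>(u, y). V u y)"
  have "{fs. map (\<lambda>i. (fs ! i) (us ! i, ys ! i)) [0..<n] = zs} = {fs. \<forall>i<n. fs ! i \<in> {f. f (us ! i, ys ! i) = zs ! i}}"
    using assms by (auto simp: list_eq_iff_nth_eq)
  then have "measure_pmf.prob (sampler n V) {fs. map (\<lambda>i. (fs ! i) (us ! i, ys ! i)) [0..<n] = zs}
    = (\<Prod>i<n. measure_pmf.prob ?F {f. f (us ! i, ys ! i) = zs ! i})"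
    by (simp only: sampler_def prob_replicate_pmf)
  also have "\<dots> = (\<Prod>i<n. pmf (V (us ! i) (ys ! i)) (zs ! i))"
  proof (rule prod.cong)
    fix i
    have "measure_pmf.prob ?F {f. f (us ! i, ys ! i) = zs ! i} = pmf (map_pmf (\<lambda>f. f (us ! i, ys ! i)) ?F) (zs ! i)"
      by (simp add: pmf_map vimage_def)
    then show "measure_pmf.prob ?F {f. f (us ! i, ys ! i) = zs ! i} = pmf (V (us ! i) (ys ! i)) (zs ! i)"
      by (simp add: Pi_pmf_component)
  qed simp
  finally show ?thesis .
qed

lemma sum_sampler_le_1:
  "(\<Sum>zs | length zs = n. measure_pmf.prob (sampler n V) {fs. map (\<lambda>i. (fs ! i) (us ! i, ys ! i)) [0..<n] = (zs :: 'z::finite list)}) \<le> 1"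
proof -
  have fin: "finite {zs :: 'z list. length zs = n}"
    using finite_lists_length_eq[of "UNIV :: 'z set" n] by simp
  have "(\<Sum>zs | length zs = n. measure_pmf.prob (sampler n V) {fs. map (\<lambda>i. (fs ! i) (us ! i, ys ! i)) [0..<n] = (zs :: 'z list)})
    = measure_pmf.prob (sampler n V) (\<Union>zs\<in>{zs. length zs = n}. {fs. map (\<lambda>i. (fs ! i) (us ! i, ys ! i)) [0..<n] = (zs :: 'z list)})"
    by (rule measure_pmf.finite_measure_finite_Union[symmetric, OF fin]) (auto simp: disjoint_family_on_def)
  also have "\<dots> \<le> 1" by (rule measure_pmf.prob_le_1)
  finally show ?thesis .
qed

section \<open>Analysis of the binning protocol\<close>

context
  fixes P :: "('x::finite \<times> 'y::finite) pmf" and W :: "'x \<Rightarrow> 'y \<Rightarrow> 'z::finite pmf" and n :: nat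
    and e :: "'x list \<Rightarrow> bool list" and dec :: "'y list \<Rightarrow> bool list \<Rightarrow> 'x list" and L :: nat
    and V :: "'x \<Rightarrow> 'y \<Rightarrow> 'z pmf" and \<pi> :: "('x, 'y, 'z) protocol"
  assumes e: "\<And>us. length (e us) = L" and n: "n > 0"
    and V: "\<forall>x y. pmf P (x, y) > 0 \<longrightarrow> V (x_EQ P W x) y = W x y"
    and \<pi>: "\<pi> = binning_protocol n (x_EQ P W) e dec L V"
begin

lemma valid_binning: "valid_protocol n \<pi>" unfolding \<pi> by (rule valid_binning_protocol[OF e])

lemma transcript_binning [simp]: "transcript \<pi> xs ys a b = e (map (x_EQ P W) xs)"
  by (simp add: transcript_def \<pi> binning_protocol_def)

lemma transcript_determined:
  assumes "(xs, ys, m, zs) \<in> set_pmf (joint_pmf P n \<pi>)"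
  shows "m = e (map (x_EQ P W) xs)"
proof -
  obtain w where "(xs, ys, m, zs) = joint_rv \<pi> w" using joint_pmf_support[OF valid_binning assms] ..
  then show ?thesis by (cases w) (simp add: joint_rv_def input_A_def transcript_rv_def)
qed

text \<open>Given the inputs the transcript is deterministic, so only Bob's randomness remains; it
  is independent of the inputs and is the image of the sampler.\<close>

lemma output_prob_binning:
  assumes w: "w \<in> set_pmf (replicate_pmf n P)"
  defines "us \<equiv> dec (map snd w) (e (map (x_EQ P W) (map fst w)))"
  shows "output_prob P n \<pi> (map fst w) (map snd w) zs
    = measure_pmf.prob (sampler n V) {fs. map (\<lambda>i. (fs ! i) (us ! i, map snd w ! i)) [0..<n] = zs}"
proof -
  interpret A: prob_space "rand_A \<pi>" using valid_binning by (simp add: valid_protocol_def)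
  interpret B: prob_space "rand_B \<pi>" using valid_binning by (simp add: valid_protocol_def)
  interpret AB: pair_prob_space "rand_A \<pi>" "rand_B \<pi>" ..
  have sets: "sets (rand_A \<pi>) = sets borel" "sets (rand_B \<pi>) = sets borel"
    using valid_binning by (auto simp: valid_protocol_def)
  have space: "space (rand_A \<pi>) = UNIV" "space (rand_B \<pi>) = UNIV"
    using sets by (auto dest: sets_eq_imp_space_eq)
  let ?o = "\<lambda>b. out_B \<pi> (map snd w) b (e (map (x_EQ P W) (map fst w)))"
  have mB: "{b. ?o b = zs} \<in> sets (rand_B \<pi>)"
    unfolding sets by (rule sets_borel_eq) (use valid_binning in \<open>auto simp: valid_protocol_def\<close>)
  have Ex: "{\<omega> \<in> space (exec_space P n \<pi>). input_A \<omega> = map fst w \<and> input_B \<omega> = map snd w} = {w} \<times> (UNIV \<times> UNIV)"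
    by (auto simp: exec_space_def space_pair_measure space input_A_def input_B_def)
      (metis zip_map_fst_snd)
  have Eo: "{\<omega> \<in> space (exec_space P n \<pi>). output_rv \<pi> \<omega> = zs \<and> input_A \<omega> = map fst w \<and> input_B \<omega> = map snd w}
    = {w} \<times> (UNIV \<times> {b. ?o b = zs})"
    by (auto simp: exec_space_def space_pair_measure space input_A_def input_B_def output_rv_def)
      (metis zip_map_fst_snd)+
  have times: "measure (exec_space P n \<pi>) ({w} \<times> (UNIV \<times> D)) = pmf (replicate_pmf n P) w * measure (rand_B \<pi>) D"
    if D: "D \<in> sets (rand_B \<pi>)" for D
  proof -
    have U: "UNIV \<in> sets (rand_A \<pi>)" using space sets by (metis sets.top)
    have "emeasure (rand_A \<pi> \<Otimes>\<^sub>M rand_B \<pi>) (UNIV \<times> D) = emeasure (rand_B \<pi>) D"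
      using B.emeasure_pair_measure_Times[OF U D] A.emeasure_space_1 space by simp
    moreover have "UNIV \<times> D \<in> sets (rand_A \<pi> \<Otimes>\<^sub>M rand_B \<pi>)" using U D by simp
    ultimately have "emeasure (exec_space P n \<pi>) ({w} \<times> (UNIV \<times> D)) = emeasure (replicate_pmf n P) {w} * emeasure (rand_B \<pi>) D"
      unfolding exec_space_def by (subst AB.P.emeasure_pair_measure_Times) auto
    then show ?thesis by (simp add: measure_def enn2real_mult pmf.rep_eq)
  qed
  have "output_prob P n \<pi> (map fst w) (map snd w) zs = measure (rand_B \<pi>) {b. ?o b = zs}"
    using times[OF mB] times[of UNIV] w space B.prob_space sets.top[of "rand_B \<pi>"]
    unfolding output_prob_def cond_prob_def Ex Eo by (simp add: set_pmf_iff)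
  also have "\<dots> = measure_pmf.prob (sampler n V) ((\<lambda>fs. real (to_nat fs)) -` {b. ?o b = zs})"
  proof -
    have "rand_B \<pi> = distr (measure_pmf (sampler n V)) borel (\<lambda>fs. real (to_nat fs))"
      by (simp add: \<pi> binning_protocol_def)
    then show ?thesis using mB[unfolded sets] by (simp add: measure_distr)
  qed
  also have "(\<lambda>fs. real (to_nat fs)) -` {b. ?o b = zs} = {fs. map (\<lambda>i. (fs ! i) (us ! i, map snd w ! i)) [0..<n] = zs}"
    by (auto simp: \<pi> binning_protocol_def us_def)
  finally show ?thesis .
qed

text \<open>After correct decoding the output law is exactly the ideal one; after a decoding error
  the two laws are at l1 distance at most 2.\<close>

lemma correctness_error_binning:
  "correctness_error P W n \<pi> \<le> 2 * measure_pmf.prob (replicate_pmf n P)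
    {w. dec (map snd w) (e (map (x_EQ P W) (map fst w))) \<noteq> map (x_EQ P W) (map fst w)}"
  (is "_ \<le> 2 * measure_pmf.prob ?q ?bad")
proof -
  let ?G = "\<lambda>us w zs. measure_pmf.prob (sampler n V) {fs. map (\<lambda>i. (fs ! i) (us ! i, map snd w ! i)) [0..<n] = zs}"
  have "correctness_error P W n \<pi> \<le> measure_pmf.expectation ?q (\<lambda>w. 2 * indicator ?bad w)"
    unfolding correctness_error_def
  proof (rule integral_mono_AE)
    have fin: "finite (set_pmf ?q)" by (rule finite_set_replicate_pmf) simp
    show "integrable (measure_pmf ?q) f" for f :: "_ \<Rightarrow> real" by (rule integrable_measure_pmf_finite[OF fin])
    then show "integrable (measure_pmf ?q) f" for f :: "_ \<Rightarrow> real" .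
    show "AE w in measure_pmf ?q. (\<Sum>zs | length zs = n. \<bar>output_prob P n \<pi> (map fst w) (map snd w) zs
        - ideal_prob W n (map fst w) (map snd w) zs\<bar>) \<le> 2 * indicator ?bad w"
      unfolding AE_measure_pmf_iff
    proof
      fix w assume w: "w \<in> set_pmf ?q"
      have len: "length w = n" by (rule length_replicate_pmf[OF w])
      let ?us = "dec (map snd w) (e (map (x_EQ P W) (map fst w)))" and ?vs = "map (x_EQ P W) (map fst w)"
      have ideal: "ideal_prob W n (map fst w) (map snd w) zs = ?G ?vs w zs" if "length zs = n" for zs
        unfolding prob_sampler[OF that] ideal_prob_def
      proof (rule prod.cong)
        fix i assume i: "i \<in> {..<n}"
        then have "w ! i \<in> set_pmf P" using nth_replicate_pmf_in[OF w] by simp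
        then have "V (x_EQ P W (fst (w ! i))) (snd (w ! i)) = W (fst (w ! i)) (snd (w ! i))"
          by (intro V[rule_format]) (simp add: pmf_positive)
        then show "pmf (W (map fst w ! i) (map snd w ! i)) (zs ! i) = pmf (V (?vs ! i) (map snd w ! i)) (zs ! i)"
          using i len by simp
      qed simp
      have "(\<Sum>zs | length zs = n. \<bar>output_prob P n \<pi> (map fst w) (map snd w) zs - ideal_prob W n (map fst w) (map snd w) zs\<bar>)
        = (\<Sum>zs | length zs = n. \<bar>?G ?us w zs - ?G ?vs w zs\<bar>)"
        by (rule sum.cong) (simp_all add: output_prob_binning[OF w] ideal)
      also have "\<dots> \<le> 2 * indicator ?bad w"
      proof (cases "w \<in> ?bad")
        case True
        have "(\<Sum>zs | length zs = n. \<bar>?G ?us w zs - ?G ?vs w zs\<bar>) \<le> (\<Sum>zs | length zs = n. ?G ?us w zs + ?G ?vs w zs)"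
          by (rule sum_mono) (simp add: abs_le_iff add_nonneg_nonneg measure_nonneg)
        also have "\<dots> \<le> 1 + 1" unfolding sum.distrib by (intro add_mono sum_sampler_le_1)
        finally show ?thesis using True by simp
      qed simp
      finally show "(\<Sum>zs | length zs = n. \<bar>output_prob P n \<pi> (map fst w) (map snd w) zs
        - ideal_prob W n (map fst w) (map snd w) zs\<bar>) \<le> 2 * indicator ?bad w" .
    qed
  qed
  then show ?thesis by simp
qed

lemma leakage_A_binning: "leakage_A P n \<pi> = 0"
proof -
  have "cond_ent (joint_pmf P n \<pi>) (\<lambda>(xs, ys, m, zs). (ys, zs)) (\<lambda>(xs, ys, m, zs). xs)
    = cond_ent (joint_pmf P n \<pi>) (\<lambda>(xs, ys, m, zs). (ys, zs)) (\<lambda>(xs, ys, m, zs). (m, xs))"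
    by (rule cond_ent_cong) (auto dest: transcript_determined)
  then show ?thesis by (simp add: leakage_A_eq[OF valid_binning])
qed

lemma leakage_B_binning:
  assumes T: "correctness_error P W n \<pi> \<le> T"
  shows "leakage_B P n \<pi> \<le> n * ent_dev (CARD(('x \<times> 'y) \<times> 'z)) T"
proof -
  let ?q = "joint_pmf P n \<pi>"
  let ?X = "\<lambda>(xs :: 'x list, ys :: 'y list, m :: bool list, zs :: 'z list). xs"
  let ?M = "\<lambda>(xs :: 'x list, ys :: 'y list, m :: bool list, zs :: 'z list). m"
  let ?YZ = "\<lambda>(xs :: 'x list, ys :: 'y list, m :: bool list, zs :: 'z list). (ys, zs)"
  let ?U = "\<lambda>(xs :: 'x list, ys :: 'y list, m :: bool list, zs :: 'z list). map (x_EQ P W) xs"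
  note fin = finite_image_determined[OF finite_range_joint[OF valid_binning, of P]]
  have fX: "finite (?X ` set_pmf ?q)" and fU: "finite (?U ` set_pmf ?q)" by (rule fin; auto)+
  have fM: "finite (?M ` set_pmf ?q)" by (rule fin) (auto dest!: transcript_determined)
  have "cond_ent ?q ?X ?YZ = cond_ent ?q (\<lambda>w. (?M w, ?X w)) ?YZ"
    by (rule cond_ent_cong) (auto dest!: transcript_determined)
  also have "\<dots> = cond_ent ?q ?M ?YZ + cond_ent ?q ?X (\<lambda>w. (?M w, ?YZ w))"
    by (rule cond_ent_chain[OF fM fX])
  finally have "leakage_B P n \<pi> = cond_ent ?q ?M ?YZ"
    unfolding leakage_B_eq[OF valid_binning] by (simp add: case_prod_unfold)
  also have "\<dots> \<le> cond_ent ?q ?U ?YZ"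
    by (rule cond_ent_mono_val[OF fM fU]) (auto dest!: transcript_determined)
  also have "\<dots> \<le> n * ent_dev (CARD(('x \<times> 'y) \<times> 'z)) T"
    by (rule cond_ent_x_EQ_outputs_le[OF valid_binning n T])
  finally show ?thesis .
qed

lemma protocol_rate_binning: "protocol_rate P n \<pi> = ennreal (L / n)"
proof -
  interpret E: prob_space "exec_space P n \<pi>" by (rule prob_space_exec_space[OF valid_binning])
  have "length (transcript_rv \<pi> w) = L" for w by (cases w) (simp add: transcript_rv_def e)
  then have "protocol_rate P n \<pi> = of_nat L / of_nat n"
    by (simp add: protocol_rate_def E.emeasure_space_1)
  also have "\<dots> = ennreal (L / n)"
    using n by (simp add: ennreal_of_nat_eq_real_of_nat divide_ennreal)
  finally show ?thesis .
qed

end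

lemma achievable_AS_above_entropy:
  fixes P :: "('x::finite \<times> 'y::finite) pmf" and W :: "'x \<Rightarrow> 'y \<Rightarrow> 'z::finite pmf"
  assumes comp: "computable_AS P W" and d: "d > 0"
  shows "achievable_AS P W (ennreal (entropy_XEQ_given_Y P W + 2 * d))"
proof -
  let ?H = "entropy_XEQ_given_Y P W" and ?K = "real (CARD(('x \<times> 'y) \<times> 'z))"
  define p where "p = map_pmf (\<lambda>(x, y). (x_EQ P W x, y)) P"
  \<comment> \<open>Bob knows only the class \<open>u\<close> and his letter \<open>y\<close>. He
    takes any \<open>x\<close> compatible with them; by \<open>computable_AS_structure\<close> the
    law of \<open>z\<close> does not depend on the choice.\<close>
  define V where "V u y = W (SOME x. x_EQ P W x = u \<and> pmf P (x, y) > 0) y" for u y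
  have V: "\<forall>x y. pmf P (x, y) > 0 \<longrightarrow> V (x_EQ P W x) y = W x y"
  proof (intro allI impI)
    fix x y assume that: "pmf P (x, y) > 0"
    let ?x' = "SOME x'. x_EQ P W x' = x_EQ P W x \<and> pmf P (x', y) > 0"
    have "x_EQ P W ?x' = x_EQ P W x \<and> pmf P (?x', y) > 0"
      using someI[of "\<lambda>x'. x_EQ P W x' = x_EQ P W x \<and> pmf P (x', y) > 0" x] that by simp
    then show "V (x_EQ P W x) y = W x y"
      unfolding V_def by (intro computable_AS_structure[OF comp _ _ that]) (simp_all add: x_EQ_representative)
  qed
  have H: "cond_ent p fst snd = ?H"
    unfolding p_def cond_ent_map entropy_XEQ_given_Y_eq
    by (simp add: case_prod_unfold)
  have H0: "?H \<ge> 0" unfolding entropy_XEQ_given_Y_eq by (rule cond_ent_nonneg)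
  define L where "L n = nat \<lfloor>n * (?H + 2 * d)\<rfloor>" for n :: nat
  define s where "s n = measure_pmf.variance p (\<lambda>w. log 2 (pmf (map_pmf snd p) (snd w) / pmf p w)) / (n * d\<^sup>2) + 2 * (2 powr - d) ^ n" for n :: nat
  let ?code = "\<lambda>n (e :: 'x list \<Rightarrow> bool list) dec. (\<forall>us. length (e us) = L n) \<and> measure_pmf.prob (replicate_pmf n P)
    {w. dec (map snd w) (e (map (x_EQ P W) (map fst w))) \<noteq> map (x_EQ P W) (map fst w)} \<le> s n"
  have "\<exists>e dec. n > 0 \<longrightarrow> ?code n e dec" for n
  proof (cases "n > 0")
    case True
    from slepian_wolf[OF d True, of p]
    obtain e :: "'x list \<Rightarrow> bool list" and dec where *: "\<forall>us. length (e us) = L n"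
      "measure_pmf.prob (replicate_pmf n p) {w. dec (map snd w) (e (map fst w)) \<noteq> map fst w} \<le> s n"
      unfolding H L_def s_def by blast
    have "measure_pmf.prob (replicate_pmf n p) {w. dec (map snd w) (e (map fst w)) \<noteq> map fst w}
      = measure_pmf.prob (replicate_pmf n P) {w. dec (map snd w) (e (map (x_EQ P W) (map fst w))) \<noteq> map (x_EQ P W) (map fst w)}"
      unfolding p_def map_map_replicate_pmf[symmetric] measure_map_pmf
      by (simp add: vimage_def comp_def case_prod_unfold)
    with * show ?thesis by (intro exI[of _ e] exI[of _ dec]) simp
  qed simp
  then have "\<forall>n. \<exists>e dec. n > 0 \<longrightarrow> ?code n e dec" ..
  from choice[OF this] obtain e where "\<forall>n. \<exists>dec. n > 0 \<longrightarrow> ?code n (e n) dec" ..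
  from choice[OF this] obtain dec where code: "\<forall>n. n > 0 \<longrightarrow> ?code n (e n) (dec n)" ..
  have code: "\<And>n us. n > 0 \<Longrightarrow> length (e n us) = L n"
    "\<And>n. n > 0 \<Longrightarrow> measure_pmf.prob (replicate_pmf n P)
      {w. dec n (map snd w) (e n (map (x_EQ P W) (map fst w))) \<noteq> map (x_EQ P W) (map fst w)} \<le> s n"
    using code by blast+
  define \<pi> where "\<pi> n = binning_protocol n (x_EQ P W) (e n) (dec n) (L n) V" for n
  have rate: "protocol_rate P n (\<pi> n) \<le> ennreal (?H + 2 * d)" if "n > 0" for n
  proof -
    have "real (L n) \<le> n * (?H + 2 * d)" unfolding L_def using H0 d by simp
    then have "L n / n \<le> ?H + 2 * d" using that by (simp add: field_simps)
    then show ?thesis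
      unfolding protocol_rate_binning[OF code(1)[OF that] that V \<pi>_def] by (rule ennreal_leI)
  qed
  \<comment> \<open>\<open>2 * s n\<close> bounds the correctness error, and the leakage to Bob per
    letter is at most \<open>ent_dev\<close> of the same quantity, so both vanish together.\<close>
  have s: "(\<lambda>n. 2 * s n) \<longlonglongrightarrow> 0"
  proof -
    have pow: "(\<lambda>n. (2 powr - d) ^ n) \<longlonglongrightarrow> 0"
    proof (rule LIMSEQ_power_zero)
      have "2 powr - d < 1" using d by (simp add: powr_def)
      then show "norm (2 powr - d) < 1" by simp
    qed
    have quot: "(\<lambda>n. c / (real n * d\<^sup>2)) \<longlonglongrightarrow> 0" for c :: real
      using lim_const_over_n[of "c / d\<^sup>2"] by (simp add: mult.commute)
    have "(\<lambda>n. 2 * s n) \<longlonglongrightarrow> 2 * (0 + 2 * 0)"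
      unfolding s_def by (intro tendsto_mult tendsto_add tendsto_const pow quot)
    then show ?thesis by simp
  qed
  have "\<exists>n>N. eps_secure P W n \<epsilon> (\<pi> n)" if "\<epsilon> > 0" for \<epsilon> N
  proof -
    have "\<forall>\<^sub>F n in sequentially. 2 * s n < \<epsilon>" using s that by (rule order_tendstoD)
    moreover have "\<forall>\<^sub>F n in sequentially. ent_dev ?K (2 * s n) < \<epsilon>"
      using ent_dev_tendsto[OF s] that by (rule order_tendstoD)
    ultimately have "\<forall>\<^sub>F n in sequentially. 2 * s n < \<epsilon> \<and> ent_dev ?K (2 * s n) < \<epsilon> \<and> n > N"
      using eventually_gt_at_top[of N] by eventually_elim simp
    then have "\<exists>n. 2 * s n < \<epsilon> \<and> ent_dev ?K (2 * s n) < \<epsilon> \<and> n > N"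
      by (rule eventually_happens'[OF sequentially_bot])
    then obtain n where n: "2 * s n < \<epsilon>" "ent_dev ?K (2 * s n) < \<epsilon>" "n > N" by blast
    then have n0: "n > 0" by simp
    note ctx = code(1)[OF n0] n0 V \<pi>_def[of n]
    have T: "correctness_error P W n (\<pi> n) \<le> 2 * s n"
      by (rule order_trans[OF correctness_error_binning[OF ctx]]) (use code(2)[OF n0] in simp)
    have "leakage_B P n (\<pi> n) \<le> n * ent_dev ?K (2 * s n)"
      by (rule leakage_B_binning[OF ctx T])
    also have "\<dots> \<le> n * \<epsilon>" using n by (intro mult_left_mono) auto
    finally have "eps_secure P W n \<epsilon> (\<pi> n)"
      using T n that by (simp add: eps_secure_def leakage_A_binning[OF ctx])
    with n show ?thesis by blast
  qed
  moreover have "valid_protocol n (\<pi> n)" if "n > 0" for n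
    by (rule valid_binning[OF code(1)[OF that] that V \<pi>_def])
  ultimately show ?thesis
    unfolding achievable_AS_def using rate by (intro exI[of _ \<pi>]) blast
qed

theorem theorem5:
  fixes P :: "('x::finite \<times> 'y::finite) pmf"
    and W :: "'x \<Rightarrow> 'y \<Rightarrow> 'z::finite pmf"
  assumes "set_pmf (map_pmf fst P) = UNIV"
    and "set_pmf (map_pmf snd P) = UNIV"
    and "set_pmf (bind_pmf P (\<lambda>(x, y). W x y)) = UNIV"
    and "computable_AS P W"
  shows "optimal_rate_AS P W = ennreal (entropy_XEQ_given_Y P W)"
proof (rule antisym)
  \<comment> \<open>Every rate strictly above the entropy is achievable; letting the gap tend to 0
    bounds the infimum.\<close>
  have "(\<lambda>k. ennreal (entropy_XEQ_given_Y P W + 2 * inverse (real (Suc k)))) \<longlonglongrightarrow> ennreal (entropy_XEQ_given_Y P W + 2 * 0)"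
    by (intro tendsto_ennrealI tendsto_intros LIMSEQ_inverse_real_of_nat)
  moreover have "optimal_rate_AS P W \<le> ennreal (entropy_XEQ_given_Y P W + 2 * inverse (real (Suc k)))" for k
    unfolding optimal_rate_AS_def
    by (rule Inf_lower, unfold mem_Collect_eq, rule achievable_AS_above_entropy[OF assms(4)]) simp
  ultimately have "optimal_rate_AS P W \<le> ennreal (entropy_XEQ_given_Y P W + 2 * 0)"
    by (intro LIMSEQ_le_const) auto
  then show "optimal_rate_AS P W \<le> ennreal (entropy_XEQ_given_Y P W)" by simp
  show "ennreal (entropy_XEQ_given_Y P W) \<le> optimal_rate_AS P W"
    unfolding optimal_rate_AS_def by (rule Inf_greatest) (simp add: achievable_AS_ge)
qed

end
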